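(* Let $p$ be a prime, $q$ a positive power of $p$, $X$ a Noetherian $F$-finite $\mathbf{F}_p$-scheme, and $\mathcal{I}\subset\mathcal{O}_X$ a quasi-coherent ideal sheaf that is locally generated by a single element. Let $M$ be an $F$-pure $q$-Cartier module on $X$. Then the following hold. (1) $$\nu_{\mathcal{I}}(q^\infty;M)\cap\bigl(\mathbf{Z}_{(p)}\cap[-1,0)\bigr)=-\Bigl(\mathrm{FJN}^-(M,\mathcal{I})\cap\mathbf{Z}_{(p)}\cap(0,1]\Bigr).$$ (2) $0\in\nu_{\mathcal{I}}(q^\infty;M)$ if and only if $0\in\mathrm{FJN}^+(M,\mathcal{I})$.
   Context: An $\mathbf{F}_p$-scheme is $F$-finite if its Frobenius is finite. A $q$-Cartier module on $X$ is a pair $(M,C)$ with $M$ an $\mathcal{O}_X$-module and $C\colon M\to M$ an additive endomorphism with $C(a^qx)=aC(x)$ for all local sections $a\in\mathcal{O}_X$, $x\in M$. It is $F$-pure if $M$ is coherent over $\mathcal{O}_X$ and $C(M)=M$. For an $\mathcal{O}_X$-submodule $N\subset M$ and $m\ge1$, $\nu_{\mathcal{I}}(q^m;N)=\{n\in\mathbf{Z}_{\ge0}\mid C^m(\mathcal{I}^nN)\ne C^m(\mathcal{I}^{n+1}N)\}$; $\nu_{\mathcal{I}}(q^\infty;N)$ is the set of all $\alpha\in\mathbf{Z}_p$ such that for every integer $m\ge1$ there is $n\in\nu_{\mathcal{I}}(q^m;N)$ with $\alpha-n\in q^m\mathbf{Z}_p$. For $M$ $F$-pure and real $t\ge0$,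 the test module is $\tau(M,\mathcal{I}^t)=\bigcup_{m\ge0}C^m(\mathcal{I}^{\lceil tq^m\rceil}M)$ (an increasing union, and $\tau$ is decreasing in $t$). $\mathrm{FJN}^+(M,\mathcal{I})$ is the set of real $t\ge0$ such that $\tau(M,\mathcal{I}^{t+\epsilon})\subsetneq\tau(M,\mathcal{I}^t)$ for all $\epsilon>0$. $\mathrm{FJN}^-(M,\mathcal{I})$ is the set of real $t>0$ such that $\tau(M,\mathcal{I}^t)\subsetneq\tau(M,\mathcal{I}^{t-\epsilon})$ for all $0<\epsilon<t$. $\mathbf{Z}_{(p)}=\mathbf{Z}_p\cap\mathbf{Q}$ is the ring of rationals with denominator prime to $p$, regarded inside both $\mathbf{Z}_p$ and $\mathbf{R}$. *)

theory Defs
  imports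
    "HOL-Analysis.Abstract_Topology"
    "HOL-Algebra.QuotRing"
    "HOL-Algebra.Ring_Divisibility"
    "HOL-Algebra.Module"
    "HOL-Computational_Algebra.Primes"
begin

section \<open>Ringed spaces and sheaves of modules\<close>

text \<open>Only the values of sections and restriction maps at open sets are meaningful. Letting the
  sections over all open sets share one carrier type is no restriction up to isomorphism.\<close>

record ('a, 'r) ringed_space =
  pts :: "'a topology"
  sec :: "'a set \<Rightarrow> 'r ring"
  res :: "'a set \<Rightarrow> 'a set \<Rightarrow> 'r \<Rightarrow> 'r"

record ('a, 'r, 'm) module_sheaf =
  msec :: "'a set \<Rightarrow> ('r, 'm) module"
  mres :: "'a set \<Rightarrow> 'a set \<Rightarrow> 'm \<Rightarrow> 'm"

definition is_sheaf :: "'a topology \<Rightarrow> ('a set \<Rightarrow> 'b set) \<Rightarrow> ('a set \<Rightarrow> 'a set \<Rightarrow> 'b \<Rightarrow> 'b) \<Rightarrow> bool"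
  where "is_sheaf T S \<rho> \<longleftrightarrow>
    (\<forall>U V. openin T U \<and> openin T V \<and> V \<subseteq> U \<longrightarrow> \<rho> U V \<in> S U \<rightarrow> S V) \<and>
    (\<forall>U. openin T U \<longrightarrow> (\<forall>s\<in>S U. \<rho> U U s = s)) \<and>
    (\<forall>U V W. openin T U \<and> openin T V \<and> openin T W \<and> W \<subseteq> V \<and> V \<subseteq> U \<longrightarrow>
       (\<forall>s\<in>S U. \<rho> V W (\<rho> U V s) = \<rho> U W s)) \<and>
    (\<forall>\<U> s. (\<forall>V\<in>\<U>. openin T V \<and> s V \<in> S V) \<and>
       (\<forall>V\<in>\<U>. \<forall>W\<in>\<U>. \<rho> V (V \<inter> W) (s V) = \<rho> W (V \<inter> W) (s W)) \<longrightarrow>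
       (\<exists>!t. t \<in> S (\<Union>\<U>) \<and> (\<forall>V\<in>\<U>. \<rho> (\<Union>\<U>) V t = s V)))"

definition is_ringed_space :: "('a, 'r) ringed_space \<Rightarrow> bool"
  where "is_ringed_space X \<longleftrightarrow>
    is_sheaf (pts X) (\<lambda>U. carrier (sec X U)) (res X) \<and>
    (\<forall>U. openin (pts X) U \<longrightarrow> cring (sec X U)) \<and>
    (\<forall>U V. openin (pts X) U \<and> openin (pts X) V \<and> V \<subseteq> U \<longrightarrow>
       res X U V \<in> ring_hom (sec X U) (sec X V))"

definition is_module_sheaf :: "('a, 'r) ringed_space \<Rightarrow> ('a, 'r, 'm) module_sheaf \<Rightarrow> bool"
  where "is_module_sheaf X M \<longleftrightarrow>
    is_sheaf (pts X) (\<lambda>U. carrier (msec M U)) (mres M) \<and>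
    (\<forall>U. openin (pts X) U \<longrightarrow> module (sec X U) (msec M U)) \<and>
    (\<forall>U V. openin (pts X) U \<and> openin (pts X) V \<and> V \<subseteq> U \<longrightarrow>
       (\<forall>x\<in>carrier (msec M U). \<forall>y\<in>carrier (msec M U).
          mres M U V (x \<oplus>\<^bsub>msec M U\<^esub> y) = mres M U V x \<oplus>\<^bsub>msec M V\<^esub> mres M U V y) \<and>
       (\<forall>a\<in>carrier (sec X U). \<forall>x\<in>carrier (msec M U).
          mres M U V (a \<odot>\<^bsub>msec M U\<^esub> x) = res X U V a \<odot>\<^bsub>msec M V\<^esub> mres M U V x))"

definition restrict_space_to :: "('a, 'r) ringed_space \<Rightarrow> 'a set \<Rightarrow> ('a, 'r) ringed_space"
  where "restrict_space_to X U = X\<lparr>pts := subtopology (pts X) U\<rparr>"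

definition preim :: "('a, 'r) ringed_space \<Rightarrow> ('a \<Rightarrow> 'b) \<Rightarrow> 'b set \<Rightarrow> 'a set"
  where "preim X f V = {x \<in> topspace (pts X). f x \<in> V}"

definition ringed_space_iso ::
  "('a, 'r) ringed_space \<Rightarrow> ('b, 's) ringed_space \<Rightarrow> ('a \<Rightarrow> 'b) \<Rightarrow> ('b set \<Rightarrow> 's \<Rightarrow> 'r) \<Rightarrow> bool"
  where "ringed_space_iso X Y f \<phi> \<longleftrightarrow>
    homeomorphic_map (pts X) (pts Y) f \<and>
    (\<forall>V. openin (pts Y) V \<longrightarrow> \<phi> V \<in> ring_iso (sec Y V) (sec X (preim X f V))) \<and>
    (\<forall>V W. openin (pts Y) V \<and> openin (pts Y) W \<and> W \<subseteq> V \<longrightarrow>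
       (\<forall>s\<in>carrier (sec Y V).
          res X (preim X f V) (preim X f W) (\<phi> V s) = \<phi> W (res Y V W s)))"

text \<open>Isomorphism of modules \<open>N\<close> on \<open>Y\<close> and \<open>M\<close> on \<open>X\<close> over an isomorphism
  \<open>(f, \<phi>)\<close> from \<open>X\<close> to \<open>Y\<close>.\<close>

definition module_sheaf_iso ::
  "('a, 'r) ringed_space \<Rightarrow> ('b, 's) ringed_space \<Rightarrow> ('a \<Rightarrow> 'b) \<Rightarrow> ('b set \<Rightarrow> 's \<Rightarrow> 'r) \<Rightarrow>
   ('a, 'r, 'm) module_sheaf \<Rightarrow> ('b, 's, 'n) module_sheaf \<Rightarrow> ('b set \<Rightarrow> 'n \<Rightarrow> 'm) \<Rightarrow> bool"
  where "module_sheaf_iso X Y f \<phi> M N \<psi> \<longleftrightarrow>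
    (\<forall>V. openin (pts Y) V \<longrightarrow>
       bij_betw (\<psi> V) (carrier (msec N V)) (carrier (msec M (preim X f V))) \<and>
       (\<forall>x\<in>carrier (msec N V). \<forall>y\<in>carrier (msec N V).
          \<psi> V (x \<oplus>\<^bsub>msec N V\<^esub> y) = \<psi> V x \<oplus>\<^bsub>msec M (preim X f V)\<^esub> \<psi> V y) \<and>
       (\<forall>a\<in>carrier (sec Y V). \<forall>x\<in>carrier (msec N V).
          \<psi> V (a \<odot>\<^bsub>msec N V\<^esub> x) = \<phi> V a \<odot>\<^bsub>msec M (preim X f V)\<^esub> \<psi> V x)) \<and>
    (\<forall>V W. openin (pts Y) V \<and> openin (pts Y) W \<and> W \<subseteq> V \<longrightarrow>
       (\<forall>x\<in>carrier (msec N V).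
          mres M (preim X f V) (preim X f W) (\<psi> V x) = \<psi> W (mres N V W x)))"


section \<open>Algebras as modules, finite generation\<close>

definition alg_module :: "('a \<Rightarrow> 'b) \<Rightarrow> ('b, 'x) ring_scheme \<Rightarrow> ('a, 'b) module"
  where "alg_module h B = \<lparr>carrier = carrier B, mult = mult B, one = one B, zero = zero B,
    add = add B, smult = (\<lambda>a b. h a \<otimes>\<^bsub>B\<^esub> b)\<rparr>"

abbreviation self_module :: "('a, 'x) ring_scheme \<Rightarrow> ('a, 'a) module"
  where "self_module A \<equiv> alg_module (\<lambda>a. a) A"

definition fin_gen_module :: "('a, 'x) ring_scheme \<Rightarrow> ('a, 'm, 'y) module_scheme \<Rightarrow> bool"
  where "fin_gen_module A M \<longleftrightarrow>
    (\<exists>S. finite S \<and> S \<subseteq> carrier M \<and>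
       (\<forall>x\<in>carrier M. \<exists>c\<in>S \<rightarrow> carrier A. x = (\<Oplus>\<^bsub>M\<^esub>s\<in>S. c s \<odot>\<^bsub>M\<^esub> s)))"


section \<open>Spectra and the sheaf associated with a module\<close>

definition zariski :: "('r, 'x) ring_scheme \<Rightarrow> 'r set topology"
  where "zariski A =
    topology (\<lambda>U. \<exists>S\<subseteq>carrier A. U = {P. primeideal P A \<and> \<not> S \<subseteq> P})"

lemma istopology_zariski:
  "istopology (\<lambda>U. \<exists>S\<subseteq>carrier A. U = {P. primeideal P A \<and> \<not> S \<subseteq> P})"
proof -
  define D where "D S = {P. primeideal P A \<and> \<not> S \<subseteq> P}" for S
  have inter: "\<exists>R\<subseteq>carrier A. D S \<inter> D T = D R" if S: "S \<subseteq> carrier A" and T: "T \<subseteq> carrier A" for S T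
  proof (intro exI conjI)
    let ?R = "{x \<in> carrier A. \<exists>s\<in>S. \<exists>t\<in>T. x = s \<otimes>\<^bsub>A\<^esub> t}"
    show "?R \<subseteq> carrier A" by simp
    show "D S \<inter> D T = D ?R"
    proof (rule Set.set_eqI)
      fix P
      show "P \<in> D S \<inter> D T \<longleftrightarrow> P \<in> D ?R"
      proof (cases "primeideal P A")
        case True
        then interpret primeideal P A .
        have "s \<otimes>\<^bsub>A\<^esub> t \<in> P \<longleftrightarrow> s \<in> P \<or> t \<in> P" if "s \<in> S" "t \<in> T" for s t
          using I_prime[of s t] I_l_closed[of t s] I_r_closed[of s t] that S T by auto
        moreover have "s \<otimes>\<^bsub>A\<^esub> t \<in> carrier A" if "s \<in> S" "t \<in> T" for s t
          using that S T by (auto intro: m_closed)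
        ultimately have "(\<exists>x\<in>?R. x \<notin> P) \<longleftrightarrow> (\<exists>s\<in>S. s \<notin> P) \<and> (\<exists>t\<in>T. t \<notin> P)"
          by simp metis
        then show ?thesis by (simp add: D_def True subset_iff Bex_def)
      qed (simp add: D_def)
    qed
  qed
  have union: "\<exists>R\<subseteq>carrier A. \<Union>\<K> = D R" if K: "\<forall>K\<in>\<K>. \<exists>S\<subseteq>carrier A. K = D S" for \<K>
  proof (intro exI conjI)
    let ?R = "\<Union>{S. S \<subseteq> carrier A \<and> D S \<in> \<K>}"
    show "?R \<subseteq> carrier A" by blast
    show "\<Union>\<K> = D ?R"
    proof (rule Set.set_eqI)
      fix P
      have "P \<in> \<Union>\<K> \<longleftrightarrow> (\<exists>S\<subseteq>carrier A. D S \<in> \<K> \<and> P \<in> D S)"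
        using K by (metis Union_iff)
      also have "\<dots> \<longleftrightarrow> P \<in> D ?R"
        by (auto simp: D_def)
      finally show "P \<in> \<Union>\<K> \<longleftrightarrow> P \<in> D ?R" .
    qed
  qed
  show ?thesis
    unfolding istopology_def D_def[symmetric] using inter union by auto
qed

lemma openin_zariski:
  "openin (zariski A) U \<longleftrightarrow> (\<exists>S\<subseteq>carrier A. U = {P. primeideal P A \<and> \<not> S \<subseteq> P})"
  unfolding zariski_def topology_inverse'[OF istopology_zariski] ..

text \<open>The fraction \<open>m/s\<close> in the localization \<open>M\<^sub>P\<close>, as the class of all pairs \<open>(n, t)\<close>
  with \<open>u (t m) = u (s n)\<close> for some \<open>u \<notin> P\<close>.\<close>

definition loc_frac ::
  "('r, 'x) ring_scheme \<Rightarrow> ('r, 'm, 'y) module_scheme \<Rightarrow> 'r set \<Rightarrow> 'm \<Rightarrow> 'r \<Rightarrow> ('m \<times> 'r) set"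
  where "loc_frac A M P m s =
    {(n, t). n \<in> carrier M \<and> t \<in> carrier A - P \<and>
       (\<exists>u\<in>carrier A - P. u \<odot>\<^bsub>M\<^esub> (t \<odot>\<^bsub>M\<^esub> m) = u \<odot>\<^bsub>M\<^esub> (s \<odot>\<^bsub>M\<^esub> n))}"

definition loc_module ::
  "('r, 'x) ring_scheme \<Rightarrow> ('r, 'm, 'y) module_scheme \<Rightarrow> 'r set \<Rightarrow>
   (('r \<times> 'r) set, ('m \<times> 'r) set) module"
  where "loc_module A M P =
    \<lparr>carrier = {loc_frac A M P m s | m s. m \<in> carrier M \<and> s \<in> carrier A - P},
     mult = undefined, one = undefined,
     zero = loc_frac A M P \<zero>\<^bsub>M\<^esub> \<one>\<^bsub>A\<^esub>,
     add = (\<lambda>x y. \<Union>(m, s)\<in>x. \<Union>(n, t)\<in>y.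
       loc_frac A M P (t \<odot>\<^bsub>M\<^esub> m \<oplus>\<^bsub>M\<^esub> s \<odot>\<^bsub>M\<^esub> n) (s \<otimes>\<^bsub>A\<^esub> t)),
     smult = (\<lambda>x y. \<Union>(a, s)\<in>x. \<Union>(m, t)\<in>y. loc_frac A M P (a \<odot>\<^bsub>M\<^esub> m) (s \<otimes>\<^bsub>A\<^esub> t))\<rparr>"

text \<open>The sheaf associated with an \<open>A\<close>-module \<open>M\<close>: sections over \<open>U\<close> assign to each prime
  \<open>P\<close> in \<open>U\<close> an element of \<open>M\<^sub>P\<close>, locally given by a single fraction.\<close>

definition tilde ::
  "('r, 'x) ring_scheme \<Rightarrow> ('r, 'm, 'y) module_scheme \<Rightarrow>
   ('r set, 'r set \<Rightarrow> ('r \<times> 'r) set, 'r set \<Rightarrow> ('m \<times> 'r) set) module_sheaf"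
  where "tilde A M =
    \<lparr>msec = (\<lambda>U.
       \<lparr>carrier = {\<sigma> \<in> extensional U. \<forall>P\<in>U. \<exists>V. openin (zariski A) V \<and> P \<in> V \<and> V \<subseteq> U \<and>
          (\<exists>m\<in>carrier M. \<exists>s\<in>carrier A. \<forall>Q\<in>V. s \<notin> Q \<and> \<sigma> Q = loc_frac A M Q m s)},
        mult = undefined, one = undefined,
        zero = (\<lambda>P\<in>U. \<zero>\<^bsub>loc_module A M P\<^esub>),
        add = (\<lambda>\<sigma> \<tau>. \<lambda>P\<in>U. \<sigma> P \<oplus>\<^bsub>loc_module A M P\<^esub> \<tau> P),
        smult = (\<lambda>\<alpha> \<sigma>. \<lambda>P\<in>U. \<alpha> P \<odot>\<^bsub>loc_module A M P\<^esub> \<sigma> P)\<rparr>),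
     mres = (\<lambda>U V \<sigma>. restrict \<sigma> V)\<rparr>"

definition Spec :: "('r, 'x) ring_scheme \<Rightarrow> ('r set, 'r set \<Rightarrow> ('r \<times> 'r) set) ringed_space"
  where "Spec A =
    (let \<O> = tilde A (self_module A) in
     \<lparr>pts = zariski A,
      sec = (\<lambda>U. \<lparr>carrier = carrier (msec \<O> U), mult = smult (msec \<O> U),
        one = (\<lambda>P\<in>U. loc_frac A (self_module A) P \<one>\<^bsub>A\<^esub> \<one>\<^bsub>A\<^esub>),
        zero = zero (msec \<O> U), add = add (msec \<O> U)\<rparr>),
      res = mres \<O>\<rparr>)"


section \<open>Schemes\<close>

text \<open>An affine open \<open>U\<close> is the spectrum of its own ring of sections, so the ring in a chart
  can be fixed to be that ring. Isomorphisms of ringed spaces induce isomorphisms of stalks, which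
  are automatically local.\<close>

definition affine_chart ::
  "('a, 'r) ringed_space \<Rightarrow> 'a set \<Rightarrow> ('a \<Rightarrow> 'r set) \<Rightarrow>
   ('r set set \<Rightarrow> ('r set \<Rightarrow> ('r \<times> 'r) set) \<Rightarrow> 'r) \<Rightarrow> bool"
  where "affine_chart X U f \<phi> \<longleftrightarrow>
    openin (pts X) U \<and> ringed_space_iso (restrict_space_to X U) (Spec (sec X U)) f \<phi>"

definition affine_open :: "('a, 'r) ringed_space \<Rightarrow> 'a set \<Rightarrow> bool"
  where "affine_open X U \<longleftrightarrow> (\<exists>f \<phi>. affine_chart X U f \<phi>)"

definition is_scheme :: "('a, 'r) ringed_space \<Rightarrow> bool"
  where "is_scheme X \<longleftrightarrow>
    is_ringed_space X \<and> (\<forall>x\<in>topspace (pts X). \<exists>U. x \<in> U \<and> affine_open X U)"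

definition noetherian_scheme :: "('a, 'r) ringed_space \<Rightarrow> bool"
  where "noetherian_scheme X \<longleftrightarrow>
    is_scheme X \<and>
    (\<exists>\<U>. finite \<U> \<and> \<Union>\<U> = topspace (pts X) \<and>
       (\<forall>U\<in>\<U>. affine_open X U \<and> noetherian_ring (sec X U)))"

definition Fp_scheme :: "nat \<Rightarrow> ('a, 'r) ringed_space \<Rightarrow> bool"
  where "Fp_scheme p X \<longleftrightarrow>
    is_scheme X \<and>
    (let A = sec X (topspace (pts X)) in ([p] \<cdot>\<^bsub>A\<^esub> \<one>\<^bsub>A\<^esub>) = \<zero>\<^bsub>A\<^esub>)"

text \<open>Finiteness of a morphism of schemes from \<open>X\<close> to \<open>Y\<close> given by \<open>f\<close> on points and by
  the ring homomorphisms \<open>\<phi> V\<close> from sections over \<open>V\<close> to sections over its preimage. That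
  \<open>(f, \<phi>)\<close> is a morphism is presupposed.\<close>

definition finite_morphism ::
  "('a, 'r) ringed_space \<Rightarrow> ('b, 's) ringed_space \<Rightarrow> ('a \<Rightarrow> 'b) \<Rightarrow> ('b set \<Rightarrow> 's \<Rightarrow> 'r) \<Rightarrow> bool"
  where "finite_morphism X Y f \<phi> \<longleftrightarrow>
    (\<forall>y\<in>topspace (pts Y). \<exists>V. y \<in> V \<and> affine_open Y V \<and> affine_open X (preim X f V) \<and>
       fin_gen_module (sec Y V) (alg_module (\<phi> V) (sec X (preim X f V))))"

text \<open>The absolute Frobenius is the identity on points and \<open>a \<mapsto> a\<^sup>p\<close> on sections.\<close>

definition F_finite :: "nat \<Rightarrow> ('a, 'r) ringed_space \<Rightarrow> bool"
  where "F_finite p X \<longleftrightarrow> finite_morphism X X id (\<lambda>U a. a [^]\<^bsub>sec X U\<^esub> p)"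


section \<open>Quasi-coherent and coherent modules, submodules, ideals\<close>

definition is_tilde_on ::
  "('a, 'r) ringed_space \<Rightarrow> 'a set \<Rightarrow> ('a, 'r, 'm) module_sheaf \<Rightarrow> ('r, 'm) module \<Rightarrow> bool"
  where "is_tilde_on X U M N \<longleftrightarrow>
    module (sec X U) N \<and>
    (\<exists>f \<phi> \<psi>. affine_chart X U f \<phi> \<and>
       module_sheaf_iso (restrict_space_to X U) (Spec (sec X U)) f \<phi> M (tilde (sec X U) N) \<psi>)"

definition quasi_coherent :: "('a, 'r) ringed_space \<Rightarrow> ('a, 'r, 'm) module_sheaf \<Rightarrow> bool"
  where "quasi_coherent X M \<longleftrightarrow>
    is_module_sheaf X M \<and>
    (\<forall>x\<in>topspace (pts X). \<exists>U N. x \<in> U \<and> is_tilde_on X U M N)"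

text \<open>This is the notion of coherence appropriate for locally Noetherian schemes.\<close>

definition coherent :: "('a, 'r) ringed_space \<Rightarrow> ('a, 'r, 'm) module_sheaf \<Rightarrow> bool"
  where "coherent X M \<longleftrightarrow>
    is_module_sheaf X M \<and>
    (\<forall>x\<in>topspace (pts X).
       \<exists>U N. x \<in> U \<and> is_tilde_on X U M N \<and> fin_gen_module (sec X U) N)"

text \<open>The subsheaf of \<open>M\<close> generated by a family \<open>F\<close> of sets of sections: the sections which
  locally belong to \<open>F\<close>. It is empty at sets that are not open, so that subsheaves arising in
  this way can be compared by \<open>=\<close>, \<open>\<le>\<close> and \<open><\<close> on functions.\<close>

definition sheaf_closure ::
  "('a, 'r) ringed_space \<Rightarrow> ('a, 'r, 'm) module_sheaf \<Rightarrow> ('a set \<Rightarrow> 'm set) \<Rightarrow> 'a set \<Rightarrow> 'm set"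
  where "sheaf_closure X M F U =
    {s \<in> carrier (msec M U). openin (pts X) U \<and>
       (\<forall>x\<in>U. \<exists>W. openin (pts X) W \<and> x \<in> W \<and> W \<subseteq> U \<and> mres M U W s \<in> F W)}"

definition submodule_sheaf ::
  "('a, 'r) ringed_space \<Rightarrow> ('a, 'r, 'm) module_sheaf \<Rightarrow> ('a set \<Rightarrow> 'm set) \<Rightarrow> bool"
  where "submodule_sheaf X M N \<longleftrightarrow>
    (\<forall>U. openin (pts X) U \<longrightarrow>
       submodule (N U) (sec X U) (msec M U) \<and> sheaf_closure X M N U = N U) \<and>
    (\<forall>U V. openin (pts X) U \<and> openin (pts X) V \<and> V \<subseteq> U \<longrightarrow> mres M U V \<in> N U \<rightarrow> N V)"

definition as_module_sheaf ::
  "('a, 'r, 'm) module_sheaf \<Rightarrow> ('a set \<Rightarrow> 'm set) \<Rightarrow> ('a, 'r, 'm) module_sheaf"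
  where "as_module_sheaf M N = M\<lparr>msec := (\<lambda>U. (msec M U)\<lparr>carrier := N U\<rparr>)\<rparr>"

definition structure_module :: "('a, 'r) ringed_space \<Rightarrow> ('a, 'r, 'r) module_sheaf"
  where "structure_module X = \<lparr>msec = (\<lambda>U. self_module (sec X U)), mres = res X\<rparr>"

abbreviation ideal_sheaf :: "('a, 'r) ringed_space \<Rightarrow> ('a set \<Rightarrow> 'r set) \<Rightarrow> bool"
  where "ideal_sheaf X I \<equiv> submodule_sheaf X (structure_module X) I"

definition quasi_coherent_ideal :: "('a, 'r) ringed_space \<Rightarrow> ('a set \<Rightarrow> 'r set) \<Rightarrow> bool"
  where "quasi_coherent_ideal X I \<longleftrightarrow>
    ideal_sheaf X I \<and> quasi_coherent X (as_module_sheaf (structure_module X) I)"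

definition locally_principal :: "('a, 'r) ringed_space \<Rightarrow> ('a set \<Rightarrow> 'r set) \<Rightarrow> bool"
  where "locally_principal X I \<longleftrightarrow>
    (\<forall>x\<in>topspace (pts X). \<exists>U. openin (pts X) U \<and> x \<in> U \<and> (\<exists>g\<in>I U.
       \<forall>V. openin (pts X) V \<and> V \<subseteq> U \<longrightarrow>
         I V = sheaf_closure X (structure_module X)
           (\<lambda>W. {a \<otimes>\<^bsub>sec X W\<^esub> res X U W g | a. a \<in> carrier (sec X W)}) V))"

definition product_sheaf ::
  "('a, 'r) ringed_space \<Rightarrow> ('a, 'r, 'm) module_sheaf \<Rightarrow> ('a set \<Rightarrow> 'r set) \<Rightarrow>
   ('a set \<Rightarrow> 'm set) \<Rightarrow> 'a set \<Rightarrow> 'm set"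
  where "product_sheaf X M I N =
    sheaf_closure X M (\<lambda>U. {(\<Oplus>\<^bsub>msec M U\<^esub>i\<in>{..<k::nat}. a i \<odot>\<^bsub>msec M U\<^esub> x i) | k a x.
       a \<in> {..<k} \<rightarrow> I U \<and> x \<in> {..<k} \<rightarrow> N U})"

primrec ideal_power :: "('a, 'r) ringed_space \<Rightarrow> ('a set \<Rightarrow> 'r set) \<Rightarrow> nat \<Rightarrow> 'a set \<Rightarrow> 'r set"
  where
    "ideal_power X I 0 = (\<lambda>U. carrier (sec X U))"
  | "ideal_power X I (Suc n) = product_sheaf X (structure_module X) I (ideal_power X I n)"

definition whole :: "('a, 'r, 'm) module_sheaf \<Rightarrow> 'a set \<Rightarrow> 'm set"
  where "whole M U = carrier (msec M U)"


section \<open>Cartier modules, test modules and jumping numbers\<close>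

definition cartier_module ::
  "nat \<Rightarrow> ('a, 'r) ringed_space \<Rightarrow> ('a, 'r, 'm) module_sheaf \<Rightarrow> ('a set \<Rightarrow> 'm \<Rightarrow> 'm) \<Rightarrow> bool"
  where "cartier_module q X M C \<longleftrightarrow>
    is_module_sheaf X M \<and>
    (\<forall>U. openin (pts X) U \<longrightarrow>
       C U \<in> carrier (msec M U) \<rightarrow> carrier (msec M U) \<and>
       (\<forall>x\<in>carrier (msec M U). \<forall>y\<in>carrier (msec M U).
          C U (x \<oplus>\<^bsub>msec M U\<^esub> y) = C U x \<oplus>\<^bsub>msec M U\<^esub> C U y) \<and>
       (\<forall>a\<in>carrier (sec X U). \<forall>x\<in>carrier (msec M U).
          C U ((a [^]\<^bsub>sec X U\<^esub> q) \<odot>\<^bsub>msec M U\<^esub> x) = a \<odot>\<^bsub>msec M U\<^esub> C U x)) \<and>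
    (\<forall>U V. openin (pts X) U \<and> openin (pts X) V \<and> V \<subseteq> U \<longrightarrow>
       (\<forall>x\<in>carrier (msec M U). mres M U V (C U x) = C V (mres M U V x)))"

text \<open>The image sheaf \<open>C\<^sup>m(N)\<close>, a subsheaf of \<open>M\<close>.\<close>

definition cartier_image ::
  "('a, 'r) ringed_space \<Rightarrow> ('a, 'r, 'm) module_sheaf \<Rightarrow> ('a set \<Rightarrow> 'm \<Rightarrow> 'm) \<Rightarrow> nat \<Rightarrow>
   ('a set \<Rightarrow> 'm set) \<Rightarrow> 'a set \<Rightarrow> 'm set"
  where "cartier_image X M C m N = sheaf_closure X M (\<lambda>U. (C U ^^ m) ` N U)"

definition F_pure ::
  "nat \<Rightarrow> ('a, 'r) ringed_space \<Rightarrow> ('a, 'r, 'm) module_sheaf \<Rightarrow> ('a set \<Rightarrow> 'm \<Rightarrow> 'm) \<Rightarrow> bool"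
  where "F_pure q X M C \<longleftrightarrow>
    cartier_module q X M C \<and> coherent X M \<and>
    (\<forall>U. openin (pts X) U \<longrightarrow> cartier_image X M C 1 (whole M) U = whole M U)"

text \<open>The prime power \<open>q\<close> enters \<open>nu\<close> only through \<open>C\<close>.\<close>

definition nu ::
  "('a, 'r) ringed_space \<Rightarrow> ('a, 'r, 'm) module_sheaf \<Rightarrow> ('a set \<Rightarrow> 'm \<Rightarrow> 'm) \<Rightarrow>
   ('a set \<Rightarrow> 'r set) \<Rightarrow> nat \<Rightarrow> ('a set \<Rightarrow> 'm set) \<Rightarrow> nat set"
  where "nu X M C I m N =
    {n. cartier_image X M C m (product_sheaf X M (ideal_power X I n) N) \<noteq>
        cartier_image X M C m (product_sheaf X M (ideal_power X I (n + 1)) N)}"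

text \<open>The ring of \<open>p\<close>-adic integers, as the inverse limit of the rings \<open>\<int>/p\<^sup>k\<int>\<close>.\<close>

definition Zp :: "nat \<Rightarrow> (nat \<Rightarrow> int) ring"
  where "Zp p =
    \<lparr>carrier = {a. \<forall>k. 0 \<le> a k \<and> a k < int p ^ k \<and> a (Suc k) mod int p ^ k = a k},
     mult = (\<lambda>a b k. (a k * b k) mod int p ^ k),
     one = (\<lambda>k. 1 mod int p ^ k),
     zero = (\<lambda>k. 0),
     add = (\<lambda>a b k. (a k + b k) mod int p ^ k)\<rparr>"

definition nu_inf ::
  "nat \<Rightarrow> nat \<Rightarrow> ('a, 'r) ringed_space \<Rightarrow> ('a, 'r, 'm) module_sheaf \<Rightarrow> ('a set \<Rightarrow> 'm \<Rightarrow> 'm) \<Rightarrow>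
   ('a set \<Rightarrow> 'r set) \<Rightarrow> ('a set \<Rightarrow> 'm set) \<Rightarrow> (nat \<Rightarrow> int) set"
  where "nu_inf p q X M C I N =
    {\<alpha> \<in> carrier (Zp p). \<forall>m\<ge>1. \<exists>n\<in>nu X M C I m N. \<exists>\<beta>\<in>carrier (Zp p).
       \<alpha> \<ominus>\<^bsub>Zp p\<^esub> ([n] \<cdot>\<^bsub>Zp p\<^esub> \<one>\<^bsub>Zp p\<^esub>) = ([(q ^ m)] \<cdot>\<^bsub>Zp p\<^esub> \<beta>)}"

definition test_module ::
  "nat \<Rightarrow> ('a, 'r) ringed_space \<Rightarrow> ('a, 'r, 'm) module_sheaf \<Rightarrow> ('a set \<Rightarrow> 'm \<Rightarrow> 'm) \<Rightarrow>
   ('a set \<Rightarrow> 'r set) \<Rightarrow> real \<Rightarrow> 'a set \<Rightarrow> 'm set"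
  where "test_module q X M C I t =
    sheaf_closure X M (\<lambda>U. \<Union>m. cartier_image X M C m
      (product_sheaf X M (ideal_power X I (nat \<lceil>t * real q ^ m\<rceil>)) (whole M)) U)"

definition FJN_plus ::
  "nat \<Rightarrow> ('a, 'r) ringed_space \<Rightarrow> ('a, 'r, 'm) module_sheaf \<Rightarrow> ('a set \<Rightarrow> 'm \<Rightarrow> 'm) \<Rightarrow>
   ('a set \<Rightarrow> 'r set) \<Rightarrow> real set"
  where "FJN_plus q X M C I =
    {t. t \<ge> 0 \<and> (\<forall>\<epsilon>>0. test_module q X M C I (t + \<epsilon>) < test_module q X M C I t)}"

definition FJN_minus ::
  "nat \<Rightarrow> ('a, 'r) ringed_space \<Rightarrow> ('a, 'r, 'm) module_sheaf \<Rightarrow> ('a set \<Rightarrow> 'm \<Rightarrow> 'm) \<Rightarrow>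
   ('a set \<Rightarrow> 'r set) \<Rightarrow> real set"
  where "FJN_minus q X M C I =
    {t. t > 0 \<and> (\<forall>\<epsilon>. 0 < \<epsilon> \<and> \<epsilon> < t \<longrightarrow>
       test_module q X M C I t < test_module q X M C I (t - \<epsilon>))}"

definition Z_loc :: "nat \<Rightarrow> rat set"
  where "Z_loc p = {r. \<not> int p dvd snd (quotient_of r)}"

text \<open>The inclusion of \<open>Z_loc p\<close> into \<open>Zp p\<close>: the fraction \<open>a/b\<close> in lowest terms goes to
  the unique solution \<open>x\<close> of \<open>b x = a\<close>.\<close>

definition Zp_of_rat :: "nat \<Rightarrow> rat \<Rightarrow> (nat \<Rightarrow> int)"
  where "Zp_of_rat p r =
    (THE x. x \<in> carrier (Zp p) \<and>
       [snd (quotient_of r)] \<cdot>\<^bsub>Zp p\<^esub> x = [fst (quotient_of r)] \<cdot>\<^bsub>Zp p\<^esub> \<one>\<^bsub>Zp p\<^esub>)"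

end

theory Submission
  imports Defs "HOL-Number_Theory.Residues"
begin

text \<open>
  Write \<open>\<tau>(t)\<close> for the test module. Where a section \<open>g\<close> generates the ideal, \<open>C\<^sup>m(I\<^sup>n M)\<close> consists of
  the sections that are locally of the form \<open>C\<^sup>m (g\<^sup>n z)\<close>, and everything that depends on the ideal being
  locally principal comes from \<open>C (g\<^bsup>qk\<^esup> z) = g\<^sup>k C z\<close>. Together with \<open>C(M) = M\<close> this identity gives
  \<open>C\<^bsup>m+1\<^esup>(I\<^bsup>nq\<^esup> M) = C\<^sup>m(I\<^sup>n M)\<close>, so that \<open>C\<^sup>m(I\<^sup>n M) = \<tau>(n/q\<^sup>m)\<close> and \<open>n \<in> \<nu>(q\<^sup>m)\<close> means that \<open>\<tau>\<close> drops
  between \<open>n/q\<^sup>m\<close> and \<open>(n+1)/q\<^sup>m\<close> (\<open>power_image_Suc\<close>, \<open>test_module_fraction\<close>). It also shows that an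
  equality \<open>C\<^sup>m(I\<^sup>n M) = C\<^sup>m(I\<^bsup>n+1\<^esup> M)\<close> persists when \<open>m\<close> grows and when a multiple of \<open>q\<^sup>m\<close> is added to
  \<open>n\<close> (\<open>power_image_shift\<close>). Hence a \<open>p\<close>-adic integer lies in \<open>\<nu>(q\<^sup>\<infinity>)\<close> as soon as its residues modulo
  arbitrarily large powers of \<open>q\<close> lie in the sets \<open>\<nu>(q\<^sup>m)\<close>.

  For the \<open>p\<close>-adic integer \<open>0\<close> this condition is \<open>\<tau>(1/q\<^sup>m) \<noteq> \<tau>(0)\<close> for all \<open>m\<close>, which is the second claim.
  For \<open>-t\<close> with \<open>t = a/b\<close> in \<open>(0, 1]\<close> and \<open>p\<close> prime to \<open>b\<close>, choose \<open>s\<close> with \<open>q\<^sup>s \<equiv> 1\<close> modulo \<open>b\<close>. The residue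
  of \<open>-t\<close> modulo \<open>q\<^bsup>sl\<^esup>\<close> is \<open>t (q\<^bsup>sl\<^esup> - 1)\<close>, and the condition is that \<open>\<tau>\<close> drops between
  \<open>t - t/q\<^bsup>sl\<^esup>\<close> and \<open>t + (1-t)/q\<^bsup>sl\<^esup>\<close> for all \<open>l\<close>. These intervals shrink to \<open>t\<close> and always reach
  strictly to the left of \<open>t\<close>, so a jump of \<open>\<tau>\<close> at \<open>t\<close> from the left is seen by all of them. For the converse
  one needs that \<open>\<tau>\<close> has no jump at \<open>t\<close> to the right (\<open>residues_iff\<close>). If \<open>t = 1\<close> then the intervals end at
  \<open>t\<close>. Otherwise \<open>t\<close> is not a fraction with denominator a power of \<open>q\<close>, so \<open>\<tau>(t)\<close> is the increasing union
  of the modules \<open>\<tau>(u)\<close> at the numbers \<open>u = \<lceil>t q\<^sup>k\<rceil>/q\<^sup>k > t\<close>, and it has to be shown that this union is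
  attained.

  Only the following case is needed: a subsheaf \<open>C\<^sup>m(I\<^sup>n M)\<close> of the union is contained in one of its
  members (\<open>test_module_attained\<close>). Since \<open>X\<close> is quasi-compact, it suffices that \<open>C\<^sup>m(I\<^sup>n M)\<close> is locally
  generated by finitely many sections. If \<open>s\<^sub>i\<close> generate \<open>M\<close> and \<open>b\<^sub>j\<close> generate the structure sheaf over
  its \<open>q\<^sup>m\<close>-th powers, as they do on small open sets because \<open>M\<close> is coherent and \<open>X\<close> is \<open>F\<close>-finite,
  then the sections \<open>C\<^sup>m (g\<^sup>n b\<^sub>j s\<^sub>i)\<close> generate \<open>C\<^sup>m(I\<^sup>n M)\<close>.
\<close>

section \<open>Divisibility in the p-adic integers\<close>

lemma Zp_simps:
  "carrier (Zp p) = {a. \<forall>k. 0 \<le> a k \<and> a k < int p ^ k \<and> a (Suc k) mod int p ^ k = a k}"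
  "a \<oplus>\<^bsub>Zp p\<^esub> b = (\<lambda>k. (a k + b k) mod int p ^ k)"
  "\<one>\<^bsub>Zp p\<^esub> = (\<lambda>k. 1 mod int p ^ k)"
  "\<zero>\<^bsub>Zp p\<^esub> = (\<lambda>k. 0)"
  by (simp_all add: Zp_def)

lemma Zp_carrierI:
  assumes "p > 0" and "\<And>k. [f (Suc k) = f k] (mod int p ^ k)"
  shows "(\<lambda>k. f k mod int p ^ k) \<in> carrier (Zp p)"
proof -
  have "(f (Suc k) mod int p ^ Suc k) mod int p ^ k = f k mod int p ^ k" for k
    using assms(2)[of k] by (simp add: cong_def mod_mod_cancel)
  then show ?thesis using assms(1) by (simp add: Zp_simps)
qed

lemma Zp_mod_eq: "a \<in> carrier (Zp p) \<Longrightarrow> a k mod int p ^ k = a k"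
  by (simp add: Zp_simps)

lemma Zp_cong_Suc: "a \<in> carrier (Zp p) \<Longrightarrow> [a (Suc k) = a k] (mod int p ^ k)"
  by (simp add: Zp_simps cong_def)

lemma Zp_cong_add:
  assumes "a \<in> carrier (Zp p)" shows "[a (k + j) = a k] (mod int p ^ k)"
proof (induction j)
  case (Suc j)
  have "[a (Suc (k + j)) = a (k + j)] (mod int p ^ k)"
    using Zp_cong_Suc[OF assms, of "k + j"]
    by (rule cong_dvd_modulus) (simp add: le_imp_power_dvd)
  with Suc show ?case by (metis add_Suc_right cong_trans)
qed simp

lemma Zp_abelian_group:
  assumes "p > 0" shows "abelian_group (Zp p)"
proof (rule abelian_groupI)
  fix x y assume x: "x \<in> carrier (Zp p)" and y: "y \<in> carrier (Zp p)"
  show "x \<oplus>\<^bsub>Zp p\<^esub> y \<in> carrier (Zp p)"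
    unfolding Zp_simps(2)
    by (rule Zp_carrierI[OF assms]) (intro cong_add Zp_cong_Suc x y)
  show "x \<oplus>\<^bsub>Zp p\<^esub> y = y \<oplus>\<^bsub>Zp p\<^esub> x"
    by (simp add: Zp_simps add.commute)
  fix z assume "z \<in> carrier (Zp p)"
  show "x \<oplus>\<^bsub>Zp p\<^esub> y \<oplus>\<^bsub>Zp p\<^esub> z = x \<oplus>\<^bsub>Zp p\<^esub> (y \<oplus>\<^bsub>Zp p\<^esub> z)"
    by (simp add: Zp_simps mod_simps add.assoc)
next
  show "\<zero>\<^bsub>Zp p\<^esub> \<in> carrier (Zp p)" using assms by (simp add: Zp_simps)
next
  fix x assume x: "x \<in> carrier (Zp p)"
  then show "\<zero>\<^bsub>Zp p\<^esub> \<oplus>\<^bsub>Zp p\<^esub> x = x" using Zp_mod_eq[OF x] by (simp add: Zp_simps(2,4))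
  show "\<exists>y\<in>carrier (Zp p). y \<oplus>\<^bsub>Zp p\<^esub> x = \<zero>\<^bsub>Zp p\<^esub>"
  proof
    show "(\<lambda>k. (- x k) mod int p ^ k) \<in> carrier (Zp p)"
      by (rule Zp_carrierI[OF assms]) (simp add: cong_minus_minus_iff Zp_cong_Suc x)
    show "(\<lambda>k. (- x k) mod int p ^ k) \<oplus>\<^bsub>Zp p\<^esub> x = \<zero>\<^bsub>Zp p\<^esub>"
      by (simp add: Zp_simps mod_simps)
  qed
qed

lemma Zp_neg:
  assumes "p > 0" and x: "x \<in> carrier (Zp p)"
  shows "\<ominus>\<^bsub>Zp p\<^esub> x = (\<lambda>k. (- x k) mod int p ^ k)"
proof -
  interpret abelian_group "Zp p" by (rule Zp_abelian_group[OF assms(1)])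
  show ?thesis
  proof (rule minus_equality)
    show "(\<lambda>k. (- x k) mod int p ^ k) \<in> carrier (Zp p)"
      by (rule Zp_carrierI[OF assms(1)]) (simp add: cong_minus_minus_iff Zp_cong_Suc x)
    show "(\<lambda>k. (- x k) mod int p ^ k) \<oplus>\<^bsub>Zp p\<^esub> x = \<zero>\<^bsub>Zp p\<^esub>"
      by (simp add: Zp_simps mod_simps)
  qed fact
qed

lemma Zp_nat_multiple:
  assumes "p > 0" and x: "x \<in> carrier (Zp p)"
  shows "[(n :: nat)] \<cdot>\<^bsub>Zp p\<^esub> x = (\<lambda>k. (int n * x k) mod int p ^ k)"
proof -
  interpret abelian_group "Zp p" by (rule Zp_abelian_group[OF assms(1)])
  show ?thesis
  proof (induction n)
    case (Suc n)
    have "[(Suc n)] \<cdot>\<^bsub>Zp p\<^esub> x = [n] \<cdot>\<^bsub>Zp p\<^esub> x \<oplus>\<^bsub>Zp p\<^esub> x"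
      using x by simp
    also have "\<dots> = (\<lambda>k. (int (Suc n) * x k) mod int p ^ k)"
      unfolding Suc by (simp add: Zp_simps mod_simps algebra_simps)
    finally show ?case .
  qed (simp add: Zp_simps)
qed

lemma Zp_int_multiple:
  assumes "p > 0" and x: "x \<in> carrier (Zp p)"
  shows "[(n :: int)] \<cdot>\<^bsub>Zp p\<^esub> x = (\<lambda>k. (n * x k) mod int p ^ k)"
proof -
  interpret abelian_group "Zp p" by (rule Zp_abelian_group[OF assms(1)])
  show ?thesis
  proof (cases "n \<ge> 0")
    case True
    then show ?thesis by (simp add: add_pow_int_ge Zp_nat_multiple[OF assms])
  next
    case False
    have "[(nat (- n))] \<cdot>\<^bsub>Zp p\<^esub> x \<in> carrier (Zp p)" using x by simp
    then show ?thesis using False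
      by (simp add: add_pow_int_lt Zp_neg[OF assms(1)] Zp_nat_multiple[OF assms] mod_simps)
  qed
qed

lemma Zp_one_closed: "p > 0 \<Longrightarrow> \<one>\<^bsub>Zp p\<^esub> \<in> carrier (Zp p)"
  unfolding Zp_simps(3) by (rule Zp_carrierI) simp_all

lemma Zp_nat: "p > 0 \<Longrightarrow> [(n :: nat)] \<cdot>\<^bsub>Zp p\<^esub> \<one>\<^bsub>Zp p\<^esub> = (\<lambda>k. int n mod int p ^ k)"
  by (simp add: Zp_nat_multiple[OF _ Zp_one_closed]) (simp add: Zp_simps mod_simps)

lemma Zp_int: "p > 0 \<Longrightarrow> [(n :: int)] \<cdot>\<^bsub>Zp p\<^esub> \<one>\<^bsub>Zp p\<^esub> = (\<lambda>k. n mod int p ^ k)"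
  by (simp add: Zp_int_multiple[OF _ Zp_one_closed]) (simp add: Zp_simps mod_simps)

lemma Zp_minus_nat:
  assumes "p > 0" and x: "x \<in> carrier (Zp p)"
  shows "x \<ominus>\<^bsub>Zp p\<^esub> ([(n :: nat)] \<cdot>\<^bsub>Zp p\<^esub> \<one>\<^bsub>Zp p\<^esub>) = (\<lambda>k. (x k - int n) mod int p ^ k)"
proof -
  interpret abelian_group "Zp p" by (rule Zp_abelian_group[OF assms(1)])
  have "[n] \<cdot>\<^bsub>Zp p\<^esub> \<one>\<^bsub>Zp p\<^esub> \<in> carrier (Zp p)"
    using Zp_one_closed[OF assms(1)] by simp
  then show ?thesis
    by (simp add: minus_eq Zp_neg[OF assms(1)] Zp_nat[OF assms(1)] Zp_simps(2) mod_simps)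
qed

text \<open>If the \<open>j\<close>-th coordinate of \<open>x - n\<close> vanishes then the quotient by \<open>p\<^sup>j\<close> has the coordinates
  \<open>(x (k + j) - n) div p\<^sup>j\<close>, shifted by \<open>j\<close> because division by \<open>p\<^sup>j\<close> costs \<open>j\<close> digits.\<close>

lemma Zp_dvd_iff:
  assumes "p > 0" and x: "x \<in> carrier (Zp p)"
  shows "(\<exists>\<beta>\<in>carrier (Zp p). x \<ominus>\<^bsub>Zp p\<^esub> ([(n :: nat)] \<cdot>\<^bsub>Zp p\<^esub> \<one>\<^bsub>Zp p\<^esub>) = [(p ^ j)] \<cdot>\<^bsub>Zp p\<^esub> \<beta>) \<longleftrightarrow>
    int p ^ j dvd x j - int n"
proof
  assume "\<exists>\<beta>\<in>carrier (Zp p). x \<ominus>\<^bsub>Zp p\<^esub> ([n] \<cdot>\<^bsub>Zp p\<^esub> \<one>\<^bsub>Zp p\<^esub>) = [(p ^ j)] \<cdot>\<^bsub>Zp p\<^esub> \<beta>"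
  then obtain \<beta> where "\<beta> \<in> carrier (Zp p)"
    and eq: "x \<ominus>\<^bsub>Zp p\<^esub> ([n] \<cdot>\<^bsub>Zp p\<^esub> \<one>\<^bsub>Zp p\<^esub>) = [(p ^ j)] \<cdot>\<^bsub>Zp p\<^esub> \<beta>" by blast
  then have "(x j - int n) mod int p ^ j = (int (p ^ j) * \<beta> j) mod int p ^ j"
    using Zp_minus_nat[OF assms, of n] Zp_nat_multiple[OF assms(1), of \<beta> "p ^ j"] by metis
  then show "int p ^ j dvd x j - int n" by (simp add: dvd_eq_mod_eq_0)
next
  assume dvd: "int p ^ j dvd x j - int n"
  \<comment> \<open>The quotient, with coordinates not yet reduced modulo \<open>p\<^sup>k\<close>.\<close>
  define d where "d k = (x (k + j) - int n) div int p ^ j" for k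
  have "int p ^ j dvd x (k + j) - int n" for k
  proof -
    have "[x (k + j) - int n = x j - int n] (mod int p ^ j)"
      using Zp_cong_add[OF x, of j k] by (simp add: add.commute cong_diff)
    with dvd show ?thesis using cong_dvd_iff by blast
  qed
  then have d: "x (k + j) = int n + int p ^ j * d k" for k by (simp add: d_def)
  have "[d (Suc k) = d k] (mod int p ^ k)" for k
  proof -
    have "int p ^ (k + j) dvd x (Suc k + j) - x (k + j)"
      using Zp_cong_Suc[OF x, of "k + j"] by (simp add: cong_iff_dvd_diff)
    then have "int p ^ j * int p ^ k dvd int p ^ j * (d (Suc k) - d k)"
      by (simp only: d) (simp add: power_add algebra_simps)
    then show ?thesis using assms(1) by (simp add: cong_iff_dvd_diff)
  qed
  then have "(\<lambda>k. d k mod int p ^ k) \<in> carrier (Zp p)" (is "?b \<in> _")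
    by (rule Zp_carrierI[OF assms(1)])
  moreover have "x \<ominus>\<^bsub>Zp p\<^esub> ([n] \<cdot>\<^bsub>Zp p\<^esub> \<one>\<^bsub>Zp p\<^esub>) = [(p ^ j)] \<cdot>\<^bsub>Zp p\<^esub> ?b"
  proof -
    have "(x k - int n) mod int p ^ k = (int p ^ j * d k) mod int p ^ k" for k
    proof -
      have "[x k - int n = x (k + j) - int n] (mod int p ^ k)"
        using cong_sym[OF Zp_cong_add[OF x, of k j]] by (simp add: cong_diff)
      then show ?thesis by (simp add: d cong_def)
    qed
    then show ?thesis
      using calculation by (simp add: Zp_minus_nat[OF assms] Zp_nat_multiple[OF assms(1)] mod_simps)
  qed
  ultimately show "\<exists>\<beta>\<in>carrier (Zp p). x \<ominus>\<^bsub>Zp p\<^esub> ([n] \<cdot>\<^bsub>Zp p\<^esub> \<one>\<^bsub>Zp p\<^esub>) = [(p ^ j)] \<cdot>\<^bsub>Zp p\<^esub> \<beta>"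
    by blast
qed

text \<open>The denominator is prime to \<open>p\<close>, hence invertible modulo every \<open>p\<^sup>k\<close>. The solutions modulo the
  various \<open>p\<^sup>k\<close> are unique, therefore compatible.\<close>

lemma Zp_of_rat:
  assumes p: "Factorial_Ring.prime p" and r: "r \<in> Z_loc p" and ab: "quotient_of r = (a, b)"
  shows "Zp_of_rat p r \<in> carrier (Zp p)" and "[b * Zp_of_rat p r k = a] (mod int p ^ k)"
proof -
  have p0: "p > 0" using p by (simp add: prime_gt_0_nat)
  have cop: "coprime b (int p ^ k)" for k
    using r p ab prime_imp_coprime[of "int p" b] by (simp add: Z_loc_def coprime_commute)
  then have "\<forall>k. \<exists>s. [b * s = 1] (mod int p ^ k)"
    using cong_solve_coprime_int by blast
  then have "\<exists>s. \<forall>k. [b * s k = 1] (mod int p ^ k)"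
    by (rule choice)
  then obtain s where s: "\<And>k. [b * s k = 1] (mod int p ^ k)"
    by blast
  define x where "x k = (a * s k) mod int p ^ k" for k
  have bx: "[b * (a * s k) = a] (mod int p ^ k)" for k
    using cong_scalar_left[OF s[of k], of a] by (simp add: ac_simps)
  have xc: "x \<in> carrier (Zp p)" unfolding x_def
  proof (rule Zp_carrierI[OF p0])
    fix k
    have "[b * (a * s (Suc k)) = a] (mod int p ^ k)"
      using bx[of "Suc k"] by (rule cong_dvd_modulus) simp
    with bx[of k] have "[b * (a * s (Suc k)) = b * (a * s k)] (mod int p ^ k)"
      using cong_sym cong_trans by blast
    then show "[a * s (Suc k) = a * s k] (mod int p ^ k)"
      using cop[of k] by (simp add: cong_mult_lcancel)
  qed
  have xb: "[b * x k = a] (mod int p ^ k)" for k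
    using bx[of k] by (simp add: x_def cong_def mod_simps)
  have eqv: "[b] \<cdot>\<^bsub>Zp p\<^esub> y = [a] \<cdot>\<^bsub>Zp p\<^esub> \<one>\<^bsub>Zp p\<^esub> \<longleftrightarrow> (\<forall>k. [b * y k = a] (mod int p ^ k))"
    if "y \<in> carrier (Zp p)" for y
    by (simp add: Zp_int[OF p0] Zp_int_multiple[OF p0 that] cong_def fun_eq_iff)
  have uniq: "y = x" if y: "y \<in> carrier (Zp p)" "\<forall>k. [b * y k = a] (mod int p ^ k)" for y
  proof
    fix k
    have "[b * y k = b * x k] (mod int p ^ k)"
      by (rule cong_trans[OF y(2)[rule_format] cong_sym[OF xb]])
    then have "[y k = x k] (mod int p ^ k)" using cop[of k] by (simp add: cong_mult_lcancel)
    then show "y k = x k"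
      using Zp_mod_eq[OF y(1), of k] Zp_mod_eq[OF xc, of k] by (simp add: cong_def)
  qed
  have "Zp_of_rat p r = x"
    unfolding Zp_of_rat_def ab fst_conv snd_conv
  proof (rule the_equality)
    show "x \<in> carrier (Zp p) \<and> [b] \<cdot>\<^bsub>Zp p\<^esub> x = [a] \<cdot>\<^bsub>Zp p\<^esub> \<one>\<^bsub>Zp p\<^esub>"
      using xc xb eqv[OF xc] by blast
  next
    fix y assume "y \<in> carrier (Zp p) \<and> [b] \<cdot>\<^bsub>Zp p\<^esub> y = [a] \<cdot>\<^bsub>Zp p\<^esub> \<one>\<^bsub>Zp p\<^esub>"
    then show "y = x" using uniq eqv by blast
  qed
  then show "Zp_of_rat p r \<in> carrier (Zp p)" "[b * Zp_of_rat p r k = a] (mod int p ^ k)"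
    using xc xb by simp_all
qed

lemma Zp_of_rat_dvd_iff:
  assumes p: "Factorial_Ring.prime p" and r: "r \<in> Z_loc p" and ab: "quotient_of r = (a, b)"
  shows "(\<exists>\<beta>\<in>carrier (Zp p). Zp_of_rat p r \<ominus>\<^bsub>Zp p\<^esub> ([(n :: nat)] \<cdot>\<^bsub>Zp p\<^esub> \<one>\<^bsub>Zp p\<^esub>) = [(p ^ j)] \<cdot>\<^bsub>Zp p\<^esub> \<beta>) \<longleftrightarrow>
    int p ^ j dvd a - b * int n"
proof -
  let ?x = "Zp_of_rat p r j"
  have p0: "p > 0" using p by (simp add: prime_gt_0_nat)
  have cop: "coprime (int p ^ j) b"
    using r p ab prime_imp_coprime[of "int p" b] by (simp add: Z_loc_def)
  have "int p ^ j dvd ?x - int n \<longleftrightarrow> int p ^ j dvd b * (?x - int n)"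
    using cop by (simp add: coprime_dvd_mult_right_iff)
  also have "\<dots> \<longleftrightarrow> int p ^ j dvd a - b * int n"
  proof (rule cong_dvd_iff)
    show "[b * (?x - int n) = a - b * int n] (mod int p ^ j)"
      using cong_diff[OF Zp_of_rat(2)[OF assms, of j] cong_refl] by (simp add: right_diff_distrib)
  qed
  finally show ?thesis using Zp_dvd_iff[OF p0 Zp_of_rat(1)[OF assms]] by simp
qed

section \<open>Jumps at rational numbers with denominator prime to p\<close>

text \<open>The comparison of the two kinds of jumping numbers uses only the following properties of the
  submodules \<open>N m n = C\<^sup>m(I\<^sup>n M)\<close> and of the test modules \<open>\<tau> t\<close>. The last one is a finiteness property: a
  member of the family contained in the union that defines \<open>\<tau> t\<close> is contained in a term of this union.\<close>

locale jumping_family =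
  fixes p q e :: nat and N :: "nat \<Rightarrow> nat \<Rightarrow> 'b::order" and \<tau> :: "real \<Rightarrow> 'b"
  assumes prime: "Factorial_Ring.prime p" and e: "e > 0" and q: "q = p ^ e"
    and antimono: "\<lbrakk>0 \<le> s; s \<le> t\<rbrakk> \<Longrightarrow> \<tau> t \<le> \<tau> s"
    and at_fraction: "\<tau> (real n / real q ^ m) = N m n"
    and shift: "N m n = N m (n + 1) \<Longrightarrow> N (m + j) (n + k * q ^ m) = N (m + j) (n + k * q ^ m + 1)"
    and compact: "\<lbrakk>0 \<le> t; N m n \<le> \<tau> t\<rbrakk> \<Longrightarrow> \<exists>k. N m n \<le> N k (nat \<lceil>t * real q ^ k\<rceil>)"
begin

lemma q_gt_1: "q > 1"
  unfolding q using prime e by (intro one_less_power) (simp_all add: prime_gt_Suc_0_nat)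

lemma q_power_large: "\<exists>m\<ge>m0. x / real q ^ (s * m) < \<epsilon>" if "\<epsilon> > 0" "s > 0"
proof -
  have "(\<lambda>m. x / (real q ^ s) ^ m) \<longlonglongrightarrow> 0"
    using q_gt_1 that(2) by (intro LIMSEQ_divide_realpow_zero) (simp add: one_less_power)
  then have "\<forall>\<^sub>F m in sequentially. x / (real q ^ s) ^ m < \<epsilon>"
    using that(1) by (rule order_tendstoD)
  then obtain m1 where "\<forall>m\<ge>m1. x / (real q ^ s) ^ m < \<epsilon>"
    by (auto simp: eventually_sequentially)
  then show ?thesis by (intro exI[of _ "max m0 m1"]) (simp add: power_mult)
qed

text \<open>By periodicity the multiple \<open>k q\<^sup>m\<close> can be replaced by \<open>0\<close>, and \<open>N m 0 \<noteq> N m 1\<close> says that \<open>\<tau>\<close> drops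
  between \<open>0\<close> and \<open>1/q\<^sup>m\<close>.\<close>

lemma multiples_of_q_iff:
  "(\<forall>m\<ge>1. \<exists>k. N m (k * q ^ m) \<noteq> N m (k * q ^ m + 1)) \<longleftrightarrow> (\<forall>\<epsilon>>0. \<tau> \<epsilon> < \<tau> 0)"
proof
  assume *: "\<forall>m\<ge>1. \<exists>k. N m (k * q ^ m) \<noteq> N m (k * q ^ m + 1)"
  have ne: "N m 0 \<noteq> N m 1" if m: "m \<ge> 1" for m
    using * m shift[of m 0 0] by fastforce
  show "\<forall>\<epsilon>>0. \<tau> \<epsilon> < \<tau> 0"
  proof (intro allI impI)
    fix \<epsilon> :: real assume "\<epsilon> > 0"
    then obtain m where m: "m \<ge> 1" "1 / real q ^ m < \<epsilon>"
      using q_power_large[of \<epsilon> 1 1 1] by auto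
    have "\<tau> (1 / real q ^ m) \<noteq> \<tau> 0"
      using ne[OF m(1)] at_fraction[of 1 m] at_fraction[of 0 m] by simp
    moreover have "\<tau> \<epsilon> \<le> \<tau> (1 / real q ^ m)" "\<tau> (1 / real q ^ m) \<le> \<tau> 0"
      using m(2) by (auto intro!: antimono)
    ultimately show "\<tau> \<epsilon> < \<tau> 0" by order
  qed
next
  assume *: "\<forall>\<epsilon>>0. \<tau> \<epsilon> < \<tau> 0"
  have "N m 0 \<noteq> N m 1" for m
    using *[rule_format, of "1 / real q ^ m"] q_gt_1 at_fraction[of 1 m] at_fraction[of 0 m] by simp
  then show "\<forall>m\<ge>1. \<exists>k. N m (k * q ^ m) \<noteq> N m (k * q ^ m + 1)"
    by (metis add_0 mult_0)
qed

text \<open>The divisibility says that \<open>n\<close> is congruent to \<open>-t\<close> modulo \<open>q\<^sup>m\<close>. The smallest such \<open>n\<close> is explicit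
  when \<open>m\<close> is a multiple of the order of \<open>q\<close> modulo \<open>b\<close>, and by the shift property only these \<open>m\<close> and \<open>n\<close>
  matter.\<close>

lemma residues_iff:
  assumes ab: "0 < a" "a \<le> b" "\<not> p dvd b" "coprime a b" and t: "t = real a / real b"
  shows "(\<forall>m\<ge>1. \<exists>n. N m n \<noteq> N m (n + 1) \<and> q ^ m dvd a + b * n) \<longleftrightarrow>
    (\<forall>\<epsilon>. 0 < \<epsilon> \<and> \<epsilon> < t \<longrightarrow> \<tau> t < \<tau> (t - \<epsilon>))"
proof -
  have b0: "b > 0" and t01: "0 < t" "t \<le> 1" using ab t by auto
  have q0: "real q > 1" using q_gt_1 by simp
  have cop: "coprime p b" using prime ab(3) by (simp add: prime_imp_coprime)
  then have copq: "coprime q b" by (simp add: q)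
  \<comment> \<open>Any exponent with \<open>q\<^sup>s \<equiv> 1\<close> modulo \<open>b\<close> will do.\<close>
  define s where "s = totient b"
  have s0: "s > 0" using b0 by (simp add: s_def)
  have dvd: "b dvd q ^ (s * l) - 1" for l
  proof -
    have "[(q ^ s) ^ l = 1 ^ l] (mod b)"
      using euler_theorem[OF copq] by (intro cong_pow) (simp add: s_def)
    then show ?thesis
      using q_gt_1 by (simp add: power_mult cong_altdef_nat)
  qed
  \<comment> \<open>The residue \<open>t (q\<^bsup>sl\<^esup> - 1)\<close> of \<open>-t\<close> modulo \<open>q\<^bsup>sl\<^esup>\<close>.\<close>
  define \<rho> where "\<rho> l = a * ((q ^ (s * l) - 1) div b)" for l
  have b\<rho>: "b * \<rho> l = a * (q ^ (s * l) - 1)" for l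
    unfolding \<rho>_def using dvd[of l] by auto
  then have b\<rho>': "a + b * \<rho> l = a * q ^ (s * l)" for l
    using q_gt_1 by (simp add: algebra_simps)
  have \<rho>: "real (\<rho> l) / real q ^ (s * l) = t - t / real q ^ (s * l)" 
    and \<rho>1: "real (\<rho> l + 1) / real q ^ (s * l) = t + (1 - t) / real q ^ (s * l)" for l
  proof -
    have "real a + real b * real (\<rho> l) = real a * real q ^ (s * l)"
      using b\<rho>'[of l, THEN arg_cong[where f = real]] by simp
    then have "real (\<rho> l) = t * (real q ^ (s * l) - 1)"
      using b0 by (simp add: t field_simps)
    then show "real (\<rho> l) / real q ^ (s * l) = t - t / real q ^ (s * l)"
      "real (\<rho> l + 1) / real q ^ (s * l) = t + (1 - t) / real q ^ (s * l)"
      using q0 by (simp_all add: field_simps)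
  qed
  have \<rho>_less: "\<rho> l < q ^ (s * l)" for l
  proof -
    have "b * \<rho> l \<le> b * (q ^ (s * l) - 1)" unfolding b\<rho> using ab(2) by simp
    then have "\<rho> l \<le> q ^ (s * l) - 1" using b0 by simp
    moreover have "0 < q ^ (s * l)" using q_gt_1 by simp
    ultimately show ?thesis by linarith
  qed
  show ?thesis
  proof
    assume *: "\<forall>m\<ge>1. \<exists>n. N m n \<noteq> N m (n + 1) \<and> q ^ m dvd a + b * n"
    have ne: "N (s * l) (\<rho> l) \<noteq> N (s * l) (\<rho> l + 1)" if l: "l \<ge> 1" for l
    proof
      assume eq: "N (s * l) (\<rho> l) = N (s * l) (\<rho> l + 1)"
      have "s * l \<ge> 1" using s0 l by (simp add: Suc_leI)
      then obtain n where n: "N (s * l) n \<noteq> N (s * l) (n + 1)" "q ^ (s * l) dvd a + b * n"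
        using * by blast
      have "[a + b * n = a + b * \<rho> l] (mod q ^ (s * l))"
        using n(2) unfolding b\<rho>' by (simp add: cong_def)
      then have "[n = \<rho> l] (mod q ^ (s * l))"
        using copq by (simp add: cong_add_lcancel_nat cong_mult_lcancel_nat coprime_commute)
      then have "n mod q ^ (s * l) = \<rho> l" using \<rho>_less[of l] by (simp add: cong_def)
      then have "n = \<rho> l + (n div q ^ (s * l)) * q ^ (s * l)"
        by (metis add.commute div_mult_mod_eq)
      then show False using n(1) shift[OF eq, of 0 "n div q ^ (s * l)"] by simp
    qed
    show "\<forall>\<epsilon>. 0 < \<epsilon> \<and> \<epsilon> < t \<longrightarrow> \<tau> t < \<tau> (t - \<epsilon>)"
    proof (intro allI impI, rule ccontr)
      fix \<epsilon> assume \<epsilon>: "0 < \<epsilon> \<and> \<epsilon> < t" and "\<not> \<tau> t < \<tau> (t - \<epsilon>)"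
      then have \<tau>eq: "\<tau> (t - \<epsilon>) = \<tau> t"
        using antimono[of "t - \<epsilon>" t] by (simp add: order_less_le)
      obtain l1 where l1: "l1 \<ge> 1" "t / real q ^ (s * l1) < \<epsilon>"
        using q_power_large[of \<epsilon> s 1 t] \<epsilon> s0 by auto
      have "N (s * l1) (\<rho> l1) \<le> \<tau> t"
        unfolding at_fraction[symmetric] \<rho> \<tau>eq[symmetric] using \<epsilon> l1 by (intro antimono) auto
      then obtain k where k: "N (s * l1) (\<rho> l1) \<le> N k (nat \<lceil>t * real q ^ k\<rceil>)"
        using compact t01 by (meson less_imp_le)
      \<comment> \<open>\<open>\<tau>\<close> is constant from \<open>t - \<epsilon>\<close> to \<open>u\<close>, and the intervals are eventually contained in \<open>[t - \<epsilon>, u]\<close>.\<close>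
      define u where "u = real (nat \<lceil>t * real q ^ k\<rceil>) / real q ^ k"
      have tq: "t * real q ^ k \<le> real (nat \<lceil>t * real q ^ k\<rceil>)" by (rule real_nat_ceiling_ge)
      have u: "t \<le> u" unfolding u_def using tq q0 by (simp add: le_divide_eq)
      have "\<exists>l2\<ge>l1. t + (1 - t) / real q ^ (s * l2) \<le> u"
      proof (cases "t = 1")
        case True
        then show ?thesis using u by auto
      next
        case False
        \<comment> \<open>If \<open>t = u\<close> then \<open>b\<close> divides \<open>a q\<^sup>k\<close>, hence \<open>b = 1\<close> and \<open>t = 1\<close>.\<close>
        have "t \<noteq> u"
        proof
          assume "t = u"
          then have "real a * real q ^ k = real b * real (nat \<lceil>t * real q ^ k\<rceil>)"
            unfolding t u_def using q0 b0 by (simp add: field_simps)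
          then have "a * q ^ k = b * nat \<lceil>t * real q ^ k\<rceil>"
            by (metis of_nat_eq_iff of_nat_mult of_nat_power)
          then have "b dvd a * q ^ k" by simp
          then have "b dvd a"
            using copq by (simp add: coprime_dvd_mult_left_iff coprime_commute)
          then have "b = 1" using ab(4) coprime_common_divisor_nat[of a b b] by simp
          with ab have "a = b" by simp
          then show False using False b0 t by simp
        qed
        with u have "u - t > 0" by simp
        then show ?thesis using q_power_large[of "u - t" s l1 "1 - t"] s0 by force
      qed
      then obtain l2 where l2: "l2 \<ge> l1" "t + (1 - t) / real q ^ (s * l2) \<le> u" by blast
      have "N (s * l2) (\<rho> l2) \<le> N (s * l1) (\<rho> l1)"
        unfolding at_fraction[symmetric] \<rho>
        using t01 q0 l2(1) \<epsilon> l1(2)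
        by (intro antimono diff_left_mono divide_left_mono power_increasing) auto
      also have "\<dots> \<le> \<tau> u" using k unfolding at_fraction[symmetric] u_def .
      also have "\<dots> \<le> N (s * l2) (\<rho> l2 + 1)"
        unfolding at_fraction[symmetric] \<rho>1 using t01 l2(2) q0 by (intro antimono) auto
      also have "\<dots> \<le> N (s * l2) (\<rho> l2)"
        unfolding at_fraction[symmetric] using q0 by (intro antimono divide_right_mono) auto
      finally show False using ne[of l2] l1 l2 by simp
    qed
  next
    assume *: "\<forall>\<epsilon>. 0 < \<epsilon> \<and> \<epsilon> < t \<longrightarrow> \<tau> t < \<tau> (t - \<epsilon>)"
    show "\<forall>m\<ge>1. \<exists>n. N m n \<noteq> N m (n + 1) \<and> q ^ m dvd a + b * n"
    proof (intro allI impI)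
      fix m :: nat assume m: "m \<ge> 1"
      have sm: "m \<le> s * m" "s * m > 0" using s0 m by simp_all
      have "real q ^ (s * m) > 1" using q0 sm(2) by (simp add: one_less_power)
      then have "\<tau> t < \<tau> (t - t / real q ^ (s * m))"
        using t01 q0 by (intro *[rule_format]) (simp add: divide_less_eq)
      moreover have "\<tau> (t + (1 - t) / real q ^ (s * m)) \<le> \<tau> t"
        using t01 by (intro antimono) auto
      ultimately have "N (s * m) (\<rho> m) \<noteq> N (s * m) (\<rho> m + 1)"
        unfolding at_fraction[symmetric] \<rho> \<rho>1 by auto
      then have "N m (\<rho> m) \<noteq> N m (\<rho> m + 1)"
        using shift[of m "\<rho> m" "s * m - m" 0] sm by auto
      moreover have "q ^ m dvd a + b * \<rho> m"
        unfolding b\<rho>' using sm(1) by (simp add: le_imp_power_dvd dvd_mult)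
      ultimately show "\<exists>n. N m n \<noteq> N m (n + 1) \<and> q ^ m dvd a + b * n" by blast
    qed
  qed
qed

end

section \<open>Subpresheaves and the subsheaves they generate\<close>

lemma is_sheafD:
  assumes "is_sheaf T S \<rho>"
  shows "\<lbrakk>openin T U; openin T V; V \<subseteq> U; s \<in> S U\<rbrakk> \<Longrightarrow> \<rho> U V s \<in> S V"
    and "\<lbrakk>openin T U; s \<in> S U\<rbrakk> \<Longrightarrow> \<rho> U U s = s"
    and "\<lbrakk>openin T U; openin T V; openin T W; W \<subseteq> V; V \<subseteq> U; s \<in> S U\<rbrakk> \<Longrightarrow>
      \<rho> V W (\<rho> U V s) = \<rho> U W s"
  using assms unfolding is_sheaf_def by (simp_all add: Pi_iff)

text \<open>A section belongs to the subsheaf generated by \<open>F\<close> if it does so locally. Thus inclusions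
  between generated subsheaves are checked on sections of \<open>F\<close> and after shrinking the open set. The
  rules below express this for all sheaves constructed later.\<close>

locale sheaf_of_modules =
  fixes X :: "('a, 'r) ringed_space" and M :: "('a, 'r, 'm) module_sheaf"
  assumes ringed_space: "is_ringed_space X" and module_sheaf: "is_module_sheaf X M"
begin

abbreviation opn :: "'a set \<Rightarrow> bool" where "opn U \<equiv> openin (pts X) U"

abbreviation cl :: "('a set \<Rightarrow> 'm set) \<Rightarrow> 'a set \<Rightarrow> 'm set" where "cl \<equiv> sheaf_closure X M"

lemma cring_sec: "opn U \<Longrightarrow> cring (sec X U)"
  using ringed_space by (simp add: is_ringed_space_def)

lemma module_sec: "opn U \<Longrightarrow> module (sec X U) (msec M U)"
  using module_sheaf by (simp add: is_module_sheaf_def)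

lemma res_hom: "\<lbrakk>opn U; opn V; V \<subseteq> U\<rbrakk> \<Longrightarrow> res X U V \<in> ring_hom (sec X U) (sec X V)"
  using ringed_space by (simp add: is_ringed_space_def)

lemma res_closed:
  "\<lbrakk>opn U; opn V; V \<subseteq> U; a \<in> carrier (sec X U)\<rbrakk> \<Longrightarrow> res X U V a \<in> carrier (sec X V)"
  using ring_hom_closed[OF res_hom] .

lemma res_res:
  "\<lbrakk>opn U; opn V; opn W; W \<subseteq> V; V \<subseteq> U; a \<in> carrier (sec X U)\<rbrakk> \<Longrightarrow>
    res X V W (res X U V a) = res X U W a"
  using ringed_space is_sheafD(3)[of "pts X" "\<lambda>U. carrier (sec X U)" "res X" U V W a] by (simp add: is_ringed_space_def)

lemma res_self: "\<lbrakk>opn U; a \<in> carrier (sec X U)\<rbrakk> \<Longrightarrow> res X U U a = a"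
  using ringed_space is_sheafD(2)[of "pts X" "\<lambda>U. carrier (sec X U)" "res X" U a] by (simp add: is_ringed_space_def)

lemma res_pow:
  assumes "opn U" "opn V" "V \<subseteq> U" "a \<in> carrier (sec X U)"
  shows "res X U V (a [^]\<^bsub>sec X U\<^esub> (n :: nat)) = res X U V a [^]\<^bsub>sec X V\<^esub> n"
proof -
  interpret A: cring "sec X U" using assms(1) by (rule cring_sec)
  interpret B: cring "sec X V" using assms(2) by (rule cring_sec)
  interpret ring_hom_cring "sec X U" "sec X V" "res X U V"
    by unfold_locales (rule res_hom[OF assms(1-3)])
  show ?thesis using assms(4) by (induction n) auto
qed

lemma mres_closed:
  "\<lbrakk>opn U; opn V; V \<subseteq> U; x \<in> carrier (msec M U)\<rbrakk> \<Longrightarrow> mres M U V x \<in> carrier (msec M V)"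
  using module_sheaf is_sheafD(1)[of "pts X" "\<lambda>U. carrier (msec M U)" "mres M" U V x] by (simp add: is_module_sheaf_def)

lemma mres_mres:
  "\<lbrakk>opn U; opn V; opn W; W \<subseteq> V; V \<subseteq> U; x \<in> carrier (msec M U)\<rbrakk> \<Longrightarrow>
    mres M V W (mres M U V x) = mres M U W x"
  using module_sheaf is_sheafD(3)[of "pts X" "\<lambda>U. carrier (msec M U)" "mres M" U V W x] by (simp add: is_module_sheaf_def)

lemma mres_self: "\<lbrakk>opn U; x \<in> carrier (msec M U)\<rbrakk> \<Longrightarrow> mres M U U x = x"
  using module_sheaf is_sheafD(2)[of "pts X" "\<lambda>U. carrier (msec M U)" "mres M" U x] by (simp add: is_module_sheaf_def)

lemma mres_add:
  "\<lbrakk>opn U; opn V; V \<subseteq> U; x \<in> carrier (msec M U); y \<in> carrier (msec M U)\<rbrakk> \<Longrightarrow>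
    mres M U V (x \<oplus>\<^bsub>msec M U\<^esub> y) = mres M U V x \<oplus>\<^bsub>msec M V\<^esub> mres M U V y"
  using module_sheaf by (simp add: is_module_sheaf_def)

lemma mres_smult:
  "\<lbrakk>opn U; opn V; V \<subseteq> U; a \<in> carrier (sec X U); x \<in> carrier (msec M U)\<rbrakk> \<Longrightarrow>
    mres M U V (a \<odot>\<^bsub>msec M U\<^esub> x) = res X U V a \<odot>\<^bsub>msec M V\<^esub> mres M U V x"
  using module_sheaf by (simp add: is_module_sheaf_def)

lemma mres_zero:
  assumes "opn U" "opn V" "V \<subseteq> U"
  shows "mres M U V \<zero>\<^bsub>msec M U\<^esub> = \<zero>\<^bsub>msec M V\<^esub>"
proof -
  interpret A: module "sec X U" "msec M U" using assms(1) by (rule module_sec)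
  interpret B: module "sec X V" "msec M V" using assms(2) by (rule module_sec)
  let ?z = "mres M U V \<zero>\<^bsub>msec M U\<^esub>"
  have "?z \<oplus>\<^bsub>msec M V\<^esub> ?z = ?z"
    using mres_add[OF assms, of "\<zero>\<^bsub>msec M U\<^esub>" "\<zero>\<^bsub>msec M U\<^esub>"] by simp
  moreover have "?z \<in> carrier (msec M V)" by (rule mres_closed[OF assms]) simp
  ultimately show ?thesis by (metis B.M.add.r_cancel_one)
qed

text \<open>Compatibility with restriction is required only inside \<open>G\<close>, since most of the presheaves that occur
  are written with sections that exist only over a small open set.\<close>

definition subpresheaf :: "'a set \<Rightarrow> ('a set \<Rightarrow> 'm set) \<Rightarrow> bool"
  where "subpresheaf G F \<longleftrightarrow>
    (\<forall>V. opn V \<and> V \<subseteq> G \<longrightarrow> F V \<subseteq> carrier (msec M V) \<and>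
      (\<forall>W. opn W \<and> W \<subseteq> V \<longrightarrow> mres M V W ` F V \<subseteq> F W))"

lemma subpresheafD:
  assumes "subpresheaf G F" "opn V" "V \<subseteq> G" "s \<in> F V"
  shows "s \<in> carrier (msec M V)" "\<lbrakk>opn W; W \<subseteq> V\<rbrakk> \<Longrightarrow> mres M V W s \<in> F W"
  using assms unfolding subpresheaf_def by blast+

lemma closure_carrier: "cl F U \<subseteq> carrier (msec M U)"
  by (auto simp: sheaf_closure_def)

lemma closure_opn: "s \<in> cl F U \<Longrightarrow> opn U"
  by (auto simp: sheaf_closure_def)

lemma closureI:
  assumes "opn U" "s \<in> carrier (msec M U)"
    and "\<And>x. x \<in> U \<Longrightarrow> \<exists>W. opn W \<and> x \<in> W \<and> W \<subseteq> U \<and> mres M U W s \<in> F W"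
  shows "s \<in> cl F U"
  using assms by (auto simp: sheaf_closure_def)

lemma closureE:
  assumes "s \<in> cl F U" "x \<in> U"
  obtains W where "opn W" "x \<in> W" "W \<subseteq> U" "mres M U W s \<in> F W"
  using assms by (auto simp: sheaf_closure_def)

lemma closureI_section:
  assumes "opn U" "s \<in> carrier (msec M U)" "s \<in> F U" shows "s \<in> cl F U"
  using assms by (intro closureI) (auto intro!: exI[of _ U] simp: mres_self)

text \<open>Belonging locally to a generated subsheaf is belonging locally to the generators, so generating is
  idempotent.\<close>

lemma closureI_closure:
  assumes "opn U" "s \<in> carrier (msec M U)"
    and "\<And>x. x \<in> U \<Longrightarrow> \<exists>W. opn W \<and> x \<in> W \<and> W \<subseteq> U \<and> mres M U W s \<in> cl F W"
  shows "s \<in> cl F U"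
proof (rule closureI[OF assms(1,2)])
  fix x assume "x \<in> U"
  then obtain W where W: "opn W" "x \<in> W" "W \<subseteq> U" "mres M U W s \<in> cl F W"
    using assms(3) by blast
  then obtain V where "opn V" "x \<in> V" "V \<subseteq> W" "mres M W V (mres M U W s) \<in> F V"
    by (meson closureE)
  then show "\<exists>W. opn W \<and> x \<in> W \<and> W \<subseteq> U \<and> mres M U W s \<in> F W"
    using W assms(1,2) mres_mres[of U W V s] by (metis order_trans)
qed

lemma closure_least:
  assumes "\<And>W s. \<lbrakk>opn W; W \<subseteq> U; s \<in> F W; s \<in> carrier (msec M W)\<rbrakk> \<Longrightarrow> s \<in> cl F' W"
  shows "cl F U \<subseteq> cl F' U"
proof
  fix s assume s: "s \<in> cl F U"
  have U: "opn U" "s \<in> carrier (msec M U)" using closure_opn[OF s] s closure_carrier by blast+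
  show "s \<in> cl F' U"
  proof (rule closureI_closure[OF U])
    fix x assume "x \<in> U"
    with s obtain W where W: "opn W" "x \<in> W" "W \<subseteq> U" "mres M U W s \<in> F W" by (rule closureE)
    then show "\<exists>W. opn W \<and> x \<in> W \<and> W \<subseteq> U \<and> mres M U W s \<in> cl F' W"
      using assms[OF W(1,3,4)] mres_closed[OF U(1) W(1,3) U(2)] by blast
  qed
qed

lemma closure_mono:
  assumes "\<And>W. \<lbrakk>opn W; W \<subseteq> U\<rbrakk> \<Longrightarrow> F W \<subseteq> F' W"
  shows "cl F U \<subseteq> cl F' U"
  using assms by (intro closure_least closureI_section) auto

lemma closure_restrict:
  assumes F: "subpresheaf G F" and "U \<subseteq> G" and s: "s \<in> cl F U"
    and V: "opn V" "V \<subseteq> U"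
  shows "mres M U V s \<in> cl F V"
proof -
  have U: "opn U" "s \<in> carrier (msec M U)" using closure_opn[OF s] s closure_carrier by blast+
  show ?thesis
  proof (rule closureI[OF V(1) mres_closed[OF U(1) V U(2)]])
    fix x assume x: "x \<in> V"
    then obtain W where W: "opn W" "x \<in> W" "W \<subseteq> U" "mres M U W s \<in> F W"
      using s V by (meson closureE subsetD)
    have o: "opn (W \<inter> V)" using W V by auto
    have "mres M W (W \<inter> V) (mres M U W s) \<in> F (W \<inter> V)"
      using W assms(2) o by (intro subpresheafD(2)[OF F W(1)]) auto
    then have "mres M V (W \<inter> V) (mres M U V s) \<in> F (W \<inter> V)"
      using U V W o by (simp add: mres_mres)
    then show "\<exists>W. opn W \<and> x \<in> W \<and> W \<subseteq> V \<and> mres M V W (mres M U V s) \<in> F W"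
      using x W o by blast
  qed
qed

lemma subpresheaf_closure: "subpresheaf G F \<Longrightarrow> subpresheaf G (cl F)"
  unfolding subpresheaf_def[of G "cl F"]
  using closure_restrict closure_carrier by auto

lemma closure_add:
  assumes F: "subpresheaf G F"
    and add: "\<And>W s t. \<lbrakk>opn W; W \<subseteq> G; s \<in> F W; t \<in> F W\<rbrakk> \<Longrightarrow> s \<oplus>\<^bsub>msec M W\<^esub> t \<in> F W"
    and "U \<subseteq> G" and s: "s \<in> cl F U" and t: "t \<in> cl F U"
  shows "s \<oplus>\<^bsub>msec M U\<^esub> t \<in> cl F U"
proof -
  have U: "opn U" and sc: "s \<in> carrier (msec M U)" and tc: "t \<in> carrier (msec M U)"
    using closure_opn[OF s] s t closure_carrier by blast+
  interpret A: module "sec X U" "msec M U" using U by (rule module_sec)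
  show ?thesis
  proof (rule closureI[OF U A.M.a_closed[OF sc tc]])
    fix x assume x: "x \<in> U"
    obtain V where V: "opn V" "x \<in> V" "V \<subseteq> U" "mres M U V s \<in> F V" using s x by (rule closureE)
    obtain W where W: "opn W" "x \<in> W" "W \<subseteq> U" "mres M U W t \<in> F W" using t x by (rule closureE)
    have o: "opn (V \<inter> W)" and sub: "V \<inter> W \<subseteq> U" using V W by auto
    have "mres M V (V \<inter> W) (mres M U V s) \<in> F (V \<inter> W)"
      using V assms(3) o by (intro subpresheafD(2)[OF F V(1)]) auto
    moreover have "mres M W (V \<inter> W) (mres M U W t) \<in> F (V \<inter> W)"
      using W assms(3) o by (intro subpresheafD(2)[OF F W(1)]) auto
    ultimately have "mres M U (V \<inter> W) s \<oplus>\<^bsub>msec M (V \<inter> W)\<^esub> mres M U (V \<inter> W) t \<in> F (V \<inter> W)"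
      using U V W o sc tc assms(3) by (intro add) (auto simp: mres_mres)
    then show "\<exists>W. opn W \<and> x \<in> W \<and> W \<subseteq> U \<and> mres M U W (s \<oplus>\<^bsub>msec M U\<^esub> t) \<in> F W"
      using V W o mres_add[OF U o sub sc tc] by (intro exI[of _ "V \<inter> W"]) auto
  qed
qed

lemma closure_smult:
  assumes F: "subpresheaf G F"
    and smult: "\<And>W a s. \<lbrakk>opn W; W \<subseteq> G; a \<in> carrier (sec X W); s \<in> F W\<rbrakk> \<Longrightarrow> a \<odot>\<^bsub>msec M W\<^esub> s \<in> F W"
    and "U \<subseteq> G" and a: "a \<in> carrier (sec X U)" and s: "s \<in> cl F U"
  shows "a \<odot>\<^bsub>msec M U\<^esub> s \<in> cl F U"
proof -
  have U: "opn U" and sc: "s \<in> carrier (msec M U)"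
    using closure_opn[OF s] s closure_carrier by blast+
  interpret A: module "sec X U" "msec M U" using U by (rule module_sec)
  show ?thesis
  proof (rule closureI[OF U A.smult_closed[OF a sc]])
    fix x assume x: "x \<in> U"
    obtain V where V: "opn V" "x \<in> V" "V \<subseteq> U" "mres M U V s \<in> F V" using s x by (rule closureE)
    have "res X U V a \<odot>\<^bsub>msec M V\<^esub> mres M U V s \<in> F V"
      using U V a assms(3) by (intro smult res_closed) auto
    then show "\<exists>W. opn W \<and> x \<in> W \<and> W \<subseteq> U \<and> mres M U W (a \<odot>\<^bsub>msec M U\<^esub> s) \<in> F W"
      using U V a sc by (intro exI[of _ "V"]) (auto simp: mres_smult)
  qed
qed

text \<open>This reduces inclusions between subsheaves to small open sets, where the ideal is principal.\<close>

lemma closure_le_locally: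
  assumes F: "subpresheaf (topspace (pts X)) F"
    and loc: "\<And>x. x \<in> topspace (pts X) \<Longrightarrow> \<exists>G. opn G \<and> x \<in> G \<and>
      (\<forall>U. opn U \<and> U \<subseteq> G \<longrightarrow> cl F U \<subseteq> cl F' U)"
  shows "cl F \<le> cl F'"
proof (rule le_funI, rule subsetI)
  fix U s assume s: "s \<in> cl F U"
  have U: "opn U" "s \<in> carrier (msec M U)" using closure_opn[OF s] s closure_carrier by blast+
  have Ut: "U \<subseteq> topspace (pts X)" using U(1) by (rule openin_subset)
  show "s \<in> cl F' U"
  proof (rule closureI_closure[OF U])
    fix x assume x: "x \<in> U"
    with Ut have "x \<in> topspace (pts X)" by auto
    from loc[OF this] obtain G where G: "opn G" "x \<in> G"
      and le: "\<forall>U. opn U \<and> U \<subseteq> G \<longrightarrow> cl F U \<subseteq> cl F' U"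
      by (elim exE conjE)
    have o: "opn (U \<inter> G)" using U G by auto
    have "mres M U (U \<inter> G) s \<in> cl F (U \<inter> G)"
      using closure_restrict[OF F Ut s o] by simp
    then have "mres M U (U \<inter> G) s \<in> cl F' (U \<inter> G)"
      using le o by auto
    then show "\<exists>W. opn W \<and> x \<in> W \<and> W \<subseteq> U \<and> mres M U W s \<in> cl F' W"
      using x G o by blast
  qed
qed

text \<open>A compatible family is the family of restrictions of its value at \<open>G\<close>. Families are more convenient
  than sections over \<open>G\<close>, because products and powers of restrictions are again of this form.\<close>

definition compatible :: "'a set \<Rightarrow> ('a set \<Rightarrow> 'r) \<Rightarrow> bool"
  where "compatible G h \<longleftrightarrow>
    (\<forall>V. opn V \<and> V \<subseteq> G \<longrightarrow> h V \<in> carrier (sec X V) \<and>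
      (\<forall>W. opn W \<and> W \<subseteq> V \<longrightarrow> res X V W (h V) = h W))"

abbreviation multiples :: "('a set \<Rightarrow> 'r) \<Rightarrow> 'a set \<Rightarrow> 'm set"
  where "multiples h \<equiv> \<lambda>V. (\<lambda>z. h V \<odot>\<^bsub>msec M V\<^esub> z) ` carrier (msec M V)"

lemma compatibleD:
  assumes "compatible G h" "opn V" "V \<subseteq> G"
  shows "h V \<in> carrier (sec X V)" "\<lbrakk>opn W; W \<subseteq> V\<rbrakk> \<Longrightarrow> res X V W (h V) = h W"
  using assms unfolding compatible_def by blast+

lemma subpresheaf_multiples:
  assumes "compatible G h" shows "subpresheaf G (multiples h)"
  unfolding subpresheaf_def
proof (intro allI impI conjI)
  fix V assume V: "opn V \<and> V \<subseteq> G"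
  then interpret A: module "sec X V" "msec M V" by (intro module_sec) simp
  show "multiples h V \<subseteq> carrier (msec M V)" using V compatibleD[OF assms] by auto
  fix W assume W: "opn W \<and> W \<subseteq> V"
  show "mres M V W ` multiples h V \<subseteq> multiples h W"
    using V W compatibleD[OF assms, of V] mres_closed[of V W] by (auto simp: mres_smult)
qed

lemma closure_multiples_closed:
  assumes h: "compatible G h" and U: "opn U" "U \<subseteq> G"
  shows "\<zero>\<^bsub>msec M U\<^esub> \<in> cl (multiples h) U"
    "\<lbrakk>s \<in> cl (multiples h) U; t \<in> cl (multiples h) U\<rbrakk> \<Longrightarrow>
      s \<oplus>\<^bsub>msec M U\<^esub> t \<in> cl (multiples h) U"
    "\<lbrakk>a \<in> carrier (sec X U); s \<in> cl (multiples h) U\<rbrakk> \<Longrightarrow>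
      a \<odot>\<^bsub>msec M U\<^esub> s \<in> cl (multiples h) U"
proof -
  interpret A: module "sec X U" "msec M U" using U(1) by (rule module_sec)
  have "h U \<odot>\<^bsub>msec M U\<^esub> \<zero>\<^bsub>msec M U\<^esub> = \<zero>\<^bsub>msec M U\<^esub>"
    using compatibleD(1)[OF h U] by simp
  then have "\<zero>\<^bsub>msec M U\<^esub> \<in> multiples h U"
    by (metis A.M.zero_closed imageI)
  then show "\<zero>\<^bsub>msec M U\<^esub> \<in> cl (multiples h) U"
    by (intro closureI_section U(1)) auto
next
  assume st: "s \<in> cl (multiples h) U" "t \<in> cl (multiples h) U"
  show "s \<oplus>\<^bsub>msec M U\<^esub> t \<in> cl (multiples h) U"
  proof (rule closure_add[OF subpresheaf_multiples[OF h] _ U(2) st])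
    fix W s t assume W: "opn W" "W \<subseteq> G" and s: "s \<in> multiples h W" and t: "t \<in> multiples h W"
    interpret A: module "sec X W" "msec M W" using W(1) by (rule module_sec)
    obtain y z where yz: "y \<in> carrier (msec M W)" "s = h W \<odot>\<^bsub>msec M W\<^esub> y"
      "z \<in> carrier (msec M W)" "t = h W \<odot>\<^bsub>msec M W\<^esub> z" using s t by blast
    then have "s \<oplus>\<^bsub>msec M W\<^esub> t = h W \<odot>\<^bsub>msec M W\<^esub> (y \<oplus>\<^bsub>msec M W\<^esub> z)"
      using compatibleD(1)[OF h W] by (simp add: A.smult_r_distr)
    then show "s \<oplus>\<^bsub>msec M W\<^esub> t \<in> multiples h W" using yz by blast
  qed
next
  assume as: "a \<in> carrier (sec X U)" "s \<in> cl (multiples h) U"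
  show "a \<odot>\<^bsub>msec M U\<^esub> s \<in> cl (multiples h) U"
  proof (rule closure_smult[OF subpresheaf_multiples[OF h] _ U(2) as])
    fix W a s assume W: "opn W" "W \<subseteq> G" and a: "a \<in> carrier (sec X W)" and s: "s \<in> multiples h W"
    interpret A: module "sec X W" "msec M W" using W(1) by (rule module_sec)
    obtain z where z: "z \<in> carrier (msec M W)" "s = h W \<odot>\<^bsub>msec M W\<^esub> z" using s by blast
    then have "a \<odot>\<^bsub>msec M W\<^esub> s = h W \<odot>\<^bsub>msec M W\<^esub> (a \<odot>\<^bsub>msec M W\<^esub> z)"
      using compatibleD(1)[OF h W] a by (metis A.R.m_comm A.smult_assoc1)
    then show "a \<odot>\<^bsub>msec M W\<^esub> s \<in> multiples h W" using z a by blast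
  qed
qed

text \<open>A finite sum of products of local multiples of \<open>h\<close> and \<open>k\<close> is a local multiple of \<open>h k\<close>, because
  the local multiples form a submodule.\<close>

lemma product_sheaf_principal:
  assumes h: "compatible G h" and k: "compatible G k"
    and J: "\<And>W. \<lbrakk>opn W; W \<subseteq> G\<rbrakk> \<Longrightarrow> J W =
      sheaf_closure X (structure_module X) (\<lambda>V. (\<lambda>a. h V \<otimes>\<^bsub>sec X V\<^esub> a) ` carrier (sec X V)) W"
    and N: "\<And>W. \<lbrakk>opn W; W \<subseteq> G\<rbrakk> \<Longrightarrow> N W = cl (multiples k) W"
    and U: "opn U" "U \<subseteq> G"
  shows "product_sheaf X M J N U = cl (multiples (\<lambda>V. h V \<otimes>\<^bsub>sec X V\<^esub> k V)) U"
proof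
  let ?hk = "\<lambda>V. h V \<otimes>\<^bsub>sec X V\<^esub> k V"
  have hk: "compatible G ?hk"
    unfolding compatible_def
  proof (intro allI impI conjI)
    fix V assume V: "opn V \<and> V \<subseteq> G"
    then interpret A: cring "sec X V" by (intro cring_sec) simp
    show "h V \<otimes>\<^bsub>sec X V\<^esub> k V \<in> carrier (sec X V)"
      using V compatibleD[OF h] compatibleD[OF k] by simp
    fix W assume "opn W \<and> W \<subseteq> V"
    then show "res X V W (h V \<otimes>\<^bsub>sec X V\<^esub> k V) = h W \<otimes>\<^bsub>sec X W\<^esub> k W"
      using V compatibleD[OF h, of V] compatibleD[OF k, of V] ring_hom_mult[OF res_hom, of V W] by simp
  qed
  have Jc: "J W \<subseteq> carrier (sec X W)" if "opn W" "W \<subseteq> G" for W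
    unfolding J[OF that] by (auto simp: sheaf_closure_def structure_module_def alg_module_def)
  have Nc: "N W \<subseteq> carrier (msec M W)" if "opn W" "W \<subseteq> G" for W
    unfolding N[OF that] by (rule closure_carrier)
  have ax: "a \<odot>\<^bsub>msec M W\<^esub> x \<in> cl (multiples ?hk) W"
    if W: "opn W" "W \<subseteq> G" and a: "a \<in> J W" and x: "x \<in> N W" for W a x
  proof (rule closureI[OF W(1)])
    interpret A: module "sec X W" "msec M W" using W(1) by (rule module_sec)
    have ac: "a \<in> carrier (sec X W)" and xc: "x \<in> carrier (msec M W)"
      using a x Jc[OF W] Nc[OF W] by auto
    then show "a \<odot>\<^bsub>msec M W\<^esub> x \<in> carrier (msec M W)" by simp
    fix y assume y: "y \<in> W"
    obtain W1 b where W1: "opn W1" "y \<in> W1" "W1 \<subseteq> W"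
      and b: "b \<in> carrier (sec X W1)" "res X W W1 a = h W1 \<otimes>\<^bsub>sec X W1\<^esub> b"
      using a y unfolding J[OF W] sheaf_closure_def structure_module_def by auto
    obtain W2 z where W2: "opn W2" "y \<in> W2" "W2 \<subseteq> W"
      and z: "z \<in> carrier (msec M W2)" "mres M W W2 x = k W2 \<odot>\<^bsub>msec M W2\<^esub> z"
      using x y unfolding N[OF W] sheaf_closure_def by auto
    let ?V = "W1 \<inter> W2"
    have V: "opn ?V" "?V \<subseteq> W" "?V \<subseteq> G" "W1 \<subseteq> G" "W2 \<subseteq> G" using W1 W2 W by auto
    interpret B: module "sec X ?V" "msec M ?V" using V(1) by (rule module_sec)
    let ?b = "res X W1 ?V b" and ?z = "mres M W2 ?V z"
    have bz: "?b \<in> carrier (sec X ?V)" "?z \<in> carrier (msec M ?V)"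
      using b z W1 W2 V by (auto intro!: res_closed mres_closed)
    have hkc: "h ?V \<in> carrier (sec X ?V)" "k ?V \<in> carrier (sec X ?V)"
      using compatibleD[OF h V(1,3)] compatibleD[OF k V(1,3)] by auto
    have "res X W ?V a = res X W1 ?V (h W1 \<otimes>\<^bsub>sec X W1\<^esub> b)"
      using res_res[of W W1 ?V a] W W1 V b ac by simp
    also have "\<dots> = h ?V \<otimes>\<^bsub>sec X ?V\<^esub> ?b"
      using ring_hom_mult[OF res_hom, of W1 ?V] W1 V b compatibleD[OF h W1(1) V(4)] by simp
    finally have ra: "res X W ?V a = h ?V \<otimes>\<^bsub>sec X ?V\<^esub> ?b" .
    have "mres M W ?V x = mres M W2 ?V (k W2 \<odot>\<^bsub>msec M W2\<^esub> z)"
      using mres_mres[of W W2 ?V x] W W2 V z xc by simp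
    also have "\<dots> = k ?V \<odot>\<^bsub>msec M ?V\<^esub> ?z"
      using W2 V z compatibleD[OF k W2(1) V(5)] by (simp add: mres_smult)
    finally have "mres M W ?V (a \<odot>\<^bsub>msec M W\<^esub> x)
        = (h ?V \<otimes>\<^bsub>sec X ?V\<^esub> ?b) \<odot>\<^bsub>msec M ?V\<^esub> (k ?V \<odot>\<^bsub>msec M ?V\<^esub> ?z)"
      using W V ac xc ra by (simp add: mres_smult)
    also have "\<dots> = (h ?V \<otimes>\<^bsub>sec X ?V\<^esub> ?b \<otimes>\<^bsub>sec X ?V\<^esub> k ?V) \<odot>\<^bsub>msec M ?V\<^esub> ?z"
      using bz hkc by (simp add: B.smult_assoc1)
    also have "h ?V \<otimes>\<^bsub>sec X ?V\<^esub> ?b \<otimes>\<^bsub>sec X ?V\<^esub> k ?V = ?hk ?V \<otimes>\<^bsub>sec X ?V\<^esub> ?b"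
      using bz hkc by (simp add: B.R.m_ac)
    also have "\<dots> \<odot>\<^bsub>msec M ?V\<^esub> ?z = ?hk ?V \<odot>\<^bsub>msec M ?V\<^esub> (?b \<odot>\<^bsub>msec M ?V\<^esub> ?z)"
      using bz hkc by (simp add: B.smult_assoc1)
    finally show "\<exists>V. opn V \<and> y \<in> V \<and> V \<subseteq> W \<and> mres M W V (a \<odot>\<^bsub>msec M W\<^esub> x) \<in> multiples ?hk V"
      using V y W1 W2 bz by (intro exI[of _ ?V]) auto
  qed
  show "product_sheaf X M J N U \<subseteq> cl (multiples ?hk) U"
    unfolding product_sheaf_def
  proof (rule closure_least)
    fix W s assume W: "opn W" "W \<subseteq> U" and "s \<in> {\<Oplus>\<^bsub>msec M W\<^esub>i\<in>{..<k}. a i \<odot>\<^bsub>msec M W\<^esub> x i |k a x.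
      a \<in> {..<k::nat} \<rightarrow> J W \<and> x \<in> {..<k} \<rightarrow> N W}"
    then obtain n a x where ax_in: "a \<in> {..<n::nat} \<rightarrow> J W" "x \<in> {..<n} \<rightarrow> N W"
      and s: "s = (\<Oplus>\<^bsub>msec M W\<^esub>i\<in>{..<n}. a i \<odot>\<^bsub>msec M W\<^esub> x i)" by blast
    have WG: "W \<subseteq> G" using W U by simp
    interpret A: module "sec X W" "msec M W" using W(1) by (rule module_sec)
    note D = closure_multiples_closed[OF hk W(1) WG]
    show "s \<in> cl (multiples ?hk) W"
      using ax_in unfolding s
    proof (induction n)
      case (Suc n)
      have D': "a i \<odot>\<^bsub>msec M W\<^esub> x i \<in> cl (multiples ?hk) W" if "i \<le> n" for i
        using that Suc.prems by (intro ax W WG) auto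
      have c: "a i \<odot>\<^bsub>msec M W\<^esub> x i \<in> carrier (msec M W)" if "i \<le> n" for i
        using D'[OF that] closure_carrier by blast
      then have "(\<lambda>i. a i \<odot>\<^bsub>msec M W\<^esub> x i) \<in> {..<n} \<rightarrow> carrier (msec M W)"
        by auto
      then have "(\<Oplus>\<^bsub>msec M W\<^esub>i\<in>{..<Suc n}. a i \<odot>\<^bsub>msec M W\<^esub> x i) =
          a n \<odot>\<^bsub>msec M W\<^esub> x n \<oplus>\<^bsub>msec M W\<^esub> (\<Oplus>\<^bsub>msec M W\<^esub>i\<in>{..<n}. a i \<odot>\<^bsub>msec M W\<^esub> x i)"
        using c[of n] by (simp add: lessThan_Suc)
      moreover have "(\<Oplus>\<^bsub>msec M W\<^esub>i\<in>{..<n}. a i \<odot>\<^bsub>msec M W\<^esub> x i) \<in> cl (multiples ?hk) W"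
        using Suc.prems by (intro Suc.IH) auto
      ultimately show ?case using D(2)[OF D'[OF order_refl]] by simp
    qed (simp add: D(1))
  qed
  show "cl (multiples ?hk) U \<subseteq> product_sheaf X M J N U"
    unfolding product_sheaf_def
  proof (rule closure_mono, rule subsetI)
    fix W s assume W: "opn W" "W \<subseteq> U" and "s \<in> multiples ?hk W"
    then obtain z where z: "z \<in> carrier (msec M W)" "s = ?hk W \<odot>\<^bsub>msec M W\<^esub> z" by blast
    have WG: "W \<subseteq> G" using W U by simp
    interpret A: module "sec X W" "msec M W" using W(1) by (rule module_sec)
    have hkc: "h W \<in> carrier (sec X W)" "k W \<in> carrier (sec X W)"
      using compatibleD[OF h W(1) WG] compatibleD[OF k W(1) WG] by auto
    have "h W = h W \<otimes>\<^bsub>sec X W\<^esub> \<one>\<^bsub>sec X W\<^esub>" using hkc by simp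
    then have "h W \<in> (\<lambda>a. h W \<otimes>\<^bsub>sec X W\<^esub> a) ` carrier (sec X W)" by (metis A.R.one_closed imageI)
    moreover have "res X W W (h W) = h W" using hkc W by (simp add: res_self)
    ultimately have hJ: "h W \<in> J W"
      unfolding J[OF W(1) WG] sheaf_closure_def structure_module_def alg_module_def
      using W hkc by (auto intro!: exI[of _ W])
    have kN: "k W \<odot>\<^bsub>msec M W\<^esub> z \<in> N W"
      unfolding N[OF W(1) WG] using z hkc by (intro closureI_section W) auto
    have "s = h W \<odot>\<^bsub>msec M W\<^esub> (k W \<odot>\<^bsub>msec M W\<^esub> z)"
      using z hkc by (simp add: A.smult_assoc1)
    also have "\<dots> = (\<Oplus>\<^bsub>msec M W\<^esub>i\<in>{..<1::nat}. h W \<odot>\<^bsub>msec M W\<^esub> (k W \<odot>\<^bsub>msec M W\<^esub> z))"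
      using z hkc by (simp add: lessThan_Suc)
    finally show "s \<in> {\<Oplus>\<^bsub>msec M W\<^esub>i\<in>{..<k}. a i \<odot>\<^bsub>msec M W\<^esub> x i |k a x.
        a \<in> {..<k::nat} \<rightarrow> J W \<and> x \<in> {..<k} \<rightarrow> N W}"
      using hJ kN by (intro CollectI exI[of _ 1] exI[of _ "\<lambda>_. h W"] exI[of _ "\<lambda>_. k W \<odot>\<^bsub>msec M W\<^esub> z"]) auto
  qed
qed

lemma mres_finsum:
  assumes "opn U" "opn V" "V \<subseteq> U" "f \<in> {..<k::nat} \<rightarrow> carrier (msec M U)"
  shows "mres M U V (\<Oplus>\<^bsub>msec M U\<^esub>i\<in>{..<k}. f i) = (\<Oplus>\<^bsub>msec M V\<^esub>i\<in>{..<k}. mres M U V (f i))"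
proof -
  interpret A: module "sec X U" "msec M U" using assms(1) by (rule module_sec)
  interpret B: module "sec X V" "msec M V" using assms(2) by (rule module_sec)
  show ?thesis using assms(4)
  proof (induction k)
    case 0
    then show ?case using assms by (simp add: mres_zero)
  next
    case (Suc k)
    have f: "f i \<in> carrier (msec M U)" if "i \<le> k" for i using Suc.prems that by auto
    have fk: "f \<in> {..<k} \<rightarrow> carrier (msec M U)" using f by auto
    moreover have "(\<lambda>i. mres M U V (f i)) \<in> {..<k} \<rightarrow> carrier (msec M V)"
      using mres_closed[OF assms(1-3)] f by auto
    ultimately show ?case
      using Suc.IH[OF fk] f[of k] assms(1-3) mres_closed[OF assms(1-3), of "f k"]
      by (simp add: lessThan_Suc mres_add)
  qed
qed

lemma subpresheaf_product:
  assumes J: "\<And>V. opn V \<Longrightarrow> J V \<subseteq> carrier (sec X V)"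
    "\<And>V W. \<lbrakk>opn V; opn W; W \<subseteq> V\<rbrakk> \<Longrightarrow> res X V W ` J V \<subseteq> J W"
    and N: "subpresheaf G N"
  shows "subpresheaf G (product_sheaf X M J N)"
  unfolding product_sheaf_def
proof (rule subpresheaf_closure, unfold subpresheaf_def, intro allI impI conjI)
  let ?S = "\<lambda>U. {\<Oplus>\<^bsub>msec M U\<^esub>i\<in>{..<k}. a i \<odot>\<^bsub>msec M U\<^esub> x i |k a x.
      a \<in> {..<k::nat} \<rightarrow> J U \<and> x \<in> {..<k} \<rightarrow> N U}"
  fix V assume V: "opn V \<and> V \<subseteq> G"
  then interpret A: module "sec X V" "msec M V" by (intro module_sec) simp
  have c: "(\<lambda>i. a i \<odot>\<^bsub>msec M V\<^esub> x i) \<in> {..<k} \<rightarrow> carrier (msec M V)"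
    if "a \<in> {..<k::nat} \<rightarrow> J V" "x \<in> {..<k} \<rightarrow> N V" for a x k
    using that J(1)[of V] subpresheafD(1)[OF N, of V] V by (auto simp: Pi_iff subset_iff)
  then show "?S V \<subseteq> carrier (msec M V)" by (auto intro!: A.M.finsum_closed)
  fix W assume W: "opn W \<and> W \<subseteq> V"
  then interpret B: module "sec X W" "msec M W" by (intro module_sec) simp
  show "mres M V W ` ?S V \<subseteq> ?S W"
  proof
    fix s assume "s \<in> mres M V W ` ?S V"
    then obtain k a x where ax: "a \<in> {..<k::nat} \<rightarrow> J V" "x \<in> {..<k} \<rightarrow> N V"
      and s: "s = mres M V W (\<Oplus>\<^bsub>msec M V\<^esub>i\<in>{..<k}. a i \<odot>\<^bsub>msec M V\<^esub> x i)" by blast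
    have ax': "(\<lambda>i. res X V W (a i)) \<in> {..<k} \<rightarrow> J W" "(\<lambda>i. mres M V W (x i)) \<in> {..<k} \<rightarrow> N W"
      using ax J(2)[of V W] V W subpresheafD(2)[OF N, of V _ W] by (auto simp: Pi_iff)
    have axc: "a i \<in> carrier (sec X V)" "x i \<in> carrier (msec M V)" if "i < k" for i
      using ax that J(1)[of V] V subpresheafD(1)[OF N, of V] by (auto simp: Pi_iff subset_iff)
    have "s = (\<Oplus>\<^bsub>msec M W\<^esub>i\<in>{..<k}. mres M V W (a i \<odot>\<^bsub>msec M V\<^esub> x i))"
      unfolding s using V W c[OF ax] by (intro mres_finsum) auto
    also have "\<dots> = (\<Oplus>\<^bsub>msec M W\<^esub>i\<in>{..<k}. res X V W (a i) \<odot>\<^bsub>msec M W\<^esub> mres M V W (x i))"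
    proof (rule B.M.finsum_cong')
      show "(\<lambda>i. res X V W (a i) \<odot>\<^bsub>msec M W\<^esub> mres M V W (x i)) \<in> {..<k} \<rightarrow> carrier (msec M W)"
        using V W axc by (auto intro!: B.smult_closed res_closed mres_closed)
    qed (use V W axc in \<open>auto simp: mres_smult\<close>)
    finally show "s \<in> ?S W"
      using ax' by (intro CollectI exI[of _ k] exI[of _ "\<lambda>i. res X V W (a i)"]
          exI[of _ "\<lambda>i. mres M V W (x i)"]) simp
  qed
qed

end

lemma structure_module_simps [simp]:
  "carrier (msec (structure_module X) U) = carrier (sec X U)"
  "add (msec (structure_module X) U) = add (sec X U)"
  "zero (msec (structure_module X) U) = zero (sec X U)"
  "smult (msec (structure_module X) U) = mult (sec X U)"
  "mres (structure_module X) = res X"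
  by (simp_all add: structure_module_def alg_module_def)

lemma module_self_module:
  assumes "cring A" shows "module A (self_module A)"
proof -
  interpret cring A by fact
  have "abelian_group (self_module A)"
    by (rule abelian_groupI) (auto simp: alg_module_def a_ac intro: add.l_inv_ex)
  then show ?thesis
    by (intro moduleI assms) (auto simp: alg_module_def l_distr r_distr m_assoc)
qed

lemma module_sheaf_structure_module:
  assumes "is_ringed_space X" shows "is_module_sheaf X (structure_module X)"
  unfolding is_module_sheaf_def
proof (intro conjI allI impI ballI)
  show "is_sheaf (pts X) (\<lambda>U. carrier (msec (structure_module X) U)) (mres (structure_module X))"
    using assms by (simp add: is_ringed_space_def)
next
  fix U assume "openin (pts X) U"
  then show "module (sec X U) (msec (structure_module X) U)"
    using assms by (simp add: is_ringed_space_def structure_module_def module_self_module)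
next
  fix U V assume UV: "openin (pts X) U \<and> openin (pts X) V \<and> V \<subseteq> U"
  then have h: "res X U V \<in> ring_hom (sec X U) (sec X V)"
    using assms by (simp add: is_ringed_space_def)
  fix x y assume "x \<in> carrier (msec (structure_module X) U)" "y \<in> carrier (msec (structure_module X) U)"
  then show "mres (structure_module X) U V (x \<oplus>\<^bsub>msec (structure_module X) U\<^esub> y) =
      mres (structure_module X) U V x \<oplus>\<^bsub>msec (structure_module X) V\<^esub> mres (structure_module X) U V y"
    using ring_hom_add[OF h] by simp
next
  fix U V assume UV: "openin (pts X) U \<and> openin (pts X) V \<and> V \<subseteq> U"
  then have h: "res X U V \<in> ring_hom (sec X U) (sec X V)"
    using assms by (simp add: is_ringed_space_def)
  fix a x assume "a \<in> carrier (sec X U)" "x \<in> carrier (msec (structure_module X) U)"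
  then show "mres (structure_module X) U V (a \<odot>\<^bsub>msec (structure_module X) U\<^esub> x) =
      res X U V a \<odot>\<^bsub>msec (structure_module X) V\<^esub> mres (structure_module X) U V x"
    using ring_hom_mult[OF h] by simp
qed

section \<open>Images of powers of a locally principal ideal under a Cartier operator\<close>

locale cartier_sheaf = sheaf_of_modules X M
  for X :: "('a, 'r) ringed_space" and M :: "('a, 'r, 'm) module_sheaf" +
  fixes q :: nat and C :: "'a set \<Rightarrow> 'm \<Rightarrow> 'm"
  assumes cartier: "cartier_module q X M C"
begin

lemma iter_closed: "\<lbrakk>opn U; x \<in> carrier (msec M U)\<rbrakk> \<Longrightarrow> (C U ^^ m) x \<in> carrier (msec M U)"
  using cartier unfolding cartier_module_def by (induction m) auto

lemma iter_add: "\<lbrakk>opn U; x \<in> carrier (msec M U); y \<in> carrier (msec M U)\<rbrakk> \<Longrightarrow>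
    (C U ^^ m) (x \<oplus>\<^bsub>msec M U\<^esub> y) = (C U ^^ m) x \<oplus>\<^bsub>msec M U\<^esub> (C U ^^ m) y"
proof (induction m)
  case (Suc m)
  then show ?case
    using cartier iter_closed[of U x m] iter_closed[of U y m] unfolding cartier_module_def by simp
qed simp

lemma iter_zero:
  assumes "opn U" shows "(C U ^^ m) \<zero>\<^bsub>msec M U\<^esub> = \<zero>\<^bsub>msec M U\<^esub>"
proof -
  interpret A: module "sec X U" "msec M U" using assms by (rule module_sec)
  have "(C U ^^ m) \<zero>\<^bsub>msec M U\<^esub> \<oplus>\<^bsub>msec M U\<^esub> (C U ^^ m) \<zero>\<^bsub>msec M U\<^esub> = (C U ^^ m) \<zero>\<^bsub>msec M U\<^esub>"
    using iter_add[OF assms, of "\<zero>\<^bsub>msec M U\<^esub>" "\<zero>\<^bsub>msec M U\<^esub>" m] by simp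
  then show ?thesis using iter_closed[OF assms A.M.zero_closed, of m] by (metis A.M.add.r_cancel_one)
qed

lemma iter_res: "\<lbrakk>opn U; opn V; V \<subseteq> U; x \<in> carrier (msec M U)\<rbrakk> \<Longrightarrow>
    mres M U V ((C U ^^ m) x) = (C V ^^ m) (mres M U V x)"
proof (induction m)
  case (Suc m)
  then show ?case
    using cartier iter_closed[of U x m] unfolding cartier_module_def by simp
qed simp

lemma iter_smult: "\<lbrakk>opn U; a \<in> carrier (sec X U); x \<in> carrier (msec M U)\<rbrakk> \<Longrightarrow>
    (C U ^^ m) ((a [^]\<^bsub>sec X U\<^esub> (q ^ m)) \<odot>\<^bsub>msec M U\<^esub> x) = a \<odot>\<^bsub>msec M U\<^esub> (C U ^^ m) x"
proof (induction m arbitrary: a)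
  case 0
  then interpret A: module "sec X U" "msec M U" by (intro module_sec)
  show ?case using 0 by simp
next
  case (Suc m)
  then interpret A: module "sec X U" "msec M U" by (intro module_sec)
  have "a [^]\<^bsub>sec X U\<^esub> (q ^ Suc m) = (a [^]\<^bsub>sec X U\<^esub> q) [^]\<^bsub>sec X U\<^esub> (q ^ m)"
    using Suc.prems by (simp add: A.R.nat_pow_pow)
  then have "(C U ^^ Suc m) ((a [^]\<^bsub>sec X U\<^esub> (q ^ Suc m)) \<odot>\<^bsub>msec M U\<^esub> x) =
      C U ((a [^]\<^bsub>sec X U\<^esub> q) \<odot>\<^bsub>msec M U\<^esub> (C U ^^ m) x)"
    using Suc by simp
  also have "\<dots> = a \<odot>\<^bsub>msec M U\<^esub> (C U ^^ Suc m) x"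
    using cartier Suc.prems iter_closed[of U x m] unfolding cartier_module_def by simp
  finally show ?case .
qed

text \<open>The operator commutes with restrictions, so taking the generated subsheaf first does not enlarge the
  image.\<close>

lemma cartier_image_of_closure:
  assumes F: "subpresheaf G F" and U: "opn U" "U \<subseteq> G"
    and N: "\<And>W. \<lbrakk>opn W; W \<subseteq> G\<rbrakk> \<Longrightarrow> N W = cl F W"
  shows "cartier_image X M C m N U = cl (\<lambda>V. (C V ^^ m) ` F V) U"
proof
  show "cartier_image X M C m N U \<subseteq> cl (\<lambda>V. (C V ^^ m) ` F V) U"
    unfolding cartier_image_def
  proof (rule closure_least)
    fix W s assume W: "opn W" "W \<subseteq> U" and sc: "s \<in> carrier (msec M W)" and "s \<in> (C W ^^ m) ` N W"
    then obtain y where y: "y \<in> cl F W" "s = (C W ^^ m) y"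
      using N U by auto
    have yc: "y \<in> carrier (msec M W)" using y(1) closure_carrier by blast
    show "s \<in> cl (\<lambda>V. (C V ^^ m) ` F V) W"
    proof (rule closureI[OF W(1) sc])
      fix x assume "x \<in> W"
      with y(1) obtain V where V: "opn V" "x \<in> V" "V \<subseteq> W" "mres M W V y \<in> F V" by (rule closureE)
      then show "\<exists>V. opn V \<and> x \<in> V \<and> V \<subseteq> W \<and> mres M W V s \<in> (C V ^^ m) ` F V"
        using y(2) iter_res[OF W(1) V(1,3) yc] by (intro exI[of _ V]) auto
    qed
  qed
  show "cl (\<lambda>V. (C V ^^ m) ` F V) U \<subseteq> cartier_image X M C m N U"
    unfolding cartier_image_def
  proof (rule closure_mono, rule image_mono)
    fix W assume W: "opn W" "W \<subseteq> U"
    then show "F W \<subseteq> N W"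
      using N[of W] U F subpresheafD(1)[OF F] by (auto intro!: closureI_section)
  qed
qed

end

locale principal_cartier_sheaf = cartier_sheaf X M q C
  for X :: "('a, 'r) ringed_space" and M :: "('a, 'r, 'm) module_sheaf"
    and q :: nat and C :: "'a set \<Rightarrow> 'm \<Rightarrow> 'm" +
  fixes I :: "'a set \<Rightarrow> 'r set"
  assumes ideal: "ideal_sheaf X I" and principal: "locally_principal X I"
    and pure: "opn U \<Longrightarrow> cartier_image X M C 1 (whole M) U = whole M U"
begin

sublocale \<O>: sheaf_of_modules X "structure_module X"
  using ringed_space module_sheaf_structure_module by unfold_locales

definition generates :: "'a set \<Rightarrow> 'r \<Rightarrow> bool"
  where "generates G g \<longleftrightarrow> opn G \<and> g \<in> carrier (sec X G) \<and>
    (\<forall>V. opn V \<and> V \<subseteq> G \<longrightarrow> I V = \<O>.cl (\<O>.multiples (\<lambda>W. res X G W g)) V)"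

lemma ex_generator:
  assumes "x \<in> topspace (pts X)" shows "\<exists>G g. x \<in> G \<and> generates G g"
proof -
  obtain G g where G: "opn G" "x \<in> G" "g \<in> I G"
    and IG: "\<And>V. opn V \<Longrightarrow> V \<subseteq> G \<Longrightarrow> I V = \<O>.cl
       (\<lambda>W. {a \<otimes>\<^bsub>sec X W\<^esub> res X G W g | a. a \<in> carrier (sec X W)}) V"
    using principal assms unfolding locally_principal_def by meson
  have "I G \<subseteq> carrier (sec X G)"
    unfolding IG[OF G(1) order_refl] using \<O>.closure_carrier by force
  then have g: "g \<in> carrier (sec X G)" using G by blast
  have "\<O>.cl
      (\<lambda>W. {a \<otimes>\<^bsub>sec X W\<^esub> res X G W g | a. a \<in> carrier (sec X W)}) V =
     \<O>.cl (\<O>.multiples (\<lambda>W. res X G W g)) V"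
    if V: "opn V" "V \<subseteq> G" for V
  proof -
    have "{a \<otimes>\<^bsub>sec X W\<^esub> res X G W g | a. a \<in> carrier (sec X W)} = \<O>.multiples (\<lambda>W. res X G W g) W"
      if W: "opn W" "W \<subseteq> V" for W
    proof -
      interpret cring "sec X W" using W(1) by (rule cring_sec)
      have "res X G W g \<in> carrier (sec X W)" using W V G g by (intro res_closed) auto
      then show ?thesis by (auto simp: m_comm image_iff)
    qed
    then show ?thesis by (intro equalityI \<O>.closure_mono) simp_all
  qed
  then have "generates G g" using G g IG by (simp add: generates_def)
  with G(2) show ?thesis by blast
qed

abbreviation gpow :: "'a set \<Rightarrow> 'r \<Rightarrow> nat \<Rightarrow> 'a set \<Rightarrow> 'r"
  where "gpow G g n V \<equiv> res X G V g [^]\<^bsub>sec X V\<^esub> n"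

lemma compatible_power:
  assumes "generates G g" shows "compatible G (gpow G g n)"
  unfolding compatible_def
proof (intro allI impI conjI)
  fix V assume V: "opn V \<and> V \<subseteq> G"
  then interpret cring "sec X V" by (intro cring_sec) simp
  have G: "opn G" "g \<in> carrier (sec X G)" using assms by (auto simp: generates_def)
  have r: "res X G V g \<in> carrier (sec X V)" using G V by (intro res_closed) auto
  then show "gpow G g n V \<in> carrier (sec X V)" by simp
  fix W assume W: "opn W \<and> W \<subseteq> V"
  then show "res X V W (gpow G g n V) = gpow G g n W"
    using V G r by (simp add: res_pow res_res)
qed

lemma compatible_generator:
  assumes "generates G g" shows "compatible G (\<lambda>V. res X G V g)"
  using assms unfolding compatible_def generates_def by (auto intro!: res_closed res_res)

lemma ideal_power_principal:
  assumes g: "generates G g" and U: "opn U" "U \<subseteq> G"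
  shows "ideal_power X I n U =
    \<O>.cl (\<O>.multiples (gpow G g n)) U"
  using U
proof (induction n arbitrary: U)
  case 0
  show ?case
  proof
    show "ideal_power X I 0 U \<subseteq>
        \<O>.cl (\<O>.multiples (gpow G g 0)) U"
    proof
      fix s assume s: "s \<in> ideal_power X I 0 U"
      interpret cring "sec X U" using 0 by (intro cring_sec)
      from s have "s = \<one>\<^bsub>sec X U\<^esub> \<otimes>\<^bsub>sec X U\<^esub> s" by simp
      then show "s \<in> \<O>.cl
          (\<O>.multiples (gpow G g 0)) U"
        using s 0 by (intro \<O>.closureI_section) (auto simp: image_iff)
    qed
    show "\<O>.cl (\<O>.multiples (gpow G g 0)) U
      \<subseteq> ideal_power X I 0 U"
      using \<O>.closure_carrier by force
  qed
next
  case (Suc n)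
  have "ideal_power X I (Suc n) U = \<O>.cl
      (\<O>.multiples (\<lambda>V. res X G V g \<otimes>\<^bsub>sec X V\<^esub> gpow G g n V)) U"
    unfolding ideal_power.simps
  proof (rule \<O>.product_sheaf_principal)
    show "compatible G (\<lambda>V. res X G V g)" by (rule compatible_generator[OF g])
    show "compatible G (gpow G g n)" by (rule compatible_power[OF g])
    show "I W = \<O>.cl
           (\<lambda>V. (\<otimes>\<^bsub>sec X V\<^esub>) (res X G V g) ` carrier (sec X V)) W" if "opn W" "W \<subseteq> G" for W
      using g that unfolding generates_def by simp
    show "ideal_power X I n W = \<O>.cl
        (\<O>.multiples (gpow G g n)) W" if "opn W" "W \<subseteq> G" for W
      using Suc.IH that by simp
  qed fact+
  also have "\<dots> = \<O>.cl (\<O>.multiples (gpow G g (Suc n))) U"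
  proof -
    have "\<O>.multiples (\<lambda>V. res X G V g \<otimes>\<^bsub>sec X V\<^esub> gpow G g n V) W =
      \<O>.multiples (gpow G g (Suc n)) W" if W: "opn W" "W \<subseteq> U" for W
    proof -
      interpret cring "sec X W" using W(1) by (rule cring_sec)
      have "res X G W g \<in> carrier (sec X W)"
        using W Suc.prems g by (intro res_closed) (auto simp: generates_def)
      then show ?thesis by (simp add: m_comm)
    qed
    then show ?thesis by (intro equalityI \<O>.closure_mono) simp_all
  qed
  finally show ?case .
qed

definition power_image :: "nat \<Rightarrow> nat \<Rightarrow> 'a set \<Rightarrow> 'm set"
  where "power_image m n = cartier_image X M C m (product_sheaf X M (ideal_power X I n) (whole M))"

text \<open>The sections \<open>C\<^sup>m (g\<^sup>n z)\<close>. They form only a presheaf, from which \<open>power_image m n\<close> arises on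
  open subsets of \<open>G\<close>; all later computations take place in it.\<close>

definition local_image :: "'a set \<Rightarrow> 'r \<Rightarrow> nat \<Rightarrow> nat \<Rightarrow> 'a set \<Rightarrow> 'm set"
  where "local_image G g m n V = (\<lambda>z. (C V ^^ m) (gpow G g n V \<odot>\<^bsub>msec M V\<^esub> z)) ` carrier (msec M V)"

lemma whole_eq_closure:
  assumes "opn U" shows "whole M U = cl (multiples (\<lambda>V. \<one>\<^bsub>sec X V\<^esub>)) U"
proof
  show "cl (multiples (\<lambda>V. \<one>\<^bsub>sec X V\<^esub>)) U \<subseteq> whole M U"
    using closure_carrier by (simp add: whole_def)
  interpret A: module "sec X U" "msec M U" using assms by (rule module_sec)
  show "whole M U \<subseteq> cl (multiples (\<lambda>V. \<one>\<^bsub>sec X V\<^esub>)) U"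
    using assms by (auto intro!: closureI_section simp: whole_def image_iff)
qed

lemma power_image_local:
  assumes g: "generates G g" and U: "opn U" "U \<subseteq> G"
  shows "power_image m n U = cl (local_image G g m n) U"
proof -
  have one: "compatible G (\<lambda>V. \<one>\<^bsub>sec X V\<^esub>)"
    unfolding compatible_def using res_hom cring_sec
    by (auto simp: cring_def ring_def intro!: monoid.one_closed ring_hom_one)
  have "product_sheaf X M (ideal_power X I n) (whole M) W =
     cl (multiples (gpow G g n)) W" if W: "opn W" "W \<subseteq> G" for W
  proof -
    have "product_sheaf X M (ideal_power X I n) (whole M) W =
       cl (multiples (\<lambda>V. gpow G g n V \<otimes>\<^bsub>sec X V\<^esub> \<one>\<^bsub>sec X V\<^esub>)) W"
      using ideal_power_principal[OF g] whole_eq_closure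
      by (intro product_sheaf_principal[OF compatible_power[OF g] one _ _ W]) simp_all
    also have "\<dots> = cl (multiples (gpow G g n)) W"
    proof -
      have "multiples (\<lambda>V. gpow G g n V \<otimes>\<^bsub>sec X V\<^esub> \<one>\<^bsub>sec X V\<^esub>) V =
        multiples (gpow G g n) V" if V: "opn V" "V \<subseteq> W" for V
      proof -
        interpret cring "sec X V" using V(1) by (rule cring_sec)
        have "res X G V g \<in> carrier (sec X V)"
          using V W g by (intro res_closed) (auto simp: generates_def)
        then show ?thesis by simp
      qed
      then show ?thesis by (intro equalityI closure_mono) simp_all
    qed
    finally show ?thesis .
  qed
  then have "power_image m n U = cl (\<lambda>V. (C V ^^ m) ` multiples (gpow G g n) V) U"
    unfolding power_image_def
    by (intro cartier_image_of_closure[OF subpresheaf_multiples[OF compatible_power[OF g]] U])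
  then show ?thesis by (simp add: local_image_def[abs_def] image_image)
qed

lemma subpresheaf_ideal_power: "\<O>.subpresheaf (topspace (pts X)) (ideal_power X I n)"
proof (induction n)
  case 0
  show ?case by (auto simp: \<O>.subpresheaf_def intro: res_closed)
next
  case (Suc n)
  have sub: "I V \<subseteq> carrier (sec X V)" if "opn V" for V
  proof -
    interpret cring "sec X V" using that by (rule cring_sec)
    have "submodule (I V) (sec X V) (msec (structure_module X) V)"
      using ideal that by (simp add: submodule_sheaf_def)
    from module.submoduleE(1)[OF \<O>.module_sec[OF that] this] show ?thesis by simp
  qed
  show ?case unfolding ideal_power.simps
    using ideal sub by (intro \<O>.subpresheaf_product Suc) (auto simp: submodule_sheaf_def Pi_iff)
qed

lemma subpresheaf_power_image: "subpresheaf (topspace (pts X)) (power_image m n)"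
  unfolding power_image_def cartier_image_def
proof (rule subpresheaf_closure)
  let ?P = "product_sheaf X M (ideal_power X I n) (whole M)"
  have "subpresheaf (topspace (pts X)) (whole M)"
    by (auto simp: subpresheaf_def whole_def intro: mres_closed)
  moreover have "ideal_power X I n V \<subseteq> carrier (sec X V)" if "opn V" for V
    using \<O>.subpresheafD(1)[OF subpresheaf_ideal_power that openin_subset[OF that]] by auto
  moreover have "res X V W ` ideal_power X I n V \<subseteq> ideal_power X I n W"
    if "opn V" "opn W" "W \<subseteq> V" for V W
    using \<O>.subpresheafD(2)[OF subpresheaf_ideal_power that(1) openin_subset[OF that(1)] _ that(2,3)]
    by auto
  ultimately have P: "subpresheaf (topspace (pts X)) ?P"
    by (intro subpresheaf_product)
  show "subpresheaf (topspace (pts X)) (\<lambda>U. (C U ^^ m) ` ?P U)"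
    unfolding subpresheaf_def
  proof (intro allI impI conjI)
    fix V assume V: "opn V \<and> V \<subseteq> topspace (pts X)"
    then show "(C V ^^ m) ` ?P V \<subseteq> carrier (msec M V)"
      using subpresheafD(1)[OF P] iter_closed by auto
    fix W assume W: "opn W \<and> W \<subseteq> V"
    then show "mres M V W ` (C V ^^ m) ` ?P V \<subseteq> (C W ^^ m) ` ?P W"
      using V subpresheafD[OF P, of V] by (auto simp: iter_res)
  qed
qed

lemma closure_power_image: "cl (power_image m n) = power_image m n"
proof (intro ext equalityI)
  fix U
  show "cl (power_image m n) U \<subseteq> power_image m n U"
    unfolding power_image_def cartier_image_def by (rule closure_least) simp
  show "power_image m n U \<subseteq> cl (power_image m n) U"
    unfolding power_image_def cartier_image_def using closure_carrier closure_opn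
    by (auto intro!: closureI_section)
qed

text \<open>The images of two powers can be compared on elements \<open>C\<^sup>m (g\<^sup>n z)\<close>, in the neighbourhood of a point.\<close>

lemma power_image_leI:
  assumes "\<And>G g V s x. \<lbrakk>generates G g; opn V; V \<subseteq> G; x \<in> V; s \<in> local_image G g m n V\<rbrakk> \<Longrightarrow>
    \<exists>W. opn W \<and> x \<in> W \<and> W \<subseteq> V \<and> mres M V W s \<in> local_image G g m' n' W"
  shows "power_image m n \<le> power_image m' n'"
proof -
  have "cl (power_image m n) \<le> cl (power_image m' n')"
  proof (rule closure_le_locally[OF subpresheaf_power_image])
    fix x assume "x \<in> topspace (pts X)"
    then obtain G g where G: "x \<in> G" "generates G g" using ex_generator by blast
    have "power_image m n U \<subseteq> power_image m' n' U" if U: "opn U" "U \<subseteq> G" for U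
      unfolding power_image_local[OF G(2) U]
    proof (rule closure_least)
      fix V s assume V: "opn V" "V \<subseteq> U" "s \<in> local_image G g m n V" "s \<in> carrier (msec M V)"
      show "s \<in> cl (local_image G g m' n') V"
        using assms[OF G(2) V(1) _ _ V(3)] V U by (intro closureI V(1,4)) auto
    qed
    moreover have "opn G" using G(2) by (simp add: generates_def)
    ultimately show "\<exists>G. opn G \<and> x \<in> G \<and> (\<forall>U. opn U \<and> U \<subseteq> G \<longrightarrow>
        cl (power_image m n) U \<subseteq> cl (power_image m' n') U)"
      unfolding closure_power_image using G(1) by (intro exI[of _ G]) simp
  qed
  then show ?thesis by (simp add: closure_power_image)
qed

text \<open>The projection formula \<open>g\<^sup>k C\<^sup>m x = C\<^sup>m (g\<^bsup>k q\<^sup>m\<^esup> x)\<close>, the source of both \<open>power_image_Suc\<close> and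
  \<open>power_image_shift\<close>.\<close>

lemma local_image_compose: 
  assumes g: "generates G g" and V: "opn V" "V \<subseteq> G" and z: "z \<in> carrier (msec M V)"
  shows "(C V ^^ j) (gpow G g k V \<odot>\<^bsub>msec M V\<^esub>
      (C V ^^ m) (gpow G g n V \<odot>\<^bsub>msec M V\<^esub> z)) =
    (C V ^^ (m + j)) (gpow G g (n + k * q ^ m) V \<odot>\<^bsub>msec M V\<^esub> z)"
proof -
  interpret A: module "sec X V" "msec M V" using V(1) by (rule module_sec)
  let ?g = "res X G V g"
  have gc: "?g \<in> carrier (sec X V)" using g V by (intro res_closed) (auto simp: generates_def)
  have "?g [^]\<^bsub>sec X V\<^esub> (n + k * q ^ m) = (?g [^]\<^bsub>sec X V\<^esub> k) [^]\<^bsub>sec X V\<^esub> (q ^ m) \<otimes>\<^bsub>sec X V\<^esub> ?g [^]\<^bsub>sec X V\<^esub> n"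
    using gc by (simp add: A.R.nat_pow_mult A.R.nat_pow_pow add.commute)
  then have "(?g [^]\<^bsub>sec X V\<^esub> (n + k * q ^ m)) \<odot>\<^bsub>msec M V\<^esub> z =
      ((?g [^]\<^bsub>sec X V\<^esub> k) [^]\<^bsub>sec X V\<^esub> (q ^ m)) \<odot>\<^bsub>msec M V\<^esub> ((?g [^]\<^bsub>sec X V\<^esub> n) \<odot>\<^bsub>msec M V\<^esub> z)"
    using gc z by (simp add: A.smult_assoc1)
  then show ?thesis
    using gc z V iter_smult[of V "?g [^]\<^bsub>sec X V\<^esub> k" "(?g [^]\<^bsub>sec X V\<^esub> n) \<odot>\<^bsub>msec M V\<^esub> z" m]
    by (simp add: funpow_add add.commute[of m j])
qed

lemma local_image_res:
  assumes g: "generates G g" and V: "opn V" "V \<subseteq> G" and W: "opn W" "W \<subseteq> V"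
    and z: "z \<in> carrier (msec M V)"
  shows "mres M V W ((C V ^^ m) (gpow G g n V \<odot>\<^bsub>msec M V\<^esub> z)) =
    (C W ^^ m) (gpow G g n W \<odot>\<^bsub>msec M W\<^esub> mres M V W z)"
proof -
  interpret A: module "sec X V" "msec M V" using V(1) by (rule module_sec)
  note c = compatibleD[OF compatible_power[OF g, of n] V]
  show ?thesis using V W z c(1) c(2)[OF W] by (simp add: iter_res mres_smult)
qed

lemma power_image_antimono: "n \<le> n' \<Longrightarrow> power_image m n' \<le> power_image m n"
proof (rule power_image_leI)
  fix G g V s x assume n: "n \<le> n'" and g: "generates G g" and V: "opn V" "V \<subseteq> G" "x \<in> V" and s: "s \<in> local_image G g m n' V"
  interpret A: module "sec X V" "msec M V" using V(1) by (rule module_sec)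
  obtain z where z: "z \<in> carrier (msec M V)"
    and s: "s = (C V ^^ m) (gpow G g n' V \<odot>\<^bsub>msec M V\<^esub> z)" using s by (auto simp: local_image_def)
  have gc: "res X G V g \<in> carrier (sec X V)" using g V by (intro res_closed) (auto simp: generates_def)
  have "gpow G g n' V = gpow G g n V \<otimes>\<^bsub>sec X V\<^esub> gpow G g (n' - n) V"
    using gc n by (simp add: A.R.nat_pow_mult)
  then have "s = (C V ^^ m) (gpow G g n V \<odot>\<^bsub>msec M V\<^esub>
      (gpow G g (n' - n) V \<odot>\<^bsub>msec M V\<^esub> z))"
    unfolding s using gc z by (simp add: A.smult_assoc1)
  then have "s \<in> local_image G g m n V" unfolding local_image_def using gc z by blast
  moreover have "s \<in> carrier (msec M V)" unfolding s using gc z V by (intro iter_closed) auto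
  ultimately show "\<exists>W. opn W \<and> x \<in> W \<and> W \<subseteq> V \<and> mres M V W s \<in> local_image G g m n W"
    using V by (intro exI[of _ V]) (simp add: mres_self)
qed

text \<open>Since \<open>C\<close> is surjective as a map of sheaves, a section \<open>z\<close> is locally \<open>C y\<close>, and then
  \<open>C\<^sup>m (g\<^sup>n z) = C\<^bsup>m+1\<^esup> (g\<^bsup>nq\<^esup> y)\<close>.\<close>

lemma power_image_Suc: "power_image (Suc m) (n * q) = power_image m n"
proof (rule antisym)
  show "power_image (Suc m) (n * q) \<le> power_image m n"
  proof (rule power_image_leI)
    fix G g V s x assume g: "generates G g" and V: "opn V" "V \<subseteq> G" "x \<in> V" and s: "s \<in> local_image G g (Suc m) (n * q) V"
    interpret A: module "sec X V" "msec M V" using V(1) by (rule module_sec)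
    obtain z where z: "z \<in> carrier (msec M V)"
      and s: "s = (C V ^^ Suc m) (gpow G g (n * q) V \<odot>\<^bsub>msec M V\<^esub> z)" using s by (auto simp: local_image_def)
    have gc: "res X G V g \<in> carrier (sec X V)" using g V by (intro res_closed) (auto simp: generates_def)
    have "s = (C V ^^ m) (gpow G g n V \<odot>\<^bsub>msec M V\<^esub> (C V ^^ 1) z)"
      using local_image_compose[OF g V(1,2) z, of m n 1 0] z gc unfolding s by simp
    moreover have "(C V ^^ 1) z \<in> carrier (msec M V)" using z V by (intro iter_closed)
    ultimately have "s \<in> local_image G g m n V" unfolding local_image_def by blast
    moreover have "s \<in> carrier (msec M V)" unfolding s using gc z V by (intro iter_closed) auto
    ultimately show "\<exists>W. opn W \<and> x \<in> W \<and> W \<subseteq> V \<and> mres M V W s \<in> local_image G g m n W"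
      using V by (intro exI[of _ V]) (simp add: mres_self)
  qed
  show "power_image m n \<le> power_image (Suc m) (n * q)"
  proof (rule power_image_leI)
    fix G g V s x assume g: "generates G g" and V: "opn V" "V \<subseteq> G" "x \<in> V" and s: "s \<in> local_image G g m n V"
    obtain z where z: "z \<in> carrier (msec M V)"
      and s: "s = (C V ^^ m) (gpow G g n V \<odot>\<^bsub>msec M V\<^esub> z)" using s by (auto simp: local_image_def)
    have "z \<in> cartier_image X M C 1 (whole M) V" using pure[OF V(1)] z by (simp add: whole_def)
    then obtain W where W: "opn W" "x \<in> W" "W \<subseteq> V" "mres M V W z \<in> (C W ^^ 1) ` whole M W"
      unfolding cartier_image_def using V(3) by (rule closureE)
    then obtain y where y: "y \<in> carrier (msec M W)" "mres M V W z = (C W ^^ 1) y" by (auto simp: whole_def)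
    interpret A: module "sec X W" "msec M W" using W(1) by (rule module_sec)
    have WG: "W \<subseteq> G" using W V by simp
    have gc: "res X G W g \<in> carrier (sec X W)" using g W WG by (intro res_closed) (auto simp: generates_def)
    have "mres M V W s = (C W ^^ m) (gpow G g n W \<odot>\<^bsub>msec M W\<^esub> (C W ^^ 1) y)"
      unfolding s local_image_res[OF g V(1,2) W(1,3) z] y ..
    also have "\<dots> = (C W ^^ Suc m) (gpow G g (n * q) W \<odot>\<^bsub>msec M W\<^esub> y)"
      using local_image_compose[OF g W(1) WG y(1), of m n 1 0] y gc by simp
    finally have "mres M V W s \<in> local_image G g (Suc m) (n * q) W" unfolding local_image_def using y by blast
    with W show "\<exists>W. opn W \<and> x \<in> W \<and> W \<subseteq> V \<and> mres M V W s \<in> local_image G g (Suc m) (n * q) W" by blast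
  qed
qed

lemma power_image_add: "power_image (m + k) (n * q ^ k) = power_image m n"
proof (induction k)
  case (Suc k)
  then show ?case using power_image_Suc[of "m + k" "n * q ^ k"] by (simp add: ac_simps)
qed simp

text \<open>By the projection formula \<open>C\<^bsup>m+j\<^esup> (g\<^bsup>n + k q\<^sup>m\<^esup> z)\<close> is the image of \<open>C\<^sup>m (g\<^sup>n z)\<close> under \<open>x \<mapsto> C\<^sup>j (g\<^sup>k x)\<close>.
  Applying this map to an equality of the images for \<open>n\<close> and \<open>n + 1\<close> gives the claim.\<close>

lemma power_image_shift:
  assumes eq: "power_image m n = power_image m (n + 1)"
  shows "power_image (m + j) (n + k * q ^ m) = power_image (m + j) (n + k * q ^ m + 1)"
proof (rule antisym)
  show "power_image (m + j) (n + k * q ^ m + 1) \<le> power_image (m + j) (n + k * q ^ m)" by (rule power_image_antimono) simp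
  show "power_image (m + j) (n + k * q ^ m) \<le> power_image (m + j) (n + k * q ^ m + 1)"
  proof (rule power_image_leI)
    fix G g V s x assume g: "generates G g" and V: "opn V" "V \<subseteq> G" "x \<in> V"
      and s: "s \<in> local_image G g (m + j) (n + k * q ^ m) V"
    interpret A: module "sec X V" "msec M V" using V(1) by (rule module_sec)
    obtain z where z: "z \<in> carrier (msec M V)"
      and s: "s = (C V ^^ (m + j)) (gpow G g (n + k * q ^ m) V \<odot>\<^bsub>msec M V\<^esub> z)"
      using s by (auto simp: local_image_def)
    define y where "y = (C V ^^ m) (gpow G g n V \<odot>\<^bsub>msec M V\<^esub> z)"
    have gc: "res X G V g \<in> carrier (sec X V)" using g V by (intro res_closed) (auto simp: generates_def)
    have yc: "y \<in> carrier (msec M V)" unfolding y_def using gc z V by (intro iter_closed) auto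
    have s_y: "s = (C V ^^ j) (gpow G g k V \<odot>\<^bsub>msec M V\<^esub> y)"
      unfolding s y_def using local_image_compose[OF g V(1,2) z] by simp
    have "y \<in> local_image G g m n V" unfolding local_image_def y_def using z by blast
    then have "y \<in> power_image m n V" unfolding power_image_local[OF g V(1,2)] using yc V by (intro closureI_section)
    then have "y \<in> cl (local_image G g m (n + 1)) V"
      unfolding eq power_image_local[OF g V(1,2)] .
    then obtain W where W: "opn W" "x \<in> W" "W \<subseteq> V" "mres M V W y \<in> local_image G g m (n + 1) W"
      using V(3) by (rule closureE)
    then obtain z' where z': "z' \<in> carrier (msec M W)"
      "mres M V W y = (C W ^^ m) (gpow G g (n + 1) W \<odot>\<^bsub>msec M W\<^esub> z')" unfolding local_image_def by blast
    have WG: "W \<subseteq> G" using W V by simp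
    have "mres M V W s = (C W ^^ j) (gpow G g k W \<odot>\<^bsub>msec M W\<^esub> mres M V W y)"
      unfolding s_y by (rule local_image_res[OF g V(1,2) W(1,3) yc])
    also have "\<dots> = (C W ^^ (m + j)) (gpow G g (n + 1 + k * q ^ m) W \<odot>\<^bsub>msec M W\<^esub> z')"
      unfolding z'(2) by (rule local_image_compose[OF g W(1) WG z'(1)])
    also have "n + 1 + k * q ^ m = n + k * q ^ m + 1" by simp
    finally have "mres M V W s \<in> local_image G g (m + j) (n + k * q ^ m + 1) W" unfolding local_image_def using z' by blast
    with W show "\<exists>W. opn W \<and> x \<in> W \<and> W \<subseteq> V \<and> mres M V W s \<in> local_image G g (m + j) (n + k * q ^ m + 1) W" by blast
  qed
qed

lemma test_module_eq:
  "test_module q X M C I t = cl (\<lambda>U. \<Union>m. power_image m (nat \<lceil>t * real q ^ m\<rceil>) U)"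
  by (simp add: test_module_def power_image_def)

lemma power_image_le_test_module: "power_image m (nat \<lceil>t * real q ^ m\<rceil>) \<le> test_module q X M C I t"
proof (rule le_funI, rule subsetI)
  fix U s assume s: "s \<in> power_image m (nat \<lceil>t * real q ^ m\<rceil>) U"
  then have "opn U" "s \<in> carrier (msec M U)"
    using closure_opn closure_carrier unfolding power_image_def cartier_image_def by blast+
  then show "s \<in> test_module q X M C I t U"
    unfolding test_module_eq using s by (intro closureI_section) auto
qed

lemma test_module_leI:
  assumes "\<And>m. power_image m (nat \<lceil>t * real q ^ m\<rceil>) \<le> T" and "cl T = T"
  shows "test_module q X M C I t \<le> T"
proof -
  have "test_module q X M C I t \<le> cl T"
    unfolding test_module_eq using assms(1) by (intro le_funI closure_mono) (auto simp: le_fun_def)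
  then show ?thesis using assms(2) by simp
qed

lemma test_module_antimono:
  assumes "s \<le> t" shows "test_module q X M C I t \<le> test_module q X M C I s"
proof (rule test_module_leI)
  fix m
  have "power_image m (nat \<lceil>t * real q ^ m\<rceil>) \<le> power_image m (nat \<lceil>s * real q ^ m\<rceil>)"
    using assms by (intro power_image_antimono nat_mono ceiling_mono mult_right_mono) auto
  also note power_image_le_test_module
  finally show "power_image m (nat \<lceil>t * real q ^ m\<rceil>) \<le> test_module q X M C I s" .
next
  show "cl (test_module q X M C I s) = test_module q X M C I s"
  proof (intro ext equalityI)
    fix U
    show "cl (test_module q X M C I s) U \<subseteq> test_module q X M C I s U"
      unfolding test_module_eq by (rule closure_least) simp
    show "test_module q X M C I s U \<subseteq> cl (test_module q X M C I s) U"
      unfolding test_module_eq using closure_carrier closure_opn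
      by (auto intro!: closureI_section)
  qed
qed

text \<open>From index \<open>m\<close> on, all members of the union that defines the test module coincide.\<close>

lemma test_module_fraction:
  assumes "q > 0" shows "test_module q X M C I (real n / real q ^ m) = power_image m n"
proof (rule antisym)
  show "test_module q X M C I (real n / real q ^ m) \<le> power_image m n"
  proof (rule test_module_leI)
    fix k
    define l where "l = nat \<lceil>real n / real q ^ m * real q ^ k\<rceil>"
    have "real n / real q ^ m * real q ^ k \<le> real l" unfolding l_def by (rule real_nat_ceiling_ge)
    then have "real n * real q ^ k \<le> real l * real q ^ m"
      using assms by (simp add: pos_divide_le_eq)
    then have "n * q ^ k \<le> l * q ^ m"
      by (metis of_nat_le_iff of_nat_mult of_nat_power)
    then have "power_image (k + m) (l * q ^ m) \<le> power_image (m + k) (n * q ^ k)"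
      using power_image_antimono by (simp add: add.commute)
    then show "power_image k (nat \<lceil>real n / real q ^ m * real q ^ k\<rceil>) \<le> power_image m n"
      by (simp add: power_image_add l_def)
  qed (rule closure_power_image)
  show "power_image m n \<le> test_module q X M C I (real n / real q ^ m)"
    using power_image_le_test_module[of m "real n / real q ^ m"] assms by simp
qed

end

section \<open>Sections over affine opens as fractions, and quasi-compactness\<close>

lemma topspace_zariski: "topspace (zariski A) = {P. primeideal P A}"
proof
  show "topspace (zariski A) \<subseteq> {P. primeideal P A}"
    unfolding topspace_def openin_zariski by blast
  have "{P. primeideal P A} = {P. primeideal P A \<and> \<not> carrier A \<subseteq> P}"
    using primeideal.I_notcarr ideal.Icarr primeideal.axioms(1) by (metis subsetI subset_antisym)
  then have "openin (zariski A) {P. primeideal P A}"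
    unfolding openin_zariski by blast
  then show "{P. primeideal P A} \<subseteq> topspace (zariski A)" by (rule openin_subset)
qed

text \<open>Let \<open>\<S>\<close> contain the equations of all members of a cover. Among the ideals generated by finite
  subsets of \<open>\<S>\<close> there is a maximal one, because the ring is Noetherian, and it contains \<open>\<S>\<close>. The members of the cover
  that contribute its finitely many generators already cover the spectrum.\<close>

lemma compact_space_zariski:
  assumes cr: "cring A" and noeth: "noetherian_ring A"
  shows "compact_space (zariski A)"
  unfolding compact_space
proof (intro allI impI, elim conjE)
  interpret cring A by fact
  interpret noetherian_ring A by fact
  fix \<U> assume opens: "\<forall>U\<in>\<U>. openin (zariski A) U" and cover: "\<Union>\<U> = topspace (zariski A)"
  define D where "D S = {P. primeideal P A \<and> \<not> S \<subseteq> P}" for S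
  define \<S> where "\<S> = \<Union>{S. S \<subseteq> carrier A \<and> D S \<in> \<U>}"
  define \<C> where "\<C> = {genideal A F | F. finite F \<and> F \<subseteq> \<S>}"
  have Sc: "\<S> \<subseteq> carrier A" by (auto simp: \<S>_def)
  have "\<exists>M\<in>\<C>. \<forall>J\<in>\<C>. M \<subseteq> J \<longrightarrow> J = M"
  proof (rule subset_Zorn_nonempty)
    show "\<C> \<noteq> {}" unfolding \<C>_def by blast
    fix c assume c: "c \<noteq> {}" "subset.chain \<C> c"
    have "subset.chain {I. ideal I A} c"
    proof -
      have "\<C> \<subseteq> {I. ideal I A}" using Sc by (auto simp: \<C>_def intro: genideal_ideal)
      with c(2) show ?thesis unfolding subset.chain_def by blast
    qed
    then have "\<Union>c \<in> c" using c(1) ideal_chain_is_trivial by blast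
    then show "\<Union>c \<in> \<C>" using c(2) unfolding subset.chain_def by blast
  qed
  then obtain M where M: "M \<in> \<C>" "\<forall>J\<in>\<C>. M \<subseteq> J \<longrightarrow> J = M" by blast
  then obtain F where F: "finite F" "F \<subseteq> \<S>" and MF: "M = genideal A F"
    by (auto simp: \<C>_def)
  note mx = M(2)[unfolded MF, rule_format]
  have S_F: "\<S> \<subseteq> genideal A F"
  proof
    fix s assume s: "s \<in> \<S>"
    have FsC: "insert s F \<subseteq> carrier A" using s F Sc by auto
    have self: "insert s F \<subseteq> genideal A (insert s F)" by (rule genideal_self[OF FsC])
    then have "genideal A F \<subseteq> genideal A (insert s F)"
      using genideal_ideal[OF FsC] by (intro genideal_minimal) auto
    moreover have "genideal A (insert s F) \<in> \<C>" using s F unfolding \<C>_def by blast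
    ultimately have "genideal A (insert s F) = genideal A F" using mx by blast
    then show "s \<in> genideal A F" using self by blast
  qed
  have "\<forall>s\<in>F. \<exists>S. s \<in> S \<and> D S \<in> \<U>" using F(2) by (auto simp: \<S>_def)
  then obtain T where T: "\<And>s. s \<in> F \<Longrightarrow> s \<in> T s \<and> D (T s) \<in> \<U>" by metis
  show "\<exists>\<F>. finite \<F> \<and> \<F> \<subseteq> \<U> \<and> \<Union>\<F> = topspace (zariski A)"
  proof (intro exI conjI)
    show "finite ((\<lambda>s. D (T s)) ` F)" using F by simp
    show sub: "(\<lambda>s. D (T s)) ` F \<subseteq> \<U>" using T by auto
    show "\<Union>((\<lambda>s. D (T s)) ` F) = topspace (zariski A)"
    proof (rule antisym; rule subsetI)
      fix P assume "P \<in> \<Union>((\<lambda>s. D (T s)) ` F)"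
      then show "P \<in> topspace (zariski A)" using sub cover by blast
    next
      fix P assume P: "P \<in> topspace (zariski A)"
      then have pr: "primeideal P A" by (simp add: topspace_zariski)
      obtain U where U: "U \<in> \<U>" "P \<in> U" using P cover by blast
      with opens have "openin (zariski A) U" by blast
      then obtain S where S: "S \<subseteq> carrier A" "U = D S" unfolding openin_zariski D_def by blast
      have "\<not> F \<subseteq> P"
      proof
        assume "F \<subseteq> P"
        then have "genideal A F \<subseteq> P" by (rule genideal_minimal[OF primeideal.axioms(1)[OF pr]])
        then have "S \<subseteq> P" using S_F S U by (auto simp: \<S>_def)
        then show False using S(2) U(2) by (simp add: D_def)
      qed
      then obtain s where "s \<in> F" "s \<notin> P" by blast
      with T[of s] pr show "P \<in> \<Union>((\<lambda>s. D (T s)) ` F)" by (auto simp: D_def)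
    qed
  qed
qed

locale prime_localization = module A N + primeideal P A
  for A :: "('r, 'x) ring_scheme" (structure) and N :: "('r, 'm, 'y) module_scheme" and P :: "'r set"
begin

lemma denom_mult: "\<lbrakk>s \<in> carrier A - P; t \<in> carrier A - P\<rbrakk> \<Longrightarrow> s \<otimes> t \<in> carrier A - P"
  using I_prime by auto

lemma denom_one: "\<one> \<in> carrier A - P"
  using I_notcarr one_imp_carrier by auto

lemma loc_frac_self: "\<lbrakk>m \<in> carrier N; s \<in> carrier A - P\<rbrakk> \<Longrightarrow> (m, s) \<in> loc_frac A N P m s"
  using denom_one by (auto simp: loc_frac_def)

lemma loc_frac_mono:
  assumes m: "m \<in> carrier N" "s \<in> carrier A - P" and n: "n \<in> carrier N" "t \<in> carrier A - P"
    and u: "u \<in> carrier A - P" "u \<odot>\<^bsub>N\<^esub> (t \<odot>\<^bsub>N\<^esub> m) = u \<odot>\<^bsub>N\<^esub> (s \<odot>\<^bsub>N\<^esub> n)"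
  shows "loc_frac A N P n t \<subseteq> loc_frac A N P m s"
proof
  fix x assume "x \<in> loc_frac A N P n t"
  then obtain k r v where x: "x = (k, r)" and k: "k \<in> carrier N" "r \<in> carrier A - P"
    and v: "v \<in> carrier A - P" "v \<odot>\<^bsub>N\<^esub> (r \<odot>\<^bsub>N\<^esub> n) = v \<odot>\<^bsub>N\<^esub> (t \<odot>\<^bsub>N\<^esub> k)"
    by (auto simp: loc_frac_def)
  have "(u \<otimes> v \<otimes> t) \<odot>\<^bsub>N\<^esub> (r \<odot>\<^bsub>N\<^esub> m) = (v \<otimes> r) \<odot>\<^bsub>N\<^esub> (u \<odot>\<^bsub>N\<^esub> (t \<odot>\<^bsub>N\<^esub> m))"
    using m n k u(1) v(1) by (simp add: smult_assoc1[symmetric] m_ac)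
  also have "\<dots> = (u \<otimes> s) \<odot>\<^bsub>N\<^esub> (v \<odot>\<^bsub>N\<^esub> (r \<odot>\<^bsub>N\<^esub> n))"
    unfolding u(2) using m n k u(1) v(1) by (simp add: smult_assoc1[symmetric] m_ac)
  also have "\<dots> = (u \<otimes> v \<otimes> t) \<odot>\<^bsub>N\<^esub> (s \<odot>\<^bsub>N\<^esub> k)"
    unfolding v(2) using m n k u(1) v(1) by (simp add: smult_assoc1[symmetric] m_ac)
  finally show "x \<in> loc_frac A N P m s"
    using k u v n denom_mult unfolding x loc_frac_def by blast
qed

lemma loc_frac_eqI:
  assumes m: "m \<in> carrier N" "s \<in> carrier A - P" and n: "n \<in> carrier N" "t \<in> carrier A - P"
    and u: "u \<in> carrier A - P" "u \<odot>\<^bsub>N\<^esub> (t \<odot>\<^bsub>N\<^esub> m) = u \<odot>\<^bsub>N\<^esub> (s \<odot>\<^bsub>N\<^esub> n)"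
  shows "loc_frac A N P m s = loc_frac A N P n t"
  using loc_frac_mono[OF m n u] loc_frac_mono[OF n m u(1) u(2)[symmetric]] by blast

lemma loc_fracE:
  assumes "(n, t) \<in> loc_frac A N P m s"
  obtains u where "n \<in> carrier N" "t \<in> carrier A - P" "u \<in> carrier A - P"
    "u \<odot>\<^bsub>N\<^esub> (t \<odot>\<^bsub>N\<^esub> m) = u \<odot>\<^bsub>N\<^esub> (s \<odot>\<^bsub>N\<^esub> n)"
  using assms by (auto simp: loc_frac_def)

text \<open>The operations on a localization run through all representatives of the given fractions. They
  take a single value because the result does not depend on the representatives.\<close>

lemma add_loc_frac:
  assumes m: "m \<in> carrier N" "s \<in> carrier A - P" and n: "n \<in> carrier N" "t \<in> carrier A - P"
  shows "loc_frac A N P m s \<oplus>\<^bsub>loc_module A N P\<^esub> loc_frac A N P n t =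
    loc_frac A N P (t \<odot>\<^bsub>N\<^esub> m \<oplus>\<^bsub>N\<^esub> s \<odot>\<^bsub>N\<^esub> n) (s \<otimes> t)"
proof -
  have "loc_frac A N P (t' \<odot>\<^bsub>N\<^esub> m' \<oplus>\<^bsub>N\<^esub> s' \<odot>\<^bsub>N\<^esub> n') (s' \<otimes> t') =
      loc_frac A N P (t \<odot>\<^bsub>N\<^esub> m \<oplus>\<^bsub>N\<^esub> s \<odot>\<^bsub>N\<^esub> n) (s \<otimes> t)"
    if mem: "(m', s') \<in> loc_frac A N P m s" "(n', t') \<in> loc_frac A N P n t" for m' s' n' t'
  proof -
    obtain u where u: "m' \<in> carrier N" "s' \<in> carrier A - P" "u \<in> carrier A - P"
      "u \<odot>\<^bsub>N\<^esub> (s' \<odot>\<^bsub>N\<^esub> m) = u \<odot>\<^bsub>N\<^esub> (s \<odot>\<^bsub>N\<^esub> m')" by (rule loc_fracE[OF mem(1)])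
    obtain v where v: "n' \<in> carrier N" "t' \<in> carrier A - P" "v \<in> carrier A - P"
      "v \<odot>\<^bsub>N\<^esub> (t' \<odot>\<^bsub>N\<^esub> n) = v \<odot>\<^bsub>N\<^esub> (t \<odot>\<^bsub>N\<^esub> n')" by (rule loc_fracE[OF mem(2)])
    have "(u \<otimes> v) \<odot>\<^bsub>N\<^esub> ((s \<otimes> t) \<odot>\<^bsub>N\<^esub> (t' \<odot>\<^bsub>N\<^esub> m' \<oplus>\<^bsub>N\<^esub> s' \<odot>\<^bsub>N\<^esub> n')) =
       (v \<otimes> t \<otimes> t') \<odot>\<^bsub>N\<^esub> (u \<odot>\<^bsub>N\<^esub> (s \<odot>\<^bsub>N\<^esub> m')) \<oplus>\<^bsub>N\<^esub> (u \<otimes> s \<otimes> s') \<odot>\<^bsub>N\<^esub> (v \<odot>\<^bsub>N\<^esub> (t \<odot>\<^bsub>N\<^esub> n'))"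
      using m n u(1-3) v(1-3) by (simp add: smult_r_distr smult_assoc1[symmetric] m_ac)
    also have "\<dots> = (v \<otimes> t \<otimes> t') \<odot>\<^bsub>N\<^esub> (u \<odot>\<^bsub>N\<^esub> (s' \<odot>\<^bsub>N\<^esub> m)) \<oplus>\<^bsub>N\<^esub> (u \<otimes> s \<otimes> s') \<odot>\<^bsub>N\<^esub> (v \<odot>\<^bsub>N\<^esub> (t' \<odot>\<^bsub>N\<^esub> n))"
      by (simp only: u(4) v(4))
    also have "\<dots> = (u \<otimes> v) \<odot>\<^bsub>N\<^esub> ((s' \<otimes> t') \<odot>\<^bsub>N\<^esub> (t \<odot>\<^bsub>N\<^esub> m \<oplus>\<^bsub>N\<^esub> s \<odot>\<^bsub>N\<^esub> n))"
      using m n u(1-3) v(1-3) by (simp add: smult_r_distr smult_assoc1[symmetric] m_ac)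
    finally show ?thesis
      using m n u v denom_mult by (intro loc_frac_eqI[where u = "u \<otimes> v"]) auto
  qed
  then have "(\<Union>(m', s')\<in>loc_frac A N P m s. \<Union>(n', t')\<in>loc_frac A N P n t.
       loc_frac A N P (t' \<odot>\<^bsub>N\<^esub> m' \<oplus>\<^bsub>N\<^esub> s' \<odot>\<^bsub>N\<^esub> n') (s' \<otimes> t')) =
     (\<Union>(m', s')\<in>loc_frac A N P m s. \<Union>(n', t')\<in>loc_frac A N P n t.
       loc_frac A N P (t \<odot>\<^bsub>N\<^esub> m \<oplus>\<^bsub>N\<^esub> s \<odot>\<^bsub>N\<^esub> n) (s \<otimes> t))"
    by (intro SUP_cong refl) (auto intro!: SUP_cong)
  also have "\<dots> = loc_frac A N P (t \<odot>\<^bsub>N\<^esub> m \<oplus>\<^bsub>N\<^esub> s \<odot>\<^bsub>N\<^esub> n) (s \<otimes> t)"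
    using loc_frac_self[OF m] loc_frac_self[OF n] by auto
  finally show ?thesis by (simp add: loc_module_def)
qed

lemma smult_loc_frac:
  assumes a: "a \<in> carrier A" "s \<in> carrier A - P" and m: "m \<in> carrier N" "t \<in> carrier A - P"
  shows "loc_frac A (self_module A) P a s \<odot>\<^bsub>loc_module A N P\<^esub> loc_frac A N P m t =
    loc_frac A N P (a \<odot>\<^bsub>N\<^esub> m) (s \<otimes> t)"
proof -
  have sm: "module A (self_module A)" by (rule module_self_module) (rule R.is_cring)
  interpret S: prime_localization A "self_module A" P
    by (intro prime_localization.intro sm) (rule primeideal_axioms)
  have eq: "loc_frac A N P (a' \<odot>\<^bsub>N\<^esub> m') (s' \<otimes> t') = loc_frac A N P (a \<odot>\<^bsub>N\<^esub> m) (s \<otimes> t)"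
    if mem: "(a', s') \<in> loc_frac A (self_module A) P a s" "(m', t') \<in> loc_frac A N P m t" for a' s' m' t'
  proof -
    obtain u where "a' \<in> carrier (self_module A)" and u: "s' \<in> carrier A - P" "u \<in> carrier A - P"
      "u \<odot>\<^bsub>self_module A\<^esub> (s' \<odot>\<^bsub>self_module A\<^esub> a) = u \<odot>\<^bsub>self_module A\<^esub> (s \<odot>\<^bsub>self_module A\<^esub> a')"
      by (rule S.loc_fracE[OF mem(1)])
    then have a': "a' \<in> carrier A" and ueq: "u \<otimes> (s' \<otimes> a) = u \<otimes> (s \<otimes> a')" by (simp_all add: alg_module_def)
    obtain v where v: "m' \<in> carrier N" "t' \<in> carrier A - P" "v \<in> carrier A - P"
      "v \<odot>\<^bsub>N\<^esub> (t' \<odot>\<^bsub>N\<^esub> m) = v \<odot>\<^bsub>N\<^esub> (t \<odot>\<^bsub>N\<^esub> m')" by (rule loc_fracE[OF mem(2)])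
    have "(u \<otimes> v) \<odot>\<^bsub>N\<^esub> ((s \<otimes> t) \<odot>\<^bsub>N\<^esub> (a' \<odot>\<^bsub>N\<^esub> m')) = (u \<otimes> (s \<otimes> a')) \<odot>\<^bsub>N\<^esub> (v \<odot>\<^bsub>N\<^esub> (t \<odot>\<^bsub>N\<^esub> m'))"
      using m a a' u(1,2) v(1-3) by (simp add: smult_assoc1[symmetric] m_ac)
    also have "\<dots> = (u \<otimes> (s' \<otimes> a)) \<odot>\<^bsub>N\<^esub> (v \<odot>\<^bsub>N\<^esub> (t' \<odot>\<^bsub>N\<^esub> m))"
      by (simp only: ueq v(4))
    also have "\<dots> = (u \<otimes> v) \<odot>\<^bsub>N\<^esub> ((s' \<otimes> t') \<odot>\<^bsub>N\<^esub> (a \<odot>\<^bsub>N\<^esub> m))"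
      using m a a' u(1,2) v(1-3) by (simp add: smult_assoc1[symmetric] m_ac)
    finally show ?thesis
      using m a a' u v denom_mult by (intro loc_frac_eqI[where u = "u \<otimes> v"]) auto
  qed
  have "(a, s) \<in> loc_frac A (self_module A) P a s"
    using a by (intro S.loc_frac_self) (simp_all add: alg_module_def)
  then have "(\<Union>(a', s')\<in>loc_frac A (self_module A) P a s. \<Union>(m', t')\<in>loc_frac A N P m t.
       loc_frac A N P (a \<odot>\<^bsub>N\<^esub> m) (s \<otimes> t)) = loc_frac A N P (a \<odot>\<^bsub>N\<^esub> m) (s \<otimes> t)"
    using loc_frac_self[OF m] by auto
  moreover have "(\<Union>(a', s')\<in>loc_frac A (self_module A) P a s. \<Union>(m', t')\<in>loc_frac A N P m t.
       loc_frac A N P (a' \<odot>\<^bsub>N\<^esub> m') (s' \<otimes> t')) =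
     (\<Union>(a', s')\<in>loc_frac A (self_module A) P a s. \<Union>(m', t')\<in>loc_frac A N P m t.
       loc_frac A N P (a \<odot>\<^bsub>N\<^esub> m) (s \<otimes> t))"
    using eq by (intro SUP_cong refl) (auto intro!: SUP_cong)
  ultimately show ?thesis by (simp add: loc_module_def)
qed

end

definition frac_section ::
  "('r, 'x) ring_scheme \<Rightarrow> ('r, 'm, 'y) module_scheme \<Rightarrow> 'r set set \<Rightarrow> 'm \<Rightarrow> 'r \<Rightarrow> 'r set \<Rightarrow> ('m \<times> 'r) set"
  where "frac_section A N D m s = (\<lambda>P\<in>D. loc_frac A N P m s)"

lemma frac_section_closed:
  assumes "openin (zariski A) D" "m \<in> carrier N" "s \<in> carrier A" "\<And>Q. Q \<in> D \<Longrightarrow> s \<notin> Q"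
  shows "frac_section A N D m s \<in> carrier (msec (tilde A N) D)"
  using assms by (auto simp: tilde_def frac_section_def)

lemma frac_section_restrict:
  "V \<subseteq> D \<Longrightarrow> mres (tilde A N) D V (frac_section A N D m s) = frac_section A N V m s"
  by (rule ext) (auto simp: tilde_def frac_section_def restrict_def)

lemma prime_localizationI:
  assumes "module A N" "openin (zariski A) D" "P \<in> D" shows "prime_localization A N P"
  using assms openin_subset[OF assms(2)] by (intro prime_localization.intro) (auto simp: topspace_zariski)

lemma add_frac_section:
  assumes N: "module A N" and D: "openin (zariski A) D" and "m \<in> carrier N" "n \<in> carrier N"
  shows "frac_section A N D m \<one>\<^bsub>A\<^esub> \<oplus>\<^bsub>msec (tilde A N) D\<^esub> frac_section A N D n \<one>\<^bsub>A\<^esub> =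
    frac_section A N D (m \<oplus>\<^bsub>N\<^esub> n) \<one>\<^bsub>A\<^esub>"
proof
  fix P
  show "(frac_section A N D m \<one>\<^bsub>A\<^esub> \<oplus>\<^bsub>msec (tilde A N) D\<^esub> frac_section A N D n \<one>\<^bsub>A\<^esub>) P =
    frac_section A N D (m \<oplus>\<^bsub>N\<^esub> n) \<one>\<^bsub>A\<^esub> P"
  proof (cases "P \<in> D")
    case True
    then interpret prime_localization A N P using N D by (intro prime_localizationI)
    show ?thesis using True assms add_loc_frac[OF assms(3) denom_one assms(4) denom_one]
      by (simp add: tilde_def frac_section_def)
  qed (simp add: tilde_def frac_section_def)
qed

lemma smult_frac_section:
  assumes N: "module A N" and D: "openin (zariski A) D" and "m \<in> carrier N" "a \<in> carrier A"
    and st: "s \<in> carrier A" "t \<in> carrier A" "\<And>Q. Q \<in> D \<Longrightarrow> s \<notin> Q" "\<And>Q. Q \<in> D \<Longrightarrow> t \<notin> Q"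
  shows "frac_section A (self_module A) D a s \<odot>\<^bsub>msec (tilde A N) D\<^esub> frac_section A N D m t =
    frac_section A N D (a \<odot>\<^bsub>N\<^esub> m) (s \<otimes>\<^bsub>A\<^esub> t)"
proof
  fix P
  show "(frac_section A (self_module A) D a s \<odot>\<^bsub>msec (tilde A N) D\<^esub> frac_section A N D m t) P =
    frac_section A N D (a \<odot>\<^bsub>N\<^esub> m) (s \<otimes>\<^bsub>A\<^esub> t) P"
  proof (cases "P \<in> D")
    case True
    then interpret prime_localization A N P using N D by (intro prime_localizationI)
    show ?thesis using True assms smult_loc_frac[OF assms(4) _ assms(3), of s t]
      by (simp add: tilde_def frac_section_def)
  qed (simp add: tilde_def frac_section_def)
qed

lemma Spec_simps:
  "pts (Spec A) = zariski A"
  "carrier (sec (Spec A) U) = carrier (msec (tilde A (self_module A)) U)"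
  "mult (sec (Spec A) U) = smult (msec (tilde A (self_module A)) U)"
  "add (sec (Spec A) U) = add (msec (tilde A (self_module A)) U)"
  "one (sec (Spec A) U) = frac_section A (self_module A) U \<one>\<^bsub>A\<^esub> \<one>\<^bsub>A\<^esub>"
  "res (Spec A) = mres (tilde A (self_module A))"
  by (simp_all add: Spec_def Let_def frac_section_def)

lemma module_sheaf_iso_structure_module:
  assumes "ringed_space_iso X (Spec A) f \<phi>"
  shows "module_sheaf_iso X (Spec A) f \<phi> (structure_module X) (tilde A (self_module A)) \<phi>"
proof -
  have hom: "\<phi> V \<in> ring_hom (sec (Spec A) V) (sec X (preim X f V))" if "openin (zariski A) V" for V
    using assms that by (simp add: ringed_space_iso_def ring_iso_def Spec_simps)
  show ?thesis
    using assms ring_hom_add[OF hom] ring_hom_mult[OF hom]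
    unfolding ringed_space_iso_def module_sheaf_iso_def ring_iso_def
    by (simp add: Spec_simps)
qed

context sheaf_of_modules
begin

text \<open>Every section over a small open set \<open>V\<close> in a chart is a fraction whose numerator and denominator
  come from \<open>U\<close>. The maps \<open>\<theta>\<close> and \<open>\<xi>\<close> send an element of the ring, respectively of the module, to
  the global section with denominator \<open>1\<close>. The map \<open>\<theta>\<close> appears because a chart may identify \<open>U\<close>
  with the spectrum in a way that does not induce the identity on the ring of sections.\<close>

lemma affine_chart_fractions:
  assumes chart: "affine_chart X U f \<phi>" and N: "module (sec X U) N"
    and iso: "module_sheaf_iso (restrict_space_to X U) (Spec (sec X U)) f \<phi> M (tilde (sec X U) N) \<psi>"
  defines "T \<equiv> topspace (zariski (sec X U))"
  defines "\<theta> \<equiv> \<lambda>a. \<phi> T (frac_section (sec X U) (self_module (sec X U)) T a \<one>\<^bsub>sec X U\<^esub>)"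
    and "\<xi> \<equiv> \<lambda>n. \<psi> T (frac_section (sec X U) N T n \<one>\<^bsub>sec X U\<^esub>)"
  shows "a \<in> carrier (sec X U) \<Longrightarrow> \<theta> a \<in> carrier (sec X U)"
    and "n \<in> carrier N \<Longrightarrow> \<xi> n \<in> carrier (msec M U)"
    and "\<lbrakk>n \<in> carrier N; n' \<in> carrier N\<rbrakk> \<Longrightarrow> \<xi> (n \<oplus>\<^bsub>N\<^esub> n') = \<xi> n \<oplus>\<^bsub>msec M U\<^esub> \<xi> n'"
    and "\<lbrakk>a \<in> carrier (sec X U); n \<in> carrier N\<rbrakk> \<Longrightarrow> \<xi> (a \<odot>\<^bsub>N\<^esub> n) = \<theta> a \<odot>\<^bsub>msec M U\<^esub> \<xi> n"
    and "\<lbrakk>opn W; W \<subseteq> U; y \<in> W; z \<in> carrier (msec M W)\<rbrakk> \<Longrightarrow>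
      \<exists>V b s n. opn V \<and> y \<in> V \<and> V \<subseteq> W \<and> b \<in> carrier (sec X V) \<and> s \<in> carrier (sec X U) \<and> n \<in> carrier N \<and>
        b \<otimes>\<^bsub>sec X V\<^esub> res X U V (\<theta> s) = \<one>\<^bsub>sec X V\<^esub> \<and>
        mres M W V z = b \<odot>\<^bsub>msec M V\<^esub> mres M U V (\<xi> n)"
proof -
  let ?A = "sec X U" and ?Y = "restrict_space_to X U"
  let ?pre = "preim ?Y f"
  have U: "opn U" and riso: "ringed_space_iso ?Y (Spec ?A) f \<phi>"
    using chart by (auto simp: affine_chart_def)
  interpret A: module ?A N by fact
  have selfm: "module ?A (self_module ?A)" by (rule module_self_module) (rule A.R.is_cring)
  have hom: "homeomorphic_map (subtopology (pts X) U) (zariski ?A) f"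
    using riso by (simp add: ringed_space_iso_def Spec_simps restrict_space_to_def)
  have topU: "topspace (subtopology (pts X) U) = U"
    using openin_subset[OF U] by (simp add: Int_absorb1)
  have pre: "?pre D = {x \<in> U. f x \<in> D}" for D
    using topU by (simp add: preim_def restrict_space_to_def)
  have opn_pre: "opn (?pre D)" if "openin (zariski ?A) D" for D
    using openin_continuous_map_preimage[OF homeomorphic_imp_continuous_map[OF hom] that, unfolded topU] U
    by (simp add: pre openin_open_subtopology)
  have pre_sub: "?pre D \<subseteq> U" for D by (auto simp: pre)
  have T: "openin (zariski ?A) T" by (simp add: T_def)
  have preT: "?pre T = U"
    using homeomorphic_imp_surjective_map[OF hom] topU by (auto simp: pre T_def)
  have one_notin: "\<one>\<^bsub>?A\<^esub> \<notin> Q" if "openin (zariski ?A) D" "Q \<in> D" for D Q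
    using prime_localization.denom_one[OF prime_localizationI[OF N that]] by simp
  note ri = riso[unfolded ringed_space_iso_def Spec_simps]
  have phi: "\<phi> D \<in> ring_iso (sec (Spec ?A) D) (sec X (?pre D))" if "openin (zariski ?A) D" for D
    using ri that by (simp add: restrict_space_to_def)
  have phi_res: "res X (?pre D) (?pre V) (\<phi> D \<sigma>) = \<phi> V (mres (tilde ?A (self_module ?A)) D V \<sigma>)"
    if "openin (zariski ?A) D" "openin (zariski ?A) V" "V \<subseteq> D"
      "\<sigma> \<in> carrier (msec (tilde ?A (self_module ?A)) D)" for D V \<sigma>
    using ri that by (simp add: restrict_space_to_def Spec_simps)
  note mi = iso[unfolded module_sheaf_iso_def Spec_simps]
  have psi_bij: "bij_betw (\<psi> D) (carrier (msec (tilde ?A N) D)) (carrier (msec M (?pre D)))"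
    and psi_add: "\<And>x y. \<lbrakk>x \<in> carrier (msec (tilde ?A N) D); y \<in> carrier (msec (tilde ?A N) D)\<rbrakk> \<Longrightarrow>
      \<psi> D (x \<oplus>\<^bsub>msec (tilde ?A N) D\<^esub> y) = \<psi> D x \<oplus>\<^bsub>msec M (?pre D)\<^esub> \<psi> D y"
    and psi_smult: "\<And>a x. \<lbrakk>a \<in> carrier (msec (tilde ?A (self_module ?A)) D); x \<in> carrier (msec (tilde ?A N) D)\<rbrakk> \<Longrightarrow>
      \<psi> D (a \<odot>\<^bsub>msec (tilde ?A N) D\<^esub> x) = \<phi> D a \<odot>\<^bsub>msec M (?pre D)\<^esub> \<psi> D x"
    if "openin (zariski ?A) D" for D
    using mi that by (simp_all add: Spec_simps)
  have psi_res: "mres M (?pre D) (?pre V) (\<psi> D \<sigma>) = \<psi> V (mres (tilde ?A N) D V \<sigma>)"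
    if "openin (zariski ?A) D" "openin (zariski ?A) V" "V \<subseteq> D"
      "\<sigma> \<in> carrier (msec (tilde ?A N) D)" for D V \<sigma>
    using mi that by simp
  have psi_closed: "\<psi> D \<sigma> \<in> carrier (msec M (?pre D))"
    if "openin (zariski ?A) D" "\<sigma> \<in> carrier (msec (tilde ?A N) D)" for D \<sigma>
    using psi_bij[OF that(1)] that(2) by (auto simp: bij_betw_def)
  have phi_closed: "\<phi> D \<sigma> \<in> carrier (sec X (?pre D))"
    if "openin (zariski ?A) D" "\<sigma> \<in> carrier (msec (tilde ?A (self_module ?A)) D)" for D \<sigma>
    using phi[OF that(1)] that(2) by (auto simp: ring_iso_def ring_hom_def Spec_simps)
  have fN: "frac_section ?A N D n \<one>\<^bsub>?A\<^esub> \<in> carrier (msec (tilde ?A N) D)"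
    if "openin (zariski ?A) D" "n \<in> carrier N" for D n
    using that one_notin by (intro frac_section_closed) auto
  have selfc: "carrier (self_module ?A) = carrier ?A" by (simp add: alg_module_def)
  have fA: "frac_section ?A (self_module ?A) D a \<one>\<^bsub>?A\<^esub> \<in> carrier (msec (tilde ?A (self_module ?A)) D)"
    if "openin (zariski ?A) D" "a \<in> carrier ?A" for D a
    using that one_notin by (intro frac_section_closed) (auto simp: selfc)
  show "\<theta> a \<in> carrier ?A" if "a \<in> carrier ?A" for a
    using phi_closed[OF T fA[OF T that]] by (simp add: \<theta>_def preT)
  show "\<xi> n \<in> carrier (msec M U)" if "n \<in> carrier N" for n
    using psi_closed[OF T fN[OF T that]] by (simp add: \<xi>_def preT)
  show "\<xi> (n \<oplus>\<^bsub>N\<^esub> n') = \<xi> n \<oplus>\<^bsub>msec M U\<^esub> \<xi> n'" if "n \<in> carrier N" "n' \<in> carrier N" for n n'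
    using psi_add[OF T fN[OF T that(1)] fN[OF T that(2)]] add_frac_section[OF N T that]
    by (simp add: \<xi>_def preT)
  show "\<xi> (a \<odot>\<^bsub>N\<^esub> n) = \<theta> a \<odot>\<^bsub>msec M U\<^esub> \<xi> n" if "a \<in> carrier ?A" "n \<in> carrier N" for a n
    using psi_smult[OF T fA[OF T that(1)] fN[OF T that(2)]] that one_notin[OF T]
      smult_frac_section[OF N T that(2,1), of "\<one>\<^bsub>?A\<^esub>" "\<one>\<^bsub>?A\<^esub>"]
    by (simp add: \<xi>_def \<theta>_def preT)
  assume W: "opn W" "W \<subseteq> U" "y \<in> W" and z: "z \<in> carrier (msec M W)"
  \<comment> \<open>In the chart the section is a single fraction \<open>m/s\<close> near the point, and \<open>?\<beta>\<close> below is \<open>1/s\<close>.\<close>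
  define D where "D = f ` W"
  have "openin (subtopology (pts X) U) W" using W U by (simp add: openin_open_subtopology)
  then have D: "openin (zariski ?A) D"
    using homeomorphic_imp_open_map[OF hom] by (auto simp: open_map_def D_def)
  have preD: "?pre D = W"
  proof -
    have "inj_on f U" using homeomorphic_imp_injective_map[OF hom] topU by simp
    then show ?thesis using W(2) by (auto simp: pre D_def inj_on_def)
  qed
  have "z \<in> \<psi> D ` carrier (msec (tilde ?A N) D)"
    using bij_betw_imp_surj_on[OF psi_bij[OF D]] z unfolding preD by simp
  then obtain \<sigma> where \<sigma>: "\<sigma> \<in> carrier (msec (tilde ?A N) D)" "\<psi> D \<sigma> = z"
    by blast
  have "f y \<in> D" using W by (simp add: D_def)
  then obtain Z m s where Z: "openin (zariski ?A) Z" "f y \<in> Z" "Z \<subseteq> D"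
    and ms: "m \<in> carrier N" "s \<in> carrier ?A" "\<forall>Q\<in>Z. s \<notin> Q \<and> \<sigma> Q = loc_frac ?A N Q m s"
    using \<sigma>(1) unfolding tilde_def by auto
  let ?V = "?pre Z"
  let ?\<beta> = "frac_section ?A (self_module ?A) Z \<one>\<^bsub>?A\<^esub> s"
  let ?b = "\<phi> Z ?\<beta>"
  have ZT: "Z \<subseteq> T" unfolding T_def by (rule openin_subset[OF Z(1)])
  have V: "opn ?V" "y \<in> ?V" "?V \<subseteq> W"
    using opn_pre[OF Z(1)] W Z preD by (auto simp: pre)
  have \<beta>: "?\<beta> \<in> carrier (msec (tilde ?A (self_module ?A)) Z)"
    using Z ms by (intro frac_section_closed) (auto simp: selfc)
  have restr: "mres (tilde ?A N) D Z \<sigma> = frac_section ?A N Z m s"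
    using ms by (intro ext) (auto simp: tilde_def frac_section_def restrict_def)
  have sdot: "?\<beta> \<odot>\<^bsub>msec (tilde ?A N) Z\<^esub> frac_section ?A N Z m \<one>\<^bsub>?A\<^esub> = frac_section ?A N Z m s"
    using smult_frac_section[OF N Z(1) ms(1) A.R.one_closed ms(2) A.R.one_closed] ms one_notin[OF Z(1)]
    by simp
  have "mres M W ?V z = \<psi> Z (frac_section ?A N Z m s)"
    using psi_res[OF D Z(1,3) \<sigma>(1)] by (simp add: preD \<sigma>(2) restr)
  also have "\<dots> = ?b \<odot>\<^bsub>msec M ?V\<^esub> \<psi> Z (frac_section ?A N Z m \<one>\<^bsub>?A\<^esub>)"
    using psi_smult[OF Z(1) \<beta> fN[OF Z(1) ms(1)]] sdot by simp
  also have "\<psi> Z (frac_section ?A N Z m \<one>\<^bsub>?A\<^esub>) = mres M U ?V (\<xi> m)"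
    using psi_res[OF T Z(1) ZT fN[OF T ms(1)]] frac_section_restrict[OF ZT, of ?A N m "\<one>\<^bsub>?A\<^esub>"]
    by (simp add: \<xi>_def preT)
  finally have zV: "mres M W ?V z = ?b \<odot>\<^bsub>msec M ?V\<^esub> mres M U ?V (\<xi> m)" .
  have "res X U ?V (\<theta> s) = \<phi> Z (frac_section ?A (self_module ?A) Z s \<one>\<^bsub>?A\<^esub>)"
    using phi_res[OF T Z(1) ZT fA[OF T ms(2)]] frac_section_restrict[OF ZT, of ?A "self_module ?A" s "\<one>\<^bsub>?A\<^esub>"]
    by (simp add: \<theta>_def preT)
  then have "?b \<otimes>\<^bsub>sec X ?V\<^esub> res X U ?V (\<theta> s) =
      \<phi> Z (?\<beta> \<odot>\<^bsub>msec (tilde ?A (self_module ?A)) Z\<^esub> frac_section ?A (self_module ?A) Z s \<one>\<^bsub>?A\<^esub>)"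
    using phi[OF Z(1)] \<beta> fA[OF Z(1) ms(2)] by (auto simp: ring_iso_def ring_hom_def Spec_simps)
  also have "?\<beta> \<odot>\<^bsub>msec (tilde ?A (self_module ?A)) Z\<^esub> frac_section ?A (self_module ?A) Z s \<one>\<^bsub>?A\<^esub> =
      frac_section ?A (self_module ?A) Z s s"
    using smult_frac_section[OF selfm Z(1) _ A.R.one_closed ms(2) A.R.one_closed, of s] ms one_notin[OF Z(1)]
    by (simp add: alg_module_def)
  also have "\<dots> = \<one>\<^bsub>sec (Spec ?A) Z\<^esub>"
    unfolding Spec_simps
  proof
    fix P
    show "frac_section ?A (self_module ?A) Z s s P = frac_section ?A (self_module ?A) Z \<one>\<^bsub>?A\<^esub> \<one>\<^bsub>?A\<^esub> P"
    proof (cases "P \<in> Z")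
      case True
      then interpret L: prime_localization ?A "self_module ?A" P
        using selfm Z(1) by (intro prime_localizationI)
      have "loc_frac ?A (self_module ?A) P s s = loc_frac ?A (self_module ?A) P \<one>\<^bsub>?A\<^esub> \<one>\<^bsub>?A\<^esub>"
        using True ms L.denom_one by (intro L.loc_frac_eqI[where u = "\<one>\<^bsub>?A\<^esub>"]) (auto simp: alg_module_def)
      then show ?thesis using True by (simp add: frac_section_def)
    qed (simp add: frac_section_def)
  qed
  also have "\<phi> Z \<one>\<^bsub>sec (Spec ?A) Z\<^esub> = \<one>\<^bsub>sec X ?V\<^esub>"
    using phi[OF Z(1)] by (simp add: ring_iso_def ring_hom_one)
  finally have inv: "?b \<otimes>\<^bsub>sec X ?V\<^esub> res X U ?V (\<theta> s) = \<one>\<^bsub>sec X ?V\<^esub>" .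
  show "\<exists>V b s n. opn V \<and> y \<in> V \<and> V \<subseteq> W \<and> b \<in> carrier (sec X V) \<and> s \<in> carrier (sec X U) \<and> n \<in> carrier N \<and>
        b \<otimes>\<^bsub>sec X V\<^esub> res X U V (\<theta> s) = \<one>\<^bsub>sec X V\<^esub> \<and>
        mres M W V z = b \<odot>\<^bsub>msec M V\<^esub> mres M U V (\<xi> n)"
    using V phi_closed[OF Z(1) \<beta>] ms inv zV
    by (intro exI[of _ ?V] exI[of _ ?b] exI[of _ s] exI[of _ m]) simp
qed

lemma compactin_affine_noetherian:
  assumes "affine_open X U" "noetherian_ring (sec X U)"
  shows "compactin (pts X) U"
proof -
  obtain f \<phi> where chart: "affine_chart X U f \<phi>" using assms(1) by (auto simp: affine_open_def)
  then have U: "opn U" and "homeomorphic_map (subtopology (pts X) U) (zariski (sec X U)) f"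
    by (simp_all add: affine_chart_def ringed_space_iso_def Spec_simps restrict_space_to_def)
  then have "subtopology (pts X) U homeomorphic_space zariski (sec X U)"
    using homeomorphic_map_imp_homeomorphic_space by blast
  then have "compact_space (subtopology (pts X) U)"
    using compact_space_zariski[OF cring_sec[OF U] assms(2)] homeomorphic_compact_space by blast
  then show ?thesis using openin_subset[OF U] by (simp add: compactin_subspace)
qed

lemma compact_space_noetherian_scheme:
  assumes "noetherian_scheme X" shows "compact_space (pts X)"
proof -
  obtain \<U> where \<U>: "finite \<U>" "\<Union>\<U> = topspace (pts X)"
    "\<And>U. U \<in> \<U> \<Longrightarrow> affine_open X U \<and> noetherian_ring (sec X U)"
    using assms by (auto simp: noetherian_scheme_def)
  then have "compactin (pts X) (\<Union>\<U>)"
    using compactin_affine_noetherian by (intro compactin_Union) auto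
  then show ?thesis by (simp add: compact_space_def \<U>(2))
qed

end

section \<open>Local finite generation of modules\<close>

text \<open>Finite generation enters through the set of finite sums of multiples of the generators. As an
  inductive set it yields the rule \<open>additive_span_induct\<close>, which replaces manipulations of finite
  sums: an additive map into an additively closed set has to be examined on the summands only.\<close>

inductive_set additive_span :: "('a, 'x) ring_scheme \<Rightarrow> 'a set \<Rightarrow> 'a set"
  for G :: "('a, 'x) ring_scheme" and B :: "'a set" where
  zero: "\<zero>\<^bsub>G\<^esub> \<in> additive_span G B"
| add: "\<lbrakk>b \<in> B; x \<in> additive_span G B\<rbrakk> \<Longrightarrow> b \<oplus>\<^bsub>G\<^esub> x \<in> additive_span G B"

context abelian_monoid
begin

lemma additive_span_closed: "\<lbrakk>x \<in> additive_span G B; B \<subseteq> carrier G\<rbrakk> \<Longrightarrow> x \<in> carrier G"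
  by (induction rule: additive_span.induct) auto

lemma additive_span_base: "\<lbrakk>b \<in> B; B \<subseteq> carrier G\<rbrakk> \<Longrightarrow> b \<in> additive_span G B"
  using additive_span.add[OF _ additive_span.zero, of b B G] by auto

lemma additive_span_add:
  assumes "x \<in> additive_span G B" "y \<in> additive_span G B" "B \<subseteq> carrier G"
  shows "x \<oplus> y \<in> additive_span G B"
  using assms(1)
proof (induction rule: additive_span.induct)
  case zero
  then show ?case using assms additive_span_closed by simp
next
  case (add b x)
  have "b \<in> carrier G" "x \<in> carrier G" "y \<in> carrier G"
    using add.hyps assms(2,3) additive_span_closed[of _ B] by auto
  then have "b \<oplus> x \<oplus> y = b \<oplus> (x \<oplus> y)" by (rule a_assoc)
  then show ?case using additive_span.add[OF add.hyps(1) add.IH] by simp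
qed

lemma finsum_in_additive_span:
  assumes "finite S" "\<And>s. s \<in> S \<Longrightarrow> f s \<in> B" "B \<subseteq> carrier G"
  shows "(\<Oplus>s\<in>S. f s) \<in> additive_span G B"
  using assms
proof (induction rule: finite_induct)
  case empty
  then show ?case by (simp add: additive_span.zero)
next
  case (insert s S)
  then have "(\<Oplus>s\<in>insert s S. f s) = f s \<oplus> (\<Oplus>s\<in>S. f s)"
    by (intro finsum_insert) auto
  then show ?case using insert by (auto intro: additive_span.add)
qed

lemma additive_span_induct:
  assumes x: "x \<in> additive_span G B" and B: "B \<subseteq> carrier G"
    and h: "\<And>a b. \<lbrakk>a \<in> carrier G; b \<in> carrier G\<rbrakk> \<Longrightarrow> h (a \<oplus> b) = h a \<oplus>\<^bsub>H\<^esub> h b"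
    and zero: "h \<zero> \<in> T" and base: "\<And>b. b \<in> B \<Longrightarrow> h b \<in> T"
    and T: "\<And>s t. \<lbrakk>s \<in> T; t \<in> T\<rbrakk> \<Longrightarrow> s \<oplus>\<^bsub>H\<^esub> t \<in> T"
  shows "h x \<in> T"
  using x
proof (induction rule: additive_span.induct)
  case zero
  then show ?case by (rule assms(4))
next
  case (add b x)
  then have "h (b \<oplus> x) = h b \<oplus>\<^bsub>H\<^esub> h x"
    using B additive_span_closed by (intro h) auto
  then show ?case using T[OF base add.IH] add.hyps by simp
qed

end

lemma additive_span_of_fin_gen:
  assumes M: "module A M" and "fin_gen_module A M"
  obtains S where "finite S" "S \<subseteq> carrier M"
    "\<And>x. x \<in> carrier M \<Longrightarrow> x \<in> additive_span M {c \<odot>\<^bsub>M\<^esub> s | c s. c \<in> carrier A \<and> s \<in> S}"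
proof -
  interpret module A M by fact
  obtain S where S: "finite S" "S \<subseteq> carrier M"
    "\<And>x. x \<in> carrier M \<Longrightarrow> \<exists>c\<in>S \<rightarrow> carrier A. x = (\<Oplus>\<^bsub>M\<^esub>s\<in>S. c s \<odot>\<^bsub>M\<^esub> s)"
    using assms(2) unfolding fin_gen_module_def by blast
  have "x \<in> additive_span M {c \<odot>\<^bsub>M\<^esub> s | c s. c \<in> carrier A \<and> s \<in> S}" if x: "x \<in> carrier M" for x
  proof -
    obtain c where c: "c \<in> S \<rightarrow> carrier A" "x = (\<Oplus>\<^bsub>M\<^esub>s\<in>S. c s \<odot>\<^bsub>M\<^esub> s)" using S(3)[OF x] by blast
    show ?thesis
      unfolding c(2) using S(1,2) c(1) by (intro M.finsum_in_additive_span) auto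
  qed
  with S that show thesis by blast
qed

context sheaf_of_modules
begin

lemma subpresheaf_additive_span:
  assumes K: "subpresheaf G K"
  shows "subpresheaf G (\<lambda>V. additive_span (msec M V) (K V))"
  unfolding subpresheaf_def
proof (intro allI impI conjI subsetI)
  fix V x assume V: "opn V \<and> V \<subseteq> G" and x: "x \<in> additive_span (msec M V) (K V)"
  interpret A: module "sec X V" "msec M V" using V by (intro module_sec) simp
  have KV: "K V \<subseteq> carrier (msec M V)" using V subpresheafD(1)[OF K] by blast
  then show "x \<in> carrier (msec M V)" using A.M.additive_span_closed[OF x] by simp
next
  fix V W x assume V: "opn V \<and> V \<subseteq> G" and W: "opn W \<and> W \<subseteq> V"
    and "x \<in> mres M V W ` additive_span (msec M V) (K V)"
  then obtain z where z: "z \<in> additive_span (msec M V) (K V)" and x: "x = mres M V W z" by blast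
  interpret A: module "sec X V" "msec M V" using V by (intro module_sec) simp
  interpret B: module "sec X W" "msec M W" using W by (intro module_sec) simp
  have KV: "K V \<subseteq> carrier (msec M V)" using V subpresheafD(1)[OF K] by blast
  have KW: "K W \<subseteq> carrier (msec M W)" using V W subpresheafD(1)[OF K, of W] by blast
  show "x \<in> additive_span (msec M W) (K W)"
    unfolding x
  proof (rule A.M.additive_span_induct[OF z KV, where H = "msec M W"])
    show "mres M V W (a \<oplus>\<^bsub>msec M V\<^esub> b) = mres M V W a \<oplus>\<^bsub>msec M W\<^esub> mres M V W b"
      if "a \<in> carrier (msec M V)" "b \<in> carrier (msec M V)" for a b
      using V W that by (intro mres_add) auto
    show "mres M V W \<zero>\<^bsub>msec M V\<^esub> \<in> additive_span (msec M W) (K W)"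
      using V W by (simp add: mres_zero additive_span.zero)
    show "mres M V W b \<in> additive_span (msec M W) (K W)" if "b \<in> K V" for b
      using V W that KW subpresheafD(2)[OF K, of V b W] by (intro B.M.additive_span_base) auto
    show "s \<oplus>\<^bsub>msec M W\<^esub> t \<in> additive_span (msec M W) (K W)"
      if "s \<in> additive_span (msec M W) (K W)" "t \<in> additive_span (msec M W) (K W)" for s t
      using that KW by (rule B.M.additive_span_add)
  qed
qed

lemma closure_additive_span_closed:
  assumes K: "subpresheaf G K" and V: "opn V" "V \<subseteq> G"
  shows "\<zero>\<^bsub>msec M V\<^esub> \<in> cl (\<lambda>V. additive_span (msec M V) (K V)) V"
    "\<lbrakk>s \<in> cl (\<lambda>V. additive_span (msec M V) (K V)) V;
      t \<in> cl (\<lambda>V. additive_span (msec M V) (K V)) V\<rbrakk> \<Longrightarrow>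
      s \<oplus>\<^bsub>msec M V\<^esub> t \<in> cl (\<lambda>V. additive_span (msec M V) (K V)) V"
proof -
  interpret A: module "sec X V" "msec M V" using V(1) by (rule module_sec)
  show "\<zero>\<^bsub>msec M V\<^esub> \<in> cl (\<lambda>V. additive_span (msec M V) (K V)) V"
    using V(1) by (intro closureI_section) (auto intro: additive_span.zero)
  assume st: "s \<in> cl (\<lambda>V. additive_span (msec M V) (K V)) V"
      "t \<in> cl (\<lambda>V. additive_span (msec M V) (K V)) V"
  show "s \<oplus>\<^bsub>msec M V\<^esub> t \<in> cl (\<lambda>V. additive_span (msec M V) (K V)) V"
  proof (rule closure_add[OF subpresheaf_additive_span[OF K] _ V(2) st])
    fix W s t assume W: "opn W" "W \<subseteq> G"
      and s: "s \<in> additive_span (msec M W) (K W)" and t: "t \<in> additive_span (msec M W) (K W)"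
    interpret B: module "sec X W" "msec M W" using W(1) by (rule module_sec)
    have "K W \<subseteq> carrier (msec M W)" using W subpresheafD(1)[OF K] by blast
    with s t show "s \<oplus>\<^bsub>msec M W\<^esub> t \<in> additive_span (msec M W) (K W)"
      by (rule B.M.additive_span_add)
  qed
qed

text \<open>The same principle for sheaves: if \<open>z\<close> is locally a finite sum of elements of \<open>K\<close>, and \<open>h\<close> is additive
  and compatible with restriction, then \<open>h z\<close> lies in a subsheaf of abelian groups as soon as \<open>h\<close> maps
  \<open>K\<close> there.\<close>

lemma local_additive_induct:
  assumes M': "is_module_sheaf X M'"
    and z: "z \<in> cl (\<lambda>V. additive_span (msec M V) (K V)) W"
    and K: "\<And>V. \<lbrakk>opn V; V \<subseteq> W\<rbrakk> \<Longrightarrow> K V \<subseteq> carrier (msec M V)"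
    and h_closed: "\<And>V x. \<lbrakk>opn V; V \<subseteq> W; x \<in> carrier (msec M V)\<rbrakk> \<Longrightarrow> h V x \<in> carrier (msec M' V)"
    and h_add: "\<And>V x y. \<lbrakk>opn V; V \<subseteq> W; x \<in> carrier (msec M V); y \<in> carrier (msec M V)\<rbrakk> \<Longrightarrow>
      h V (x \<oplus>\<^bsub>msec M V\<^esub> y) = h V x \<oplus>\<^bsub>msec M' V\<^esub> h V y"
    and h_res: "\<And>V. \<lbrakk>opn V; V \<subseteq> W\<rbrakk> \<Longrightarrow> mres M' W V (h W z) = h V (mres M W V z)"
    and T_zero: "\<And>V. \<lbrakk>opn V; V \<subseteq> W\<rbrakk> \<Longrightarrow> \<zero>\<^bsub>msec M' V\<^esub> \<in> sheaf_closure X M' T V"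
    and T_add: "\<And>V s t. \<lbrakk>opn V; V \<subseteq> W; s \<in> sheaf_closure X M' T V; t \<in> sheaf_closure X M' T V\<rbrakk> \<Longrightarrow>
      s \<oplus>\<^bsub>msec M' V\<^esub> t \<in> sheaf_closure X M' T V"
    and base: "\<And>V k. \<lbrakk>opn V; V \<subseteq> W; k \<in> K V\<rbrakk> \<Longrightarrow> h V k \<in> sheaf_closure X M' T V"
  shows "h W z \<in> sheaf_closure X M' T W"
proof -
  interpret M': sheaf_of_modules X M' using ringed_space M' by unfold_locales
  have W: "opn W" and zc: "z \<in> carrier (msec M W)" using closure_opn[OF z] z closure_carrier by blast+
  show ?thesis
  proof (rule M'.closureI_closure[OF W h_closed[OF W order_refl zc]])
    fix x assume "x \<in> W"
    with z obtain V where V: "opn V" "x \<in> V" "V \<subseteq> W" "mres M W V z \<in> additive_span (msec M V) (K V)"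
      by (rule closureE)
    interpret A: module "sec X V" "msec M V" using V(1) by (rule module_sec)
    interpret B: module "sec X V" "msec M' V" using V(1) by (rule M'.module_sec)
    have h0: "h V \<zero>\<^bsub>msec M V\<^esub> = \<zero>\<^bsub>msec M' V\<^esub>"
    proof -
      have "h V \<zero>\<^bsub>msec M V\<^esub> \<oplus>\<^bsub>msec M' V\<^esub> h V \<zero>\<^bsub>msec M V\<^esub> = h V \<zero>\<^bsub>msec M V\<^esub>"
        using h_add[OF V(1,3), of "\<zero>\<^bsub>msec M V\<^esub>" "\<zero>\<^bsub>msec M V\<^esub>"] by simp
      then show ?thesis
        using h_closed[OF V(1,3) A.M.zero_closed] by (metis B.M.add.r_cancel_one)
    qed
    have "h V (mres M W V z) \<in> sheaf_closure X M' T V"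
      using T_zero[OF V(1,3)] h0
      by (intro A.M.additive_span_induct[OF V(4) K[OF V(1,3)] h_add[OF V(1,3)] _ base[OF V(1,3)] T_add[OF V(1,3)]]) auto
    then show "\<exists>V. opn V \<and> x \<in> V \<and> V \<subseteq> W \<and> mres M' W V (h W z) \<in> sheaf_closure X M' T V"
      using V h_res[OF V(1,3)] by auto
  qed
qed

text \<open>Generation is a condition on the sections over all open subsets of \<open>U\<close>, each of which has to be a
  combination of the restricted generators after further shrinking.\<close>

definition spans :: "'a set \<Rightarrow> 'm set \<Rightarrow> bool"
  where "spans U S \<longleftrightarrow> opn U \<and> finite S \<and> S \<subseteq> carrier (msec M U) \<and>
    (\<forall>W. opn W \<and> W \<subseteq> U \<longrightarrow> carrier (msec M W) \<subseteq> cl (\<lambda>V. additive_span (msec M V)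
      {c \<odot>\<^bsub>msec M V\<^esub> mres M U V s | c s. c \<in> carrier (sec X V) \<and> s \<in> S}) W)"

text \<open>A section over a small open set is \<open>n/s\<close> with \<open>n\<close> in a finitely generated module. The image of
  \<open>n\<close> is a combination of the images of the generators, and \<open>1/s\<close> is absorbed into the coefficients.\<close>

lemma ex_spans:
  assumes "coherent X M" "x \<in> topspace (pts X)" shows "\<exists>U S. x \<in> U \<and> spans U S"
proof -
  obtain U N where x: "x \<in> U" and tl: "is_tilde_on X U M N" and fg: "fin_gen_module (sec X U) N"
    using assms unfolding coherent_def by blast
  from tl obtain f \<phi> \<psi> where "module (sec X U) N" and chart: "affine_chart X U f \<phi>"
    and iso: "module_sheaf_iso (restrict_space_to X U) (Spec (sec X U)) f \<phi> M (tilde (sec X U) N) \<psi>"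
    unfolding is_tilde_on_def by blast
  with fg have N: "module (sec X U) N" "fin_gen_module (sec X U) N" by simp_all
  have U: "opn U" using chart by (simp add: affine_chart_def)
  note fr = affine_chart_fractions[OF chart N(1) iso]
  obtain S where S: "finite S" "S \<subseteq> carrier N"
    "\<And>n. n \<in> carrier N \<Longrightarrow> n \<in> additive_span N {c \<odot>\<^bsub>N\<^esub> s | c s. c \<in> carrier (sec X U) \<and> s \<in> S}"
    using additive_span_of_fin_gen[OF N] by blast
  interpret N: module "sec X U" N by fact
  define \<theta> where "\<theta> a = \<phi> (topspace (zariski (sec X U))) (frac_section (sec X U) (self_module (sec X U))
    (topspace (zariski (sec X U))) a \<one>\<^bsub>sec X U\<^esub>)" for a
  define \<xi> where "\<xi> n = \<psi> (topspace (zariski (sec X U))) (frac_section (sec X U) N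
    (topspace (zariski (sec X U))) n \<one>\<^bsub>sec X U\<^esub>)" for n
  note fr = fr[folded \<theta>_def \<xi>_def]
  let ?K = "\<lambda>V. {c \<odot>\<^bsub>msec M V\<^esub> mres M U V s | c s. c \<in> carrier (sec X V) \<and> s \<in> \<xi> ` S}"
  have "z \<in> cl (\<lambda>V. additive_span (msec M V) (?K V)) W"
    if W: "opn W" "W \<subseteq> U" and z: "z \<in> carrier (msec M W)" for W z
  proof (rule closureI[OF W(1) z])
    fix y assume y: "y \<in> W"
    obtain V b n where V: "opn V" "y \<in> V" "V \<subseteq> W" and b: "b \<in> carrier (sec X V)" and n: "n \<in> carrier N"
      and zV: "mres M W V z = b \<odot>\<^bsub>msec M V\<^esub> mres M U V (\<xi> n)"
      using fr(5)[OF W y z] by blast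
    have VU: "V \<subseteq> U" using V W by simp
    interpret B: module "sec X V" "msec M V" using V(1) by (rule module_sec)
    have \<xi>c: "mres M U V (\<xi> n) \<in> carrier (msec M V)" if "n \<in> carrier N" for n
      using mres_closed[OF U V(1) VU fr(2)[OF that]] .
    have Kc: "?K V \<subseteq> carrier (msec M V)" using \<xi>c S(2) b by auto
    have "b \<odot>\<^bsub>msec M V\<^esub> mres M U V (\<xi> n) \<in> additive_span (msec M V) (?K V)"
    proof (rule N.M.additive_span_induct[OF S(3)[OF n], where H = "msec M V"])
      show "{c \<odot>\<^bsub>N\<^esub> s |c s. c \<in> carrier (sec X U) \<and> s \<in> S} \<subseteq> carrier N" using S(2) by auto
      show "b \<odot>\<^bsub>msec M V\<^esub> mres M U V (\<xi> (x \<oplus>\<^bsub>N\<^esub> y)) =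
        b \<odot>\<^bsub>msec M V\<^esub> mres M U V (\<xi> x) \<oplus>\<^bsub>msec M V\<^esub> b \<odot>\<^bsub>msec M V\<^esub> mres M U V (\<xi> y)"
        if "x \<in> carrier N" "y \<in> carrier N" for x y
        using that U V VU b \<xi>c by (simp add: fr mres_add B.smult_r_distr)
      have mult: "b \<odot>\<^bsub>msec M V\<^esub> mres M U V (\<xi> (c \<odot>\<^bsub>N\<^esub> s)) =
        (b \<otimes>\<^bsub>sec X V\<^esub> res X U V (\<theta> c)) \<odot>\<^bsub>msec M V\<^esub> mres M U V (\<xi> s)"
        if "c \<in> carrier (sec X U)" "s \<in> carrier N" for c s
        using that U V VU b \<xi>c fr(1)[OF that(1)] by (simp add: fr mres_smult B.smult_assoc1 res_closed)
      show base: "b \<odot>\<^bsub>msec M V\<^esub> mres M U V (\<xi> k) \<in> additive_span (msec M V) (?K V)"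
        if k: "k \<in> {c \<odot>\<^bsub>N\<^esub> s |c s. c \<in> carrier (sec X U) \<and> s \<in> S}" for k
      proof -
        obtain c s where cs: "c \<in> carrier (sec X U)" "s \<in> S" "k = c \<odot>\<^bsub>N\<^esub> s" using k by blast
        have "b \<otimes>\<^bsub>sec X V\<^esub> res X U V (\<theta> c) \<in> carrier (sec X V)"
          using b res_closed[OF U V(1) VU fr(1)[OF cs(1)]] by simp
        moreover have "s \<in> carrier N" using cs(2) S(2) by blast
        ultimately show ?thesis
          using cs mult[OF cs(1)] by (intro B.M.additive_span_base Kc) auto
      qed
      show "b \<odot>\<^bsub>msec M V\<^esub> mres M U V (\<xi> \<zero>\<^bsub>N\<^esub>) \<in> additive_span (msec M V) (?K V)"
      proof -
        have e: "\<xi> \<zero>\<^bsub>N\<^esub> \<oplus>\<^bsub>msec M U\<^esub> \<xi> \<zero>\<^bsub>N\<^esub> = \<xi> \<zero>\<^bsub>N\<^esub>"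
          using fr(3)[of "\<zero>\<^bsub>N\<^esub>" "\<zero>\<^bsub>N\<^esub>"] by simp
        interpret C: module "sec X U" "msec M U" using U by (rule module_sec)
        have "\<xi> \<zero>\<^bsub>N\<^esub> = \<zero>\<^bsub>msec M U\<^esub>"
          using e fr(2)[OF N.M.zero_closed] by (metis C.M.add.r_cancel_one)
        then show ?thesis using b U V VU by (simp add: mres_zero additive_span.zero)
      qed
      show "s \<oplus>\<^bsub>msec M V\<^esub> t \<in> additive_span (msec M V) (?K V)"
        if "s \<in> additive_span (msec M V) (?K V)" "t \<in> additive_span (msec M V) (?K V)" for s t
        using that Kc by (rule B.M.additive_span_add)
    qed
    then show "\<exists>V. opn V \<and> y \<in> V \<and> V \<subseteq> W \<and> mres M W V z \<in> additive_span (msec M V) (?K V)"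
      using V zV by auto
  qed
  then have "\<forall>W. opn W \<and> W \<subseteq> U \<longrightarrow>
      carrier (msec M W) \<subseteq> cl (\<lambda>V. additive_span (msec M V) (?K V)) W"
    by (intro allI impI subsetI) simp
  moreover have "\<xi> ` S \<subseteq> carrier (msec M U)" using S(2) fr(2) by auto
  ultimately have "spans U (\<xi> ` S)"
    unfolding spans_def using U S(1) by simp
  with x show ?thesis by blast
qed

end

lemma (in sheaf_of_modules) spans_restrict:
  assumes S: "spans U S" and V: "opn V" "V \<subseteq> U"
  shows "spans V (mres M U V ` S)"
proof -
  have U: "opn U" and Sc: "S \<subseteq> carrier (msec M U)" and fin: "finite S" using S by (auto simp: spans_def)
  have "carrier (msec M W) \<subseteq> cl (\<lambda>Z. additive_span (msec M Z)
      {c \<odot>\<^bsub>msec M Z\<^esub> mres M V Z s | c s. c \<in> carrier (sec X Z) \<and> s \<in> mres M U V ` S}) W"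
    if W: "opn W" "W \<subseteq> V" for W
  proof -
    have "carrier (msec M W) \<subseteq> cl (\<lambda>Z. additive_span (msec M Z)
        {c \<odot>\<^bsub>msec M Z\<^esub> mres M U Z s | c s. c \<in> carrier (sec X Z) \<and> s \<in> S}) W"
      using S W V by (auto simp: spans_def)
    also have "\<dots> \<subseteq> cl (\<lambda>Z. additive_span (msec M Z)
      {c \<odot>\<^bsub>msec M Z\<^esub> mres M V Z s | c s. c \<in> carrier (sec X Z) \<and> s \<in> mres M U V ` S}) W"
    proof (rule closure_mono)
      fix Z assume Z: "opn Z" "Z \<subseteq> W"
      have "mres M V Z (mres M U V s) = mres M U Z s" if "s \<in> S" for s
        using U V W Z Sc that by (intro mres_mres) auto
      then have "{c \<odot>\<^bsub>msec M Z\<^esub> mres M U Z s | c s. c \<in> carrier (sec X Z) \<and> s \<in> S} =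
        {c \<odot>\<^bsub>msec M Z\<^esub> mres M V Z s | c s. c \<in> carrier (sec X Z) \<and> s \<in> mres M U V ` S}"
        by (auto simp: image_iff) metis+
      then show "additive_span (msec M Z) {c \<odot>\<^bsub>msec M Z\<^esub> mres M U Z s | c s. c \<in> carrier (sec X Z) \<and> s \<in> S} \<subseteq>
        additive_span (msec M Z)
          {c \<odot>\<^bsub>msec M Z\<^esub> mres M V Z s | c s. c \<in> carrier (sec X Z) \<and> s \<in> mres M U V ` S}" by simp
    qed
    finally show ?thesis .
  qed
  moreover have "mres M U V ` S \<subseteq> carrier (msec M V)" using mres_closed[OF U V] Sc by auto
  ultimately show ?thesis using V fin by (simp add: spans_def)
qed

section \<open>Local finite generation over the iterated Frobenius\<close>

lemma (in cring) binomial_theorem: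
  assumes x: "x \<in> carrier R" and y: "y \<in> carrier R"
  shows "(x \<oplus> y) [^] (n :: nat) = (\<Oplus>k\<in>{..n}. [(n choose k)] \<cdot> (x [^] k \<otimes> y [^] (n - k)))"
proof (induction n)
  case 0
  then show ?case by simp
next
  case (Suc n)
  define f where "f k = [(n choose k)] \<cdot> (x [^] k \<otimes> y [^] (n - k))" for k
  define g where "g k = [(Suc n choose k)] \<cdot> (x [^] k \<otimes> y [^] (Suc n - k))" for k
  define h where "h k = [(n choose k)] \<cdot> (x [^] k \<otimes> y [^] (Suc n - k))" for k
  have c: "f k \<in> carrier R" "g k \<in> carrier R" "h k \<in> carrier R" for k
    using x y by (simp_all add: f_def g_def h_def)
  have fx: "f k \<otimes> x \<oplus> h (Suc k) = g (Suc k)" for k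
  proof -
    have "f k \<otimes> x = [(n choose k)] \<cdot> (x [^] Suc k \<otimes> y [^] (n - k))"
      using x y by (simp add: f_def add_pow_ldistr add_pow_rdistr m_ac)
    then show ?thesis
      using x y by (simp add: g_def h_def add.nat_pow_mult)
  qed
  have fy: "f k \<otimes> y = h k" if "k \<le> n" for k
    using x y that by (simp add: f_def h_def add_pow_ldistr m_assoc Suc_diff_le)
  have "(x \<oplus> y) [^] Suc n = (\<Oplus>k\<in>{..n}. f k) \<otimes> x \<oplus> (\<Oplus>k\<in>{..n}. f k) \<otimes> y"
    using x y c by (simp add: Suc f_def[symmetric] r_distr)
  also have "(\<Oplus>k\<in>{..n}. f k) \<otimes> x = (\<Oplus>k\<in>{..n}. f k \<otimes> x)"
    using x c by (intro finsum_ldistr) auto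
  also have "(\<Oplus>k\<in>{..n}. f k) \<otimes> y = (\<Oplus>k\<in>{..n}. f k \<otimes> y)"
    using y c by (intro finsum_ldistr) auto
  also have "(\<Oplus>k\<in>{..n}. f k \<otimes> y) = (\<Oplus>k\<in>{..n}. h k)"
    using fy c by (intro finsum_cong') auto
  also have "(\<Oplus>k\<in>{..n}. h k) = (\<Oplus>k\<in>{..Suc n}. h k)"
  proof -
    have "h (Suc n) = \<zero>" by (simp add: h_def binomial_eq_0)
    then show ?thesis using c by simp
  qed
  also have "\<dots> = (\<Oplus>k\<in>{..n}. h (Suc k)) \<oplus> h 0"
    using c by (intro finsum_Suc2) auto
  also have "h 0 = g 0" by (simp add: g_def h_def)
  also have "(\<Oplus>k\<in>{..n}. f k \<otimes> x) \<oplus> ((\<Oplus>k\<in>{..n}. h (Suc k)) \<oplus> g 0) =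
      (\<Oplus>k\<in>{..n}. f k \<otimes> x \<oplus> h (Suc k)) \<oplus> g 0"
    using c x by (simp add: finsum_addf a_assoc Pi_def)
  also have "\<dots> = (\<Oplus>k\<in>{..Suc n}. g k)"
    unfolding fx using c by (intro finsum_Suc2[symmetric]) auto
  finally show ?case by (simp only: g_def)
qed

text \<open>The inner binomial coefficients are divisible by \<open>p\<close>.\<close>

lemma (in cring) frobenius_add:
  assumes p: "Factorial_Ring.prime p" and char: "[p] \<cdot> \<one> = \<zero>"
    and x: "x \<in> carrier R" and y: "y \<in> carrier R"
  shows "(x \<oplus> y) [^] (p :: nat) = x [^] p \<oplus> y [^] p"
proof -
  obtain n where n: "p = Suc (Suc n)"
    using prime_ge_2_nat[OF p] by (metis add_2_eq_Suc le_Suc_ex)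
  define f where "f k = [(p choose k)] \<cdot> (x [^] k \<otimes> y [^] (p - k))" for k
  have c: "f k \<in> carrier R" for k using x y by (simp add: f_def)
  have kill: "[(p * j)] \<cdot> z = \<zero>" if z: "z \<in> carrier R" for j z
  proof -
    have "[p] \<cdot> z = ([p] \<cdot> \<one>) \<otimes> z" using z by (simp add: add_pow_ldistr)
    then have "[p] \<cdot> z = \<zero>" using z char by simp
    then show ?thesis using z by (metis add.nat_pow_one add.nat_pow_pow)
  qed
  have "f (Suc k) = \<zero>" if "k \<le> n" for k
  proof -
    have "p dvd p choose Suc k"
      using that p by (intro dvd_choose_prime) (auto simp: n)
    then obtain j where "p choose Suc k = p * j" ..
    then show ?thesis using kill x y by (simp add: f_def)
  qed
  then have "(\<Oplus>k\<in>{..n}. f (Suc k)) = (\<Oplus>k\<in>{..n}. \<zero>)" by (intro finsum_cong') auto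
  then have mid: "(\<Oplus>k\<in>{..n}. f (Suc k)) = \<zero>" by simp
  have "(x \<oplus> y) [^] p = (\<Oplus>k\<in>{..Suc (Suc n)}. f k)"
    unfolding f_def binomial_theorem[OF x y] n ..
  also have "\<dots> = f (Suc (Suc n)) \<oplus> (\<Oplus>k\<in>{..Suc n}. f k)"
    using c by (intro finsum_Suc) auto
  also have "(\<Oplus>k\<in>{..Suc n}. f k) = (\<Oplus>k\<in>{..n}. f (Suc k)) \<oplus> f 0"
    using c by (intro finsum_Suc2) auto
  finally show ?thesis using c x y unfolding mid by (simp add: f_def n)
qed

locale frobenius_space =
  fixes X :: "('a, 'r) ringed_space" and p :: nat
  assumes ringed_space: "is_ringed_space X" and prime: "Factorial_Ring.prime p"
    and char: "openin (pts X) U \<Longrightarrow> [p] \<cdot>\<^bsub>sec X U\<^esub> \<one>\<^bsub>sec X U\<^esub> = \<zero>\<^bsub>sec X U\<^esub>"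
begin

sublocale \<O>: sheaf_of_modules X "structure_module X"
  using ringed_space module_sheaf_structure_module by unfold_locales

abbreviation \<S> :: "('a, 'r, 'r) module_sheaf" where "\<S> \<equiv> structure_module X"

abbreviation opn :: "'a set \<Rightarrow> bool" where "opn U \<equiv> openin (pts X) U"

definition power_multiples :: "nat \<Rightarrow> 'a set \<Rightarrow> 'r set \<Rightarrow> 'a set \<Rightarrow> 'r set"
  where "power_multiples k U B V =
    {c [^]\<^bsub>sec X V\<^esub> (p ^ k) \<otimes>\<^bsub>sec X V\<^esub> res X U V b | c b. c \<in> carrier (sec X V) \<and> b \<in> B}"

text \<open>The finite set \<open>B\<close> generates the structure sheaf as a module over its \<open>p\<^sup>k\<close>-th powers.\<close>

definition frobenius_spans :: "nat \<Rightarrow> 'a set \<Rightarrow> 'r set \<Rightarrow> bool"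
  where "frobenius_spans k U B \<longleftrightarrow> opn U \<and> finite B \<and> B \<subseteq> carrier (sec X U) \<and>
    (\<forall>W. opn W \<and> W \<subseteq> U \<longrightarrow> carrier (sec X W) \<subseteq> \<O>.cl
      (\<lambda>V. additive_span (msec \<S> V) (power_multiples k U B V)) W)"

lemma power_multiples_closed:
  assumes "opn U" "opn V" "V \<subseteq> U" "B \<subseteq> carrier (sec X U)"
  shows "power_multiples k U B V \<subseteq> carrier (sec X V)"
proof -
  interpret cring "sec X V" using assms(2) by (rule \<O>.cring_sec)
  show ?thesis using assms \<O>.res_closed[OF assms(1-3)] by (auto simp: power_multiples_def)
qed

lemma subpresheaf_power_multiples:
  assumes U: "opn U" and B: "B \<subseteq> carrier (sec X U)"
  shows "\<O>.subpresheaf U (power_multiples k U B)"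
  unfolding \<O>.subpresheaf_def
proof (intro allI impI conjI)
  fix V assume V: "opn V \<and> V \<subseteq> U"
  then show "power_multiples k U B V \<subseteq> carrier (msec \<S> V)"
    using power_multiples_closed[OF U _ _ B] by simp
  fix W assume W: "opn W \<and> W \<subseteq> V"
  interpret cring "sec X V" using V by (intro \<O>.cring_sec) simp
  show "mres \<S> V W ` power_multiples k U B V \<subseteq> power_multiples k U B W"
  proof
    fix x assume "x \<in> mres \<S> V W ` power_multiples k U B V"
    then obtain c b where cb: "c \<in> carrier (sec X V)" "b \<in> B"
      and x: "x = res X V W (c [^]\<^bsub>sec X V\<^esub> (p ^ k) \<otimes>\<^bsub>sec X V\<^esub> res X U V b)"
      by (auto simp: power_multiples_def)
    have "b \<in> carrier (sec X U)" using cb B by auto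
    then have "x = res X V W c [^]\<^bsub>sec X W\<^esub> (p ^ k) \<otimes>\<^bsub>sec X W\<^esub> res X U W b"
      unfolding x using U V W cb ring_hom_mult[OF \<O>.res_hom, of V W]
      by (simp add: \<O>.res_closed \<O>.res_pow \<O>.res_res)
    then show "x \<in> power_multiples k U B W"
      using cb \<O>.res_closed[of V W c] V W unfolding power_multiples_def by blast
  qed
qed

lemma frobenius_spans_restrict:
  assumes B: "frobenius_spans k U B" and V: "opn V" "V \<subseteq> U"
  shows "frobenius_spans k V (res X U V ` B)"
proof -
  have U: "opn U" and Bc: "B \<subseteq> carrier (sec X U)" and fin: "finite B"
    using B by (auto simp: frobenius_spans_def)
  have "carrier (sec X W) \<subseteq> \<O>.cl (\<lambda>Z.
      additive_span (msec \<S> Z) (power_multiples k V (res X U V ` B) Z)) W"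
    if W: "opn W" "W \<subseteq> V" for W
  proof -
    have "carrier (sec X W) \<subseteq> \<O>.cl (\<lambda>Z.
        additive_span (msec \<S> Z) (power_multiples k U B Z)) W"
      using B W V by (auto simp: frobenius_spans_def)
    also have "\<dots> \<subseteq> \<O>.cl (\<lambda>Z.
      additive_span (msec \<S> Z) (power_multiples k V (res X U V ` B) Z)) W"
    proof (rule \<O>.closure_mono)
      fix Z assume Z: "opn Z" "Z \<subseteq> W"
      have "res X V Z (res X U V b) = res X U Z b" if "b \<in> B" for b
        using U V W Z Bc that by (intro \<O>.res_res) auto
      then have "power_multiples k U B Z = power_multiples k V (res X U V ` B) Z"
        by (auto simp: image_iff power_multiples_def) metis+
      then show "additive_span (msec \<S> Z) (power_multiples k U B Z) \<subseteq>
        additive_span (msec \<S> Z) (power_multiples k V (res X U V ` B) Z)" by simp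
    qed
    finally show ?thesis .
  qed
  moreover have "res X U V ` B \<subseteq> carrier (sec X V)" using \<O>.res_closed[OF U V] Bc by auto
  ultimately show ?thesis using V fin by (simp add: frobenius_spans_def)
qed

lemma module_frobenius:
  assumes "opn V" shows "module (sec X V) (alg_module (\<lambda>a. a [^]\<^bsub>sec X V\<^esub> p) (sec X V))"
proof -
  interpret cring "sec X V" using assms by (rule \<O>.cring_sec)
  have "abelian_group (alg_module (\<lambda>a. a [^]\<^bsub>sec X V\<^esub> p) (sec X V))"
    by (rule abelian_groupI) (auto simp: alg_module_def a_ac intro: add.l_inv_ex)
  then show ?thesis
    using frobenius_add[OF prime char[OF assms]]
    by (intro moduleI is_cring) (auto simp: alg_module_def l_distr r_distr m_assoc nat_pow_distrib)
qed

text \<open>Finiteness of the Frobenius concerns sections over an affine open set. It passes to smaller open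
  sets by writing a fraction as \<open>n/s = (1/s)\<^sup>p n s\<^bsup>p-1\<^esup>\<close>, with a \<open>p\<close>-th power in front of a section
  that is defined over the whole affine open set.\<close>

lemma ex_frobenius_spans_1:
  assumes "F_finite p X" "x \<in> topspace (pts X)"
  shows "\<exists>U B. x \<in> U \<and> frobenius_spans 1 U B"
proof -
  obtain U where x: "x \<in> U" and aff: "affine_open X U"
    and fg: "fin_gen_module (sec X U) (alg_module (\<lambda>a. a [^]\<^bsub>sec X U\<^esub> p) (sec X (preim X id U)))"
    using assms(1)[unfolded F_finite_def finite_morphism_def, THEN bspec, OF assms(2)]
    by (elim exE conjE)
  obtain f \<phi> where chart: "affine_chart X U f \<phi>" using aff by (auto simp: affine_open_def)
  then have U: "opn U" by (simp add: affine_chart_def)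
  have "preim X id U = U" using openin_subset[OF U] by (auto simp: preim_def)
  with fg have fg: "fin_gen_module (sec X U) (alg_module (\<lambda>a. a [^]\<^bsub>sec X U\<^esub> p) (sec X U))"
    (is "fin_gen_module _ ?F") by simp
  obtain B where B: "finite B" "B \<subseteq> carrier ?F"
    "\<And>v. v \<in> carrier ?F \<Longrightarrow> v \<in> additive_span ?F {c \<odot>\<^bsub>?F\<^esub> b | c b. c \<in> carrier (sec X U) \<and> b \<in> B}"
    using additive_span_of_fin_gen[OF module_frobenius[OF U] fg] by blast
  interpret U: cring "sec X U" using U by (rule \<O>.cring_sec)
  interpret F: module "sec X U" ?F using U by (rule module_frobenius)
  have Fs: "carrier ?F = carrier (sec X U)" "add ?F = add (sec X U)" "zero ?F = zero (sec X U)"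
    "\<And>a b. a \<odot>\<^bsub>?F\<^esub> b = a [^]\<^bsub>sec X U\<^esub> p \<otimes>\<^bsub>sec X U\<^esub> b" by (simp_all add: alg_module_def)
  have Bc: "B \<subseteq> carrier (sec X U)" using B(2) Fs by simp
  have riso: "ringed_space_iso (restrict_space_to X U) (Spec (sec X U)) f \<phi>"
    using chart by (simp add: affine_chart_def)
  have st: "structure_module (restrict_space_to X U) = structure_module X"
    by (simp add: structure_module_def restrict_space_to_def)
  note fr = \<O>.affine_chart_fractions[OF chart module_self_module[OF U.is_cring]
      module_sheaf_iso_structure_module[OF riso, unfolded st]]
  define \<theta> where "\<theta> a = \<phi> (topspace (zariski (sec X U))) (frac_section (sec X U) (self_module (sec X U))
    (topspace (zariski (sec X U))) a \<one>\<^bsub>sec X U\<^esub>)" for a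
  note fr = fr[folded \<theta>_def]
  obtain p' where p': "p = Suc p'" using prime_gt_0_nat[OF prime] by (cases p) auto
  have "carrier (sec X W) \<subseteq> \<O>.cl
      (\<lambda>V. additive_span (msec \<S> V) (power_multiples 1 U B V)) W"
    if W: "opn W" "W \<subseteq> U" for W
  proof (rule subsetI, rule \<O>.closureI[OF W(1)])
    fix a assume a: "a \<in> carrier (sec X W)"
    then show "a \<in> carrier (msec \<S> W)" by simp
    fix y assume y: "y \<in> W"
    obtain V b s n where V: "opn V" "y \<in> V" "V \<subseteq> W" and b: "b \<in> carrier (sec X V)"
      and sn: "s \<in> carrier (sec X U)" "n \<in> carrier (sec X U)"
      and bs: "b \<otimes>\<^bsub>sec X V\<^esub> res X U V (\<theta> s) = \<one>\<^bsub>sec X V\<^esub>"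
      and aV: "res X W V a = b \<otimes>\<^bsub>sec X V\<^esub> res X U V (\<theta> n)"
      using fr(5)[OF W y, of a] a by (auto simp: alg_module_def)
    have VU: "V \<subseteq> U" using V W by simp
    interpret V: cring "sec X V" using V(1) by (rule \<O>.cring_sec)
    interpret VM: module "sec X V" "msec \<S> V" using V(1) by (rule \<O>.module_sec)
    have \<theta>c: "\<theta> s \<in> carrier (sec X U)" "\<theta> n \<in> carrier (sec X U)" using fr(1) sn by auto
    \<comment> \<open>The numerator of \<open>n/s = (n s\<^bsup>p-1\<^esup>)/s\<^sup>p\<close>.\<close>
    define v where "v = \<theta> n \<otimes>\<^bsub>sec X U\<^esub> \<theta> s [^]\<^bsub>sec X U\<^esub> p'"
    have vc: "v \<in> carrier (sec X U)" using \<theta>c by (simp add: v_def)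
    note rc = \<O>.res_closed[OF U V(1) VU]
    have rm: "res X U V (x \<otimes>\<^bsub>sec X U\<^esub> y) = res X U V x \<otimes>\<^bsub>sec X V\<^esub> res X U V y"
      if "x \<in> carrier (sec X U)" "y \<in> carrier (sec X U)" for x y
      using ring_hom_mult[OF \<O>.res_hom[OF U V(1) VU] that] .
    have av: "res X W V a = b [^]\<^bsub>sec X V\<^esub> p \<otimes>\<^bsub>sec X V\<^esub> res X U V v"
    proof -
      let ?t = "res X U V (\<theta> s)" and ?n = "res X U V (\<theta> n)"
      have c: "?t \<in> carrier (sec X V)" "?n \<in> carrier (sec X V)" using rc \<theta>c by auto
      have "b [^]\<^bsub>sec X V\<^esub> p \<otimes>\<^bsub>sec X V\<^esub> res X U V v =
          b [^]\<^bsub>sec X V\<^esub> p' \<otimes>\<^bsub>sec X V\<^esub> b \<otimes>\<^bsub>sec X V\<^esub> (?n \<otimes>\<^bsub>sec X V\<^esub> ?t [^]\<^bsub>sec X V\<^esub> p')"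
        using \<theta>c U V VU by (simp add: v_def rm p' \<O>.res_pow)
      also have "\<dots> = (b \<otimes>\<^bsub>sec X V\<^esub> ?n) \<otimes>\<^bsub>sec X V\<^esub> (b [^]\<^bsub>sec X V\<^esub> p' \<otimes>\<^bsub>sec X V\<^esub> ?t [^]\<^bsub>sec X V\<^esub> p')"
        using b c by (simp add: V.m_ac)
      also have "b [^]\<^bsub>sec X V\<^esub> p' \<otimes>\<^bsub>sec X V\<^esub> ?t [^]\<^bsub>sec X V\<^esub> p' = \<one>\<^bsub>sec X V\<^esub>"
        using b c bs by (simp add: V.nat_pow_distrib[symmetric])
      finally show ?thesis using b c by (simp add: aV)
    qed
    have Kc: "power_multiples 1 U B V \<subseteq> carrier (sec X V)"
      by (rule power_multiples_closed[OF U V(1) VU Bc])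
    have "b [^]\<^bsub>sec X V\<^esub> p \<otimes>\<^bsub>sec X V\<^esub> res X U V v \<in>
        additive_span (msec \<S> V) (power_multiples 1 U B V)"
    proof (rule F.M.additive_span_induct[where h = "\<lambda>v. b [^]\<^bsub>sec X V\<^esub> p \<otimes>\<^bsub>sec X V\<^esub> res X U V v"
          and H = "msec \<S> V"])
      show "v \<in> additive_span ?F {c \<odot>\<^bsub>?F\<^esub> b | c b. c \<in> carrier (sec X U) \<and> b \<in> B}"
        using B(3) vc Fs by simp
      show "{c \<odot>\<^bsub>?F\<^esub> b |c b. c \<in> carrier (sec X U) \<and> b \<in> B} \<subseteq> carrier ?F"
        using Bc by (auto simp: Fs)
      show "b [^]\<^bsub>sec X V\<^esub> p \<otimes>\<^bsub>sec X V\<^esub> res X U V (x \<oplus>\<^bsub>?F\<^esub> y) =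
        b [^]\<^bsub>sec X V\<^esub> p \<otimes>\<^bsub>sec X V\<^esub> res X U V x \<oplus>\<^bsub>msec \<S> V\<^esub>
        b [^]\<^bsub>sec X V\<^esub> p \<otimes>\<^bsub>sec X V\<^esub> res X U V y"
        if "x \<in> carrier ?F" "y \<in> carrier ?F" for x y
        using that b rc ring_hom_add[OF \<O>.res_hom[OF U V(1) VU]] by (simp add: Fs V.r_distr)
      show "b [^]\<^bsub>sec X V\<^esub> p \<otimes>\<^bsub>sec X V\<^esub> res X U V \<zero>\<^bsub>?F\<^esub> \<in>
          additive_span (msec \<S> V) (power_multiples 1 U B V)"
      proof -
        have "res X U V \<zero>\<^bsub>?F\<^esub> = \<zero>\<^bsub>sec X V\<^esub>"
          using \<O>.mres_zero[OF U V(1) VU] by (simp add: Fs)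
        then show ?thesis
          using b additive_span.zero[of "msec \<S> V" "power_multiples 1 U B V"] by simp
      qed
      show "b [^]\<^bsub>sec X V\<^esub> p \<otimes>\<^bsub>sec X V\<^esub> res X U V k \<in>
          additive_span (msec \<S> V) (power_multiples 1 U B V)"
        if k: "k \<in> {c \<odot>\<^bsub>?F\<^esub> b |c b. c \<in> carrier (sec X U) \<and> b \<in> B}" for k
      proof -
        obtain c b' where cb: "c \<in> carrier (sec X U)" "b' \<in> B" "k = c [^]\<^bsub>sec X U\<^esub> p \<otimes>\<^bsub>sec X U\<^esub> b'"
          using k by (auto simp: Fs)
        have bc': "b' \<in> carrier (sec X U)" using cb Bc by auto
        have "b [^]\<^bsub>sec X V\<^esub> p \<otimes>\<^bsub>sec X V\<^esub> res X U V k =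
            (b \<otimes>\<^bsub>sec X V\<^esub> res X U V c) [^]\<^bsub>sec X V\<^esub> (p ^ 1) \<otimes>\<^bsub>sec X V\<^esub> res X U V b'"
          using cb bc' b rc U V VU by (simp add: rm \<O>.res_pow V.nat_pow_distrib V.m_assoc)
        moreover have "b \<otimes>\<^bsub>sec X V\<^esub> res X U V c \<in> carrier (sec X V)" using b cb rc by simp
        ultimately have "b [^]\<^bsub>sec X V\<^esub> p \<otimes>\<^bsub>sec X V\<^esub> res X U V k \<in> power_multiples 1 U B V"
          unfolding power_multiples_def using cb(2) by blast
        then show ?thesis using Kc by (intro VM.M.additive_span_base) simp_all
      qed
      show "s \<oplus>\<^bsub>msec \<S> V\<^esub> t \<in>
          additive_span (msec \<S> V) (power_multiples 1 U B V)"
        if "s \<in> additive_span (msec \<S> V) (power_multiples 1 U B V)"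
          "t \<in> additive_span (msec \<S> V) (power_multiples 1 U B V)" for s t
        using that Kc by (intro VM.M.additive_span_add) simp_all
    qed
    then show "\<exists>V. opn V \<and> y \<in> V \<and> V \<subseteq> W \<and> mres \<S> W V a \<in>
        additive_span (msec \<S> V) (power_multiples 1 U B V)"
      using V av by auto
  qed
  then have "frobenius_spans 1 U B" using U B(1) Bc by (simp add: frobenius_spans_def)
  with x show ?thesis by blast
qed

text \<open>Substituting \<open>d = \<Sum> c\<^bsup>p\<^sup>k\<^esup> b\<close> into \<open>a = \<Sum> d\<^sup>p b\<^sub>1\<close> gives \<open>a = \<Sum> c\<^bsup>p\<^bsup>k+1\<^esup>\<^esup> b\<^sup>p b\<^sub>1\<close>, because \<open>d \<mapsto> d\<^sup>p b\<^sub>1\<close> is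
  additive.\<close>

lemma frobenius_spans_Suc:
  assumes B1: "frobenius_spans 1 U B1" and Bk: "frobenius_spans k U Bk"
  shows "frobenius_spans (Suc k) U {b [^]\<^bsub>sec X U\<^esub> p \<otimes>\<^bsub>sec X U\<^esub> b1 | b b1. b \<in> Bk \<and> b1 \<in> B1}"
    (is "frobenius_spans _ _ ?B")
proof -
  have U: "opn U" and fin: "finite B1" "finite Bk"
    and B1c: "B1 \<subseteq> carrier (sec X U)" and Bkc: "Bk \<subseteq> carrier (sec X U)"
    using assms by (auto simp: frobenius_spans_def)
  interpret U: cring "sec X U" using U by (rule \<O>.cring_sec)
  have Bc: "?B \<subseteq> carrier (sec X U)" using B1c Bkc by auto
  have "?B = (\<lambda>(b, b1). b [^]\<^bsub>sec X U\<^esub> p \<otimes>\<^bsub>sec X U\<^esub> b1) ` (Bk \<times> B1)" by auto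
  then have finB: "finite ?B" using fin by simp
  let ?T = "\<lambda>V. additive_span (msec \<S> V) (power_multiples (Suc k) U ?B V)"
  note T = \<O>.closure_additive_span_closed[OF subpresheaf_power_multiples[OF U Bc]]
  have "a \<in> \<O>.cl ?T W"
    if W: "opn W" "W \<subseteq> U" and a: "a \<in> carrier (sec X W)" for W a
  proof (rule \<O>.local_additive_induct[OF \<O>.module_sheaf, where h = "\<lambda>V x. x"])
    show "a \<in> \<O>.cl
        (\<lambda>V. additive_span (msec \<S> V) (power_multiples 1 U B1 V)) W"
      using B1 W a unfolding frobenius_spans_def by blast
    show "power_multiples 1 U B1 V \<subseteq> carrier (msec \<S> V)" if "opn V" "V \<subseteq> W" for V
      using power_multiples_closed[OF U that(1) _ B1c] that W by simp
    show "\<zero>\<^bsub>msec \<S> V\<^esub> \<in> \<O>.cl ?T V"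
      if "opn V" "V \<subseteq> W" for V using T(1)[OF that(1)] that W by simp
    show "s \<oplus>\<^bsub>msec \<S> V\<^esub> t \<in> \<O>.cl ?T V"
      if "opn V" "V \<subseteq> W" "s \<in> \<O>.cl ?T V"
        "t \<in> \<O>.cl ?T V" for V s t
      using T(2)[OF that(1) _ that(3,4)] that(2) W by simp
    fix V x assume V: "opn V" "V \<subseteq> W" and "x \<in> power_multiples 1 U B1 V"
    then obtain d b1 where d: "d \<in> carrier (sec X V)" "b1 \<in> B1"
      and x: "x = d [^]\<^bsub>sec X V\<^esub> p \<otimes>\<^bsub>sec X V\<^esub> res X U V b1"
      by (auto simp: power_multiples_def)
    have VU: "V \<subseteq> U" using V W by simp
    have b1c: "b1 \<in> carrier (sec X U)" using d B1c by auto
    have rb1: "res X U Z b1 \<in> carrier (sec X Z)" if "opn Z" "Z \<subseteq> V" for Z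
      using that U VU b1c by (intro \<O>.res_closed) auto
    show "x \<in> \<O>.cl ?T V"
      unfolding x
    proof (rule \<O>.local_additive_induct[OF \<O>.module_sheaf,
          where h = "\<lambda>Z c. c [^]\<^bsub>sec X Z\<^esub> p \<otimes>\<^bsub>sec X Z\<^esub> res X U Z b1"])
      show "d \<in> \<O>.cl
          (\<lambda>V. additive_span (msec \<S> V) (power_multiples k U Bk V)) V"
        using Bk V VU d unfolding frobenius_spans_def by blast
      show "power_multiples k U Bk Z \<subseteq> carrier (msec \<S> Z)" if "opn Z" "Z \<subseteq> V" for Z
        using power_multiples_closed[OF U that(1) _ Bkc] that VU by simp
      show "\<zero>\<^bsub>msec \<S> Z\<^esub> \<in> \<O>.cl ?T Z"
        if "opn Z" "Z \<subseteq> V" for Z using T(1)[OF that(1)] that VU by simp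
      show "s \<oplus>\<^bsub>msec \<S> Z\<^esub> t \<in> \<O>.cl ?T Z"
        if "opn Z" "Z \<subseteq> V" "s \<in> \<O>.cl ?T Z"
          "t \<in> \<O>.cl ?T Z" for Z s t
        using T(2)[OF that(1) _ that(3,4)] that(2) VU by simp
      fix Z assume Z: "opn Z" "Z \<subseteq> V"
      interpret Z: cring "sec X Z" using Z(1) by (rule \<O>.cring_sec)
      interpret V: cring "sec X V" using V(1) by (rule \<O>.cring_sec)
      interpret ZM: module "sec X Z" "msec \<S> Z" using Z(1) by (rule \<O>.module_sec)
      show "mres \<S> V Z (d [^]\<^bsub>sec X V\<^esub> p \<otimes>\<^bsub>sec X V\<^esub> res X U V b1) =
        mres \<S> V Z d [^]\<^bsub>sec X Z\<^esub> p \<otimes>\<^bsub>sec X Z\<^esub> res X U Z b1"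
        using U V VU Z d b1c rb1[OF V(1)] ring_hom_mult[OF \<O>.res_hom[OF V(1) Z]]
        by (simp add: \<O>.res_pow \<O>.res_res)
      show "c [^]\<^bsub>sec X Z\<^esub> p \<otimes>\<^bsub>sec X Z\<^esub> res X U Z b1 \<in> carrier (msec \<S> Z)"
        if "c \<in> carrier (msec \<S> Z)" for c
        using that rb1[OF Z] by simp
      show "(c \<oplus>\<^bsub>msec \<S> Z\<^esub> c') [^]\<^bsub>sec X Z\<^esub> p \<otimes>\<^bsub>sec X Z\<^esub> res X U Z b1 =
          c [^]\<^bsub>sec X Z\<^esub> p \<otimes>\<^bsub>sec X Z\<^esub> res X U Z b1 \<oplus>\<^bsub>msec \<S> Z\<^esub>
          c' [^]\<^bsub>sec X Z\<^esub> p \<otimes>\<^bsub>sec X Z\<^esub> res X U Z b1"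
        if "c \<in> carrier (msec \<S> Z)" "c' \<in> carrier (msec \<S> Z)" for c c'
        using that rb1[OF Z] Z.frobenius_add[OF prime char[OF Z(1)]] by (simp add: Z.l_distr)
      fix y assume "y \<in> power_multiples k U Bk Z"
      then obtain c b where c: "c \<in> carrier (sec X Z)" "b \<in> Bk"
        and y: "y = c [^]\<^bsub>sec X Z\<^esub> (p ^ k) \<otimes>\<^bsub>sec X Z\<^esub> res X U Z b"
        by (auto simp: power_multiples_def)
      have ZU: "Z \<subseteq> U" using Z VU by simp
      have bc: "b \<in> carrier (sec X U)" using c Bkc by auto
      have rb: "res X U Z b \<in> carrier (sec X Z)" by (rule \<O>.res_closed[OF U Z(1) ZU bc])
      have "y [^]\<^bsub>sec X Z\<^esub> p \<otimes>\<^bsub>sec X Z\<^esub> res X U Z b1 =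
          c [^]\<^bsub>sec X Z\<^esub> (p ^ Suc k) \<otimes>\<^bsub>sec X Z\<^esub> res X U Z (b [^]\<^bsub>sec X U\<^esub> p \<otimes>\<^bsub>sec X U\<^esub> b1)"
        using U Z ZU c bc b1c rb rb1[OF Z] ring_hom_mult[OF \<O>.res_hom[OF U Z(1) ZU]]
        by (simp add: y Z.nat_pow_distrib Z.nat_pow_pow \<O>.res_pow Z.m_assoc mult.commute)
      moreover have "b [^]\<^bsub>sec X U\<^esub> p \<otimes>\<^bsub>sec X U\<^esub> b1 \<in> ?B" using c d by blast
      ultimately have "y [^]\<^bsub>sec X Z\<^esub> p \<otimes>\<^bsub>sec X Z\<^esub> res X U Z b1 \<in> power_multiples (Suc k) U ?B Z"
        unfolding power_multiples_def using c(1) by blast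
      moreover have "power_multiples (Suc k) U ?B Z \<subseteq> carrier (msec \<S> Z)"
        using power_multiples_closed[OF U Z(1) ZU Bc] by simp
      ultimately show "y [^]\<^bsub>sec X Z\<^esub> p \<otimes>\<^bsub>sec X Z\<^esub> res X U Z b1 \<in> \<O>.cl ?T Z"
        using Z(1) ZM.M.additive_span_base by (intro \<O>.closureI_section) auto
    qed
  qed (use W in simp_all)
  then have "\<forall>W. opn W \<and> W \<subseteq> U \<longrightarrow> carrier (sec X W) \<subseteq> \<O>.cl ?T W"
    by (intro allI impI subsetI) simp
  then show ?thesis using U finB Bc by (simp add: frobenius_spans_def)
qed

lemma ex_frobenius_spans:
  assumes "F_finite p X" "x \<in> topspace (pts X)"
  shows "\<exists>U B. x \<in> U \<and> frobenius_spans k U B"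
proof (induction k)
  case 0
  let ?U = "topspace (pts X)"
  have "a \<in> \<O>.cl
      (\<lambda>V. additive_span (msec \<S> V) (power_multiples 0 ?U {\<one>\<^bsub>sec X ?U\<^esub>} V)) W"
    if W: "opn W" "W \<subseteq> ?U" and a: "a \<in> carrier (sec X W)" for W a
  proof -
    interpret W: cring "sec X W" using W(1) by (rule \<O>.cring_sec)
    interpret WM: module "sec X W" "msec \<S> W" using W(1) by (rule \<O>.module_sec)
    interpret U: cring "sec X ?U" by (rule \<O>.cring_sec) simp
    have "res X ?U W \<one>\<^bsub>sec X ?U\<^esub> = \<one>\<^bsub>sec X W\<^esub>"
      using W by (intro ring_hom_one \<O>.res_hom) auto
    then have "a = a [^]\<^bsub>sec X W\<^esub> (p ^ 0) \<otimes>\<^bsub>sec X W\<^esub> res X ?U W \<one>\<^bsub>sec X ?U\<^esub>" using a by simp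
    then have "a \<in> power_multiples 0 ?U {\<one>\<^bsub>sec X ?U\<^esub>} W"
      unfolding power_multiples_def using a by blast
    moreover have "power_multiples 0 ?U {\<one>\<^bsub>sec X ?U\<^esub>} W \<subseteq> carrier (msec \<S> W)"
      using power_multiples_closed[of ?U W "{\<one>\<^bsub>sec X ?U\<^esub>}" 0] W by simp
    ultimately show ?thesis
      using W(1) a WM.M.additive_span_base by (intro \<O>.closureI_section) auto
  qed
  moreover have "\<one>\<^bsub>sec X ?U\<^esub> \<in> carrier (sec X ?U)"
    using \<O>.cring_sec[of ?U] by (simp add: cring_def ring_def monoid.one_closed)
  ultimately have "frobenius_spans 0 ?U {\<one>\<^bsub>sec X ?U\<^esub>}"
    by (simp add: frobenius_spans_def subset_iff)
  with assms(2) show ?case by blast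
next
  case (Suc k)
  then obtain U B where B: "x \<in> U" "frobenius_spans k U B" by blast
  obtain U1 B1 where B1: "x \<in> U1" "frobenius_spans 1 U1 B1" using ex_frobenius_spans_1[OF assms] by blast
  have o: "opn (U \<inter> U1)" using B B1 by (auto simp: frobenius_spans_def)
  show ?case
    using frobenius_spans_Suc[OF frobenius_spans_restrict[OF B1(2) o] frobenius_spans_restrict[OF B(2) o]] B B1
    by blast
qed

end

section \<open>Finite generation of the images, and test modules\<close>

context principal_cartier_sheaf
begin

lemma generates_restrict:
  assumes g: "generates G g" and U: "opn U" "U \<subseteq> G"
  shows "generates U (res X G U g)"
proof -
  have G: "opn G" "g \<in> carrier (sec X G)" using g by (auto simp: generates_def)
  have "I V = \<O>.cl (\<O>.multiples (\<lambda>W. res X U W (res X G U g))) V"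
    if V: "opn V" "V \<subseteq> U" for V
  proof -
    have "I V = \<O>.cl (\<O>.multiples (\<lambda>W. res X G W g)) V"
      using g V U by (simp add: generates_def)
    also have "\<dots> = \<O>.cl (\<O>.multiples (\<lambda>W. res X U W (res X G U g))) V"
      using V U G by (intro equalityI \<O>.closure_mono) (simp_all add: res_res)
    finally show ?thesis .
  qed
  then show ?thesis using U G by (simp add: generates_def res_closed)
qed

lemma generator_power_closed:
  assumes "generates G g" "opn V" "V \<subseteq> G"
  shows "gpow G g n V \<in> carrier (sec X V)"
  by (rule compatibleD(1)[OF compatible_power[OF assms(1)] assms(2,3)])

lemma local_image_closed:
  assumes "generates G g" "opn V" "V \<subseteq> G" shows "local_image G g m n V \<subseteq> carrier (msec M V)"
proof -
  interpret A: module "sec X V" "msec M V" using assms(2) by (rule module_sec)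
  show ?thesis
    using generator_power_closed[OF assms] iter_closed[OF assms(2)] by (auto simp: local_image_def)
qed

lemma subpresheaf_local_image:
  assumes g: "generates G g" shows "subpresheaf G (local_image G g m n)"
  unfolding subpresheaf_def
proof (intro allI impI conjI)
  fix V assume V: "opn V \<and> V \<subseteq> G"
  then show "local_image G g m n V \<subseteq> carrier (msec M V)" using local_image_closed[OF g] by simp
  fix W assume W: "opn W \<and> W \<subseteq> V"
  have "mres M V W x \<in> local_image G g m n W" if xE: "x \<in> local_image G g m n V" for x
  proof -
    obtain z where z: "z \<in> carrier (msec M V)"
      and x: "x = (C V ^^ m) (gpow G g n V \<odot>\<^bsub>msec M V\<^esub> z)"
      using xE by (auto simp: local_image_def)
    have "mres M V W x = (C W ^^ m) (gpow G g n W \<odot>\<^bsub>msec M W\<^esub> mres M V W z)"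
      unfolding x using V W z by (intro local_image_res[OF g]) auto
    moreover have "mres M V W z \<in> carrier (msec M W)" using V W z by (intro mres_closed) auto
    ultimately show ?thesis by (simp add: local_image_def)
  qed
  then show "mres M V W ` local_image G g m n V \<subseteq> local_image G g m n W" by auto
qed

lemma closure_local_image_submodule:
  assumes g: "generates G g" and U: "opn U" "U \<subseteq> G"
  shows "\<zero>\<^bsub>msec M U\<^esub> \<in> cl (local_image G g m n) U"
    "\<lbrakk>s \<in> cl (local_image G g m n) U; t \<in> cl (local_image G g m n) U\<rbrakk> \<Longrightarrow>
      s \<oplus>\<^bsub>msec M U\<^esub> t \<in> cl (local_image G g m n) U"
    "\<lbrakk>a \<in> carrier (sec X U); s \<in> cl (local_image G g m n) U\<rbrakk> \<Longrightarrow>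
      a \<odot>\<^bsub>msec M U\<^esub> s \<in> cl (local_image G g m n) U"
proof -
  interpret A: module "sec X U" "msec M U" using U(1) by (rule module_sec)
  have "(C U ^^ m) (gpow G g n U \<odot>\<^bsub>msec M U\<^esub> \<zero>\<^bsub>msec M U\<^esub>) = \<zero>\<^bsub>msec M U\<^esub>"
    using generator_power_closed[OF g U] iter_zero[OF U(1)] by simp
  then have "\<zero>\<^bsub>msec M U\<^esub> \<in> local_image G g m n U"
    unfolding local_image_def by (metis A.M.zero_closed imageI)
  then show "\<zero>\<^bsub>msec M U\<^esub> \<in> cl (local_image G g m n) U"
    by (intro closureI_section U(1)) auto
next
  assume st: "s \<in> cl (local_image G g m n) U" "t \<in> cl (local_image G g m n) U"
  show "s \<oplus>\<^bsub>msec M U\<^esub> t \<in> cl (local_image G g m n) U"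
  proof (rule closure_add[OF subpresheaf_local_image[OF g] _ U(2) st])
    fix W s t assume W: "opn W" "W \<subseteq> G" and s: "s \<in> local_image G g m n W" and t: "t \<in> local_image G g m n W"
    interpret A: module "sec X W" "msec M W" using W(1) by (rule module_sec)
    let ?h = "gpow G g n W"
    obtain y z where yz: "y \<in> carrier (msec M W)" "s = (C W ^^ m) (?h \<odot>\<^bsub>msec M W\<^esub> y)"
      "z \<in> carrier (msec M W)" "t = (C W ^^ m) (?h \<odot>\<^bsub>msec M W\<^esub> z)" using s t by (auto simp: local_image_def)
    then have "s \<oplus>\<^bsub>msec M W\<^esub> t = (C W ^^ m) (?h \<odot>\<^bsub>msec M W\<^esub> (y \<oplus>\<^bsub>msec M W\<^esub> z))"
      using generator_power_closed[OF g W] W by (simp add: A.smult_r_distr iter_add)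
    then show "s \<oplus>\<^bsub>msec M W\<^esub> t \<in> local_image G g m n W" using yz by (simp add: local_image_def)
  qed
next
  assume as: "a \<in> carrier (sec X U)" "s \<in> cl (local_image G g m n) U"
  show "a \<odot>\<^bsub>msec M U\<^esub> s \<in> cl (local_image G g m n) U"
  proof (rule closure_smult[OF subpresheaf_local_image[OF g] _ U(2) as])
    fix W a s assume W: "opn W" "W \<subseteq> G" and a: "a \<in> carrier (sec X W)" and s: "s \<in> local_image G g m n W"
    interpret A: module "sec X W" "msec M W" using W(1) by (rule module_sec)
    let ?h = "gpow G g n W"
    obtain z where z: "z \<in> carrier (msec M W)" "s = (C W ^^ m) (?h \<odot>\<^bsub>msec M W\<^esub> z)"
      using s by (auto simp: local_image_def)
    have h: "?h \<in> carrier (sec X W)" by (rule generator_power_closed[OF g W])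
    have "a \<odot>\<^bsub>msec M W\<^esub> s = (C W ^^ m) ((a [^]\<^bsub>sec X W\<^esub> (q ^ m)) \<odot>\<^bsub>msec M W\<^esub> (?h \<odot>\<^bsub>msec M W\<^esub> z))"
      using iter_smult[OF W(1) a, of "?h \<odot>\<^bsub>msec M W\<^esub> z" m] z h by simp
    also have "(a [^]\<^bsub>sec X W\<^esub> (q ^ m)) \<odot>\<^bsub>msec M W\<^esub> (?h \<odot>\<^bsub>msec M W\<^esub> z) =
        ?h \<odot>\<^bsub>msec M W\<^esub> ((a [^]\<^bsub>sec X W\<^esub> (q ^ m)) \<odot>\<^bsub>msec M W\<^esub> z)"
      using a z h by (metis A.R.m_comm A.R.nat_pow_closed A.smult_assoc1)
    finally show "a \<odot>\<^bsub>msec M W\<^esub> s \<in> local_image G g m n W" using a z by (simp add: local_image_def)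
  qed
qed

end

locale finite_cartier_sheaf = principal_cartier_sheaf X M q C I + frob: frobenius_space X p
  for X :: "('a, 'r) ringed_space" and M :: "('a, 'r, 'm) module_sheaf"
    and q :: nat and C :: "'a set \<Rightarrow> 'm \<Rightarrow> 'm" and I :: "'a set \<Rightarrow> 'r set" and p :: nat +
  fixes e :: nat
  assumes q: "q = p ^ e"
begin

text \<open>The sections \<open>C\<^sup>m (g\<^sup>n b s)\<close> generate the image: a section \<open>z\<close> of \<open>M\<close> is a sum of terms \<open>c s\<close>, and each
  \<open>c\<close> is a sum of terms \<open>d\<^bsup>q\<^sup>m\<^esup> b\<close>, so \<open>C\<^sup>m (g\<^sup>n z)\<close> is a sum of terms \<open>d C\<^sup>m (g\<^sup>n b s)\<close>. Finite generation is
  expressed by its consequence for inclusions into other images.\<close>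

lemma power_image_le_if_generators:
  assumes g: "generates U g" and S: "spans U S" and B: "frob.frobenius_spans (e * m) U B"
    and V: "opn V" "V \<subseteq> U"
    and gens: "\<And>b s. \<lbrakk>b \<in> B; s \<in> S\<rbrakk> \<Longrightarrow>
      mres M U V ((C U ^^ m) ((g [^]\<^bsub>sec X U\<^esub> n) \<odot>\<^bsub>msec M U\<^esub> (b \<odot>\<^bsub>msec M U\<^esub> s))) \<in> power_image m' n' V"
  shows "power_image m n V \<subseteq> power_image m' n' V"
  unfolding power_image_local[OF g V]
proof (rule closure_least)
  let ?T = "cl (local_image U g m' n')"
  have U: "opn U" and gc: "g \<in> carrier (sec X U)" using g by (auto simp: generates_def)
  have rg: "res X U U g = g" using U gc by (simp add: res_self)
  have Sc: "S \<subseteq> carrier (msec M U)" using S by (simp add: spans_def)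
  have Bc: "B \<subseteq> carrier (sec X U)" using B by (simp add: frob.frobenius_spans_def)
  let ?g = "\<lambda>W. res X U W g [^]\<^bsub>sec X W\<^esub> n"
  define h where "h W z = (C W ^^ m) (?g W \<odot>\<^bsub>msec M W\<^esub> z)" for W z
  have h_closed: "h W z \<in> carrier (msec M W)" if "opn W" "W \<subseteq> U" "z \<in> carrier (msec M W)" for W z
  proof -
    interpret A: module "sec X W" "msec M W" using that(1) by (rule module_sec)
    show ?thesis using that generator_power_closed[OF g that(1,2)] by (simp add: h_def iter_closed)
  qed
  have h_add: "h W (y \<oplus>\<^bsub>msec M W\<^esub> z) = h W y \<oplus>\<^bsub>msec M W\<^esub> h W z"
    if "opn W" "W \<subseteq> U" "y \<in> carrier (msec M W)" "z \<in> carrier (msec M W)" for W y z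
  proof -
    interpret A: module "sec X W" "msec M W" using that(1) by (rule module_sec)
    show ?thesis using that generator_power_closed[OF g that(1,2)]
      by (simp add: h_def iter_add A.smult_r_distr)
  qed
  have h_res: "mres M W Z (h W z) = h Z (mres M W Z z)"
    if "opn W" "W \<subseteq> U" "opn Z" "Z \<subseteq> W" "z \<in> carrier (msec M W)" for W Z z
    unfolding h_def using that by (rule local_image_res[OF g])
  have rs: "mres M U Z s \<in> carrier (msec M Z)" if "opn Z" "Z \<subseteq> U" "s \<in> S" for Z s
    using that U Sc by (intro mres_closed) auto
  fix W s assume W: "opn W" "W \<subseteq> V" and s: "s \<in> local_image U g m n W"
  then obtain z where z: "z \<in> carrier (msec M W)" and sz: "s = h W z" by (auto simp: local_image_def h_def)
  have WU: "W \<subseteq> U" using W V by simp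
  show "s \<in> ?T W"
    unfolding sz
  proof (rule local_additive_induct[OF module_sheaf, where h = h])
    show "z \<in> cl (\<lambda>V. additive_span (msec M V)
      {c \<odot>\<^bsub>msec M V\<^esub> mres M U V s | c s. c \<in> carrier (sec X V) \<and> s \<in> S}) W"
      using S W(1) WU z unfolding spans_def by blast
    fix Y assume Y: "opn Y" "Y \<subseteq> W"
    then have YU: "Y \<subseteq> U" using WU by simp
    interpret Y: module "sec X Y" "msec M Y" using Y(1) by (rule module_sec)
    show "{c \<odot>\<^bsub>msec M Y\<^esub> mres M U Y s | c s. c \<in> carrier (sec X Y) \<and> s \<in> S} \<subseteq> carrier (msec M Y)"
      using rs[OF Y(1) YU] by auto
    show "h Y x \<in> carrier (msec M Y)" if "x \<in> carrier (msec M Y)" for x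
      using h_closed Y(1) YU that .
    show "h Y (x \<oplus>\<^bsub>msec M Y\<^esub> y) = h Y x \<oplus>\<^bsub>msec M Y\<^esub> h Y y"
      if "x \<in> carrier (msec M Y)" "y \<in> carrier (msec M Y)" for x y using h_add Y(1) YU that .
    show "mres M W Y (h W z) = h Y (mres M W Y z)" using W(1) WU Y z by (rule h_res)
    show "\<zero>\<^bsub>msec M Y\<^esub> \<in> ?T Y" by (rule closure_local_image_submodule(1)[OF g Y(1) YU])
    show "x \<oplus>\<^bsub>msec M Y\<^esub> y \<in> ?T Y" if "x \<in> ?T Y" "y \<in> ?T Y" for x y
      using closure_local_image_submodule(2)[OF g Y(1) YU that] .
    fix k assume "k \<in> {c \<odot>\<^bsub>msec M Y\<^esub> mres M U Y s | c s. c \<in> carrier (sec X Y) \<and> s \<in> S}"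
    then obtain c s where c: "c \<in> carrier (sec X Y)" and s: "s \<in> S"
      and k: "k = c \<odot>\<^bsub>msec M Y\<^esub> mres M U Y s" by blast
    show "h Y k \<in> ?T Y"
      unfolding k
    proof (rule \<O>.local_additive_induct[OF module_sheaf,
          where h = "\<lambda>Z c. h Z (c \<odot>\<^bsub>msec M Z\<^esub> mres M U Z s)"])
      show "c \<in> \<O>.cl (\<lambda>V. additive_span (msec (structure_module X) V)
          (frob.power_multiples (e * m) U B V)) Y"
        using B Y(1) YU c unfolding frob.frobenius_spans_def by blast
      fix Z assume Z: "opn Z" "Z \<subseteq> Y"
      then have ZU: "Z \<subseteq> U" using YU by simp
      interpret Z: module "sec X Z" "msec M Z" using Z(1) by (rule module_sec)
      note rsZ = rs[OF Z(1) ZU s]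
      show "frob.power_multiples (e * m) U B Z \<subseteq> carrier (msec (structure_module X) Z)"
        using frob.power_multiples_closed[OF U Z(1) ZU Bc] by simp
      show "h Z (x \<odot>\<^bsub>msec M Z\<^esub> mres M U Z s) \<in> carrier (msec M Z)"
        if "x \<in> carrier (msec (structure_module X) Z)" for x
        using that rsZ by (intro h_closed Z(1) ZU) simp
      show "h Z ((x \<oplus>\<^bsub>msec (structure_module X) Z\<^esub> y) \<odot>\<^bsub>msec M Z\<^esub> mres M U Z s) =
          h Z (x \<odot>\<^bsub>msec M Z\<^esub> mres M U Z s) \<oplus>\<^bsub>msec M Z\<^esub> h Z (y \<odot>\<^bsub>msec M Z\<^esub> mres M U Z s)"
        if "x \<in> carrier (msec (structure_module X) Z)" "y \<in> carrier (msec (structure_module X) Z)" for x y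
        using that rsZ Z(1) ZU by (simp add: Z.smult_l_distr h_add)
      show "mres M Y Z (h Y (c \<odot>\<^bsub>msec M Y\<^esub> mres M U Y s)) =
          h Z (mres (structure_module X) Y Z c \<odot>\<^bsub>msec M Z\<^esub> mres M U Z s)"
        using U Y(1) YU Z c rs[OF Y(1) YU s] s Sc
        by (simp add: h_res mres_smult mres_mres subset_iff)
      show "\<zero>\<^bsub>msec M Z\<^esub> \<in> ?T Z" by (rule closure_local_image_submodule(1)[OF g Z(1) ZU])
      show "x \<oplus>\<^bsub>msec M Z\<^esub> y \<in> ?T Z" if "x \<in> ?T Z" "y \<in> ?T Z" for x y
        using closure_local_image_submodule(2)[OF g Z(1) ZU that] .
      fix k assume "k \<in> frob.power_multiples (e * m) U B Z"
      then obtain d b where d: "d \<in> carrier (sec X Z)" and b: "b \<in> B"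
        and k: "k = d [^]\<^bsub>sec X Z\<^esub> (q ^ m) \<otimes>\<^bsub>sec X Z\<^esub> res X U Z b"
        by (auto simp: frob.power_multiples_def q power_mult)
      have bc: "b \<in> carrier (sec X U)" and sc: "s \<in> carrier (msec M U)" using b s Bc Sc by auto
      interpret U: module "sec X U" "msec M U" using U by (rule module_sec)
      have rb: "res X U Z b \<in> carrier (sec X Z)" by (rule res_closed[OF U Z(1) ZU bc])
      have gZ: "?g Z \<in> carrier (sec X Z)" by (rule generator_power_closed[OF g Z(1) ZU])
      let ?w = "res X U Z b \<odot>\<^bsub>msec M Z\<^esub> mres M U Z s"
      have "?g Z \<odot>\<^bsub>msec M Z\<^esub> (k \<odot>\<^bsub>msec M Z\<^esub> mres M U Z s) =
          (d [^]\<^bsub>sec X Z\<^esub> (q ^ m)) \<odot>\<^bsub>msec M Z\<^esub> (?g Z \<odot>\<^bsub>msec M Z\<^esub> ?w)"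
        using d rb gZ rsZ by (simp add: k Z.smult_assoc1[symmetric] Z.R.m_ac)
      then have "h Z (k \<odot>\<^bsub>msec M Z\<^esub> mres M U Z s) = d \<odot>\<^bsub>msec M Z\<^esub> h Z ?w"
        using iter_smult[OF Z(1) d] gZ rb rsZ by (simp add: h_def)
      moreover have "h Z ?w \<in> ?T Z"
      proof -
        have ZV: "Z \<subseteq> V" using Z Y W by simp
        have hU: "h U (b \<odot>\<^bsub>msec M U\<^esub> s) \<in> carrier (msec M U)"
          using bc sc by (intro h_closed U) auto
        have "mres M U V (h U (b \<odot>\<^bsub>msec M U\<^esub> s)) \<in> power_image m' n' V"
          using gens[OF b s] by (simp add: h_def rg)
        then have "mres M V Z (mres M U V (h U (b \<odot>\<^bsub>msec M U\<^esub> s))) \<in> power_image m' n' Z"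
          using openin_subset[OF V(1)] by (intro subpresheafD(2)[OF subpresheaf_power_image V(1) _ _ Z(1) ZV])
        moreover have "mres M V Z (mres M U V (h U (b \<odot>\<^bsub>msec M U\<^esub> s))) = mres M U Z (h U (b \<odot>\<^bsub>msec M U\<^esub> s))"
          by (rule mres_mres[OF U V(1) Z(1) ZV V(2) hU])
        moreover have "\<dots> = h Z ?w"
          using U Z(1) ZU bc sc by (simp add: h_res mres_smult)
        ultimately show ?thesis unfolding power_image_local[OF g Z(1) ZU] by simp
      qed
      ultimately show "h Z (k \<odot>\<^bsub>msec M Z\<^esub> mres M U Z s) \<in> ?T Z"
        using closure_local_image_submodule(3)[OF g Z(1) ZU d] by simp
    qed
  qed
qed

text \<open>The members of the union form an increasing sequence. Near each point the finitely many generators of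
  the given image therefore lie in a common member, and finitely many such neighbourhoods cover the
  space.\<close>

lemma test_module_attained:
  assumes compact: "compact_space (pts X)" and coh: "coherent X M" and ff: "F_finite p X"
    and le: "power_image m n \<le> test_module q X M C I t"
  shows "\<exists>k. power_image m n \<le> power_image k (nat \<lceil>t * real q ^ k\<rceil>)"
proof -
  define T where "T k = power_image k (nat \<lceil>t * real q ^ k\<rceil>)" for k
  have T_Suc: "T k \<le> T (Suc k)" for k
  proof -
    define c where "c = nat \<lceil>t * real q ^ k\<rceil>"
    have "t * real q ^ k * real q \<le> real c * real q"
      unfolding c_def by (intro mult_right_mono real_nat_ceiling_ge) simp
    then have "\<lceil>t * real q ^ Suc k\<rceil> \<le> int (c * q)"
      by (simp add: ceiling_le_iff ac_simps)
    then have "nat \<lceil>t * real q ^ Suc k\<rceil> \<le> c * q" by linarith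
    then have "power_image (Suc k) (c * q) \<le> T (Suc k)" unfolding T_def by (rule power_image_antimono)
    then show ?thesis by (simp add: power_image_Suc T_def c_def)
  qed
  have T_mono: "T k W \<subseteq> T k' W" if "k \<le> k'" for k k' W
    using lift_Suc_mono_le[of T, OF T_Suc that] by (simp add: le_fun_def)
  have sub_T: "subpresheaf (topspace (pts X)) (T k)" for k unfolding T_def by (rule subpresheaf_power_image)
  have loc: "\<exists>V k. opn V \<and> x \<in> V \<and> (\<forall>W. opn W \<and> W \<subseteq> V \<longrightarrow> power_image m n W \<subseteq> T k W)"
    if x: "x \<in> topspace (pts X)" for x
  proof -
    obtain G g where G: "x \<in> G" "generates G g" using ex_generator[OF x] by blast
    obtain U1 S1 where S1: "x \<in> U1" "spans U1 S1" using ex_spans[OF coh x] by blast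
    obtain U2 B2 where B2: "x \<in> U2" "frob.frobenius_spans (e * m) U2 B2"
      using frob.ex_frobenius_spans[OF ff x] by blast
    define U where "U = G \<inter> U1 \<inter> U2"
    have U: "opn U" "U \<subseteq> G" "U \<subseteq> U1" "U \<subseteq> U2" "x \<in> U"
      using G S1 B2 by (auto simp: U_def generates_def spans_def frob.frobenius_spans_def)
    define g' S B where "g' = res X G U g" and "S = mres M U1 U ` S1" and "B = res X U2 U ` B2"
    have g': "generates U g'" and S: "spans U S" and B: "frob.frobenius_spans (e * m) U B"
      unfolding g'_def S_def B_def using G S1 B2 U
      by (simp_all add: generates_restrict spans_restrict frob.frobenius_spans_restrict)
    have fin: "finite S" "finite B" and Sc: "S \<subseteq> carrier (msec M U)" and Bc: "B \<subseteq> carrier (sec X U)"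
      and gc: "g' \<in> carrier (sec X U)"
      using S B g' by (auto simp: spans_def frob.frobenius_spans_def generates_def)
    interpret U: module "sec X U" "msec M U" using U(1) by (rule module_sec)
    define w where "w b s = (C U ^^ m) ((g' [^]\<^bsub>sec X U\<^esub> n) \<odot>\<^bsub>msec M U\<^esub> (b \<odot>\<^bsub>msec M U\<^esub> s))" for b s
    define P where "P = (\<lambda>(b, s). w b s) ` (B \<times> S)"
    have P: "finite P" "P \<subseteq> carrier (msec M U)"
      using fin U(1) Sc Bc gc by (auto simp: P_def w_def intro!: iter_closed)
    have "\<exists>V k. opn V \<and> x \<in> V \<and> V \<subseteq> U \<and> mres M U V y \<in> T k V" if y: "y \<in> P" for y
    proof -
      obtain b s where bs: "b \<in> B" "s \<in> S" "y = w b s" using y by (auto simp: P_def)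
      have "y \<in> local_image U g' m n U"
        using bs Bc Sc U(1) gc by (auto simp: local_image_def w_def res_self)
      then have "y \<in> power_image m n U"
        unfolding power_image_local[OF g' U(1) order_refl] using y P U(1) by (intro closureI_section) auto
      then have "y \<in> test_module q X M C I t U" using le by (auto simp: le_fun_def)
      then obtain V where "opn V" "x \<in> V" "V \<subseteq> U" "mres M U V y \<in> (\<Union>k. T k V)"
        using U(5) unfolding test_module_eq T_def by (rule closureE)
      then show ?thesis by blast
    qed
    with P have "\<exists>V k. opn V \<and> x \<in> V \<and> V \<subseteq> U \<and> (\<forall>y\<in>P. mres M U V y \<in> T k V)"
    proof (induction P rule: finite_induct)
      case empty
      then show ?case using U by blast
    next
      case (insert y P)
      have "\<exists>V k. opn V \<and> x \<in> V \<and> V \<subseteq> U \<and> (\<forall>y\<in>P. mres M U V y \<in> T k V)"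
        using insert.prems by (intro insert.IH) simp_all
      then obtain V k where V: "opn V" "x \<in> V" "V \<subseteq> U" "\<forall>y\<in>P. mres M U V y \<in> T k V"
        by (elim exE conjE)
      have "\<exists>V k. opn V \<and> x \<in> V \<and> V \<subseteq> U \<and> mres M U V y \<in> T k V"
        by (rule insert.prems(2)) simp
      then obtain V' k' where V': "opn V'" "x \<in> V'" "V' \<subseteq> U" "mres M U V' y \<in> T k' V'"
        by (elim exE conjE)
      have o: "opn (V \<inter> V')" using V V' by auto
      have top: "V \<subseteq> topspace (pts X)" "V' \<subseteq> topspace (pts X)"
        using openin_subset V(1) V'(1) by auto
      have "mres M U (V \<inter> V') u \<in> T (max k k') (V \<inter> V')" if u: "u \<in> insert y P" for u
      proof -
        have uc: "u \<in> carrier (msec M U)" using u insert.prems by auto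
        show ?thesis
        proof (cases "u = y")
          case True
          then have "mres M V' (V \<inter> V') (mres M U V' u) \<in> T k' (V \<inter> V')"
            using V' o top by (intro subpresheafD(2)[OF sub_T V'(1)]) auto
          then have "mres M U (V \<inter> V') u \<in> T k' (V \<inter> V')"
            using mres_mres[OF U(1) V'(1) o _ V'(3) uc] by simp
          then show ?thesis using T_mono[of k' "max k k'"] by auto
        next
          case False
          then have "mres M V (V \<inter> V') (mres M U V u) \<in> T k (V \<inter> V')"
            using V o top u by (intro subpresheafD(2)[OF sub_T V(1)]) auto
          then have "mres M U (V \<inter> V') u \<in> T k (V \<inter> V')"
            using mres_mres[OF U(1) V(1) o _ V(3) uc] by simp
          then show ?thesis using T_mono[of k "max k k'"] by auto
        qed
      qed
      then show ?case using V V' o by (intro exI[of _ "V \<inter> V'"] exI[of _ "max k k'"]) auto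
    qed
    then obtain V k where V: "opn V" "x \<in> V" "V \<subseteq> U" and VP: "\<forall>y\<in>P. mres M U V y \<in> T k V"
      by (elim exE conjE)
    have "power_image m n W \<subseteq> T k W" if W: "opn W" "W \<subseteq> V" for W
      unfolding T_def
    proof (rule power_image_le_if_generators[OF g' S B W(1)])
      show "W \<subseteq> U" using W V by simp
      fix b s assume bs: "b \<in> B" "s \<in> S"
      then have wP: "w b s \<in> P" by (auto simp: P_def)
      have "mres M V W (mres M U V (w b s)) \<in> T k W"
        using openin_subset[OF V(1)] by (intro subpresheafD(2)[OF sub_T V(1) _ VP[rule_format, OF wP] W])
      moreover have "mres M V W (mres M U V (w b s)) = mres M U W (w b s)"
        using wP P by (intro mres_mres[OF U(1) V(1) W(1,2) V(3)]) auto
      ultimately show "mres M U W ((C U ^^ m) ((g' [^]\<^bsub>sec X U\<^esub> n) \<odot>\<^bsub>msec M U\<^esub> (b \<odot>\<^bsub>msec M U\<^esub> s)))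
          \<in> power_image k (nat \<lceil>t * real q ^ k\<rceil>) W"
        by (simp add: w_def T_def)
    qed
    then show ?thesis using V(1,2) by (intro exI[of _ V] exI[of _ k]) simp
  qed
  define \<U> where "\<U> = {V. opn V \<and> (\<exists>k. \<forall>W. opn W \<and> W \<subseteq> V \<longrightarrow> power_image m n W \<subseteq> T k W)}"
  have "\<forall>V\<in>\<U>. opn V" by (simp add: \<U>_def)
  moreover have "topspace (pts X) \<subseteq> \<Union>\<U>"
  proof
    fix x assume "x \<in> topspace (pts X)"
    from loc[OF this] obtain V k where "opn V" "x \<in> V" "\<forall>W. opn W \<and> W \<subseteq> V \<longrightarrow> power_image m n W \<subseteq> T k W"
      by (elim exE conjE)
    then have "V \<in> \<U>" unfolding \<U>_def mem_Collect_eq by (intro conjI exI[of _ k])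
    with \<open>x \<in> V\<close> show "x \<in> \<Union>\<U>" by (rule UnionI[rotated])
  qed
  ultimately have "\<exists>\<F>. finite \<F> \<and> \<F> \<subseteq> \<U> \<and> topspace (pts X) \<subseteq> \<Union>\<F>"
    using compact[unfolded compact_space_alt, rule_format, of \<U>] by simp
  then obtain \<F> where \<F>: "finite \<F>" "\<F> \<subseteq> \<U>" "topspace (pts X) \<subseteq> \<Union>\<F>"
    by (elim exE conjE)
  have "\<forall>V\<in>\<F>. \<exists>k. \<forall>W. opn W \<and> W \<subseteq> V \<longrightarrow> power_image m n W \<subseteq> T k W"
  proof
    fix V assume "V \<in> \<F>"
    with \<F>(2) have "V \<in> \<U>" by (rule subsetD)
    then show "\<exists>k. \<forall>W. opn W \<and> W \<subseteq> V \<longrightarrow> power_image m n W \<subseteq> T k W"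
      unfolding \<U>_def mem_Collect_eq by (rule conjunct2)
  qed
  then have "\<exists>\<kappa>. \<forall>V\<in>\<F>. \<forall>W. opn W \<and> W \<subseteq> V \<longrightarrow> power_image m n W \<subseteq> T (\<kappa> V) W" by (rule bchoice)
  then obtain \<kappa> where "\<forall>V\<in>\<F>. \<forall>W. opn W \<and> W \<subseteq> V \<longrightarrow> power_image m n W \<subseteq> T (\<kappa> V) W"
    by (elim exE)
  note \<kappa> = this[rule_format, OF _ conjI]
  \<comment> \<open>The value \<open>0\<close> only serves the empty cover of the empty space.\<close>
  define k where "k = Max (insert 0 (\<kappa> ` \<F>))"
  have k: "\<kappa> V \<le> k" if "V \<in> \<F>" for V unfolding k_def using \<F>(1) that by (intro Max_ge) auto
  have "cl (power_image m n) \<le> cl (T k)"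
  proof (rule closure_le_locally[OF subpresheaf_power_image])
    fix x assume "x \<in> topspace (pts X)"
    then obtain V where V: "V \<in> \<F>" "x \<in> V" using \<F>(3) by blast
    then have o: "opn V" using \<F>(2) by (auto simp: \<U>_def)
    have "cl (power_image m n) W \<subseteq> cl (T k) W" if W: "opn W" "W \<subseteq> V" for W
      using \<kappa>[OF V(1) W] T_mono[OF k[OF V(1)], of W] unfolding T_def closure_power_image by (rule subset_trans)
    then show "\<exists>G. opn G \<and> x \<in> G \<and> (\<forall>U. opn U \<and> U \<subseteq> G \<longrightarrow>
        cl (power_image m n) U \<subseteq> cl (T k) U)"
      using V(2) o by (intro exI[of _ V]) simp
  qed
  then show ?thesis unfolding T_def closure_power_image by blast
qed

end

section \<open>Comparison of the two kinds of jumping numbers\<close>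

lemma Fp_scheme_char:
  assumes "Fp_scheme p X" "openin (pts X) U"
  shows "[p] \<cdot>\<^bsub>sec X U\<^esub> \<one>\<^bsub>sec X U\<^esub> = \<zero>\<^bsub>sec X U\<^esub>"
proof -
  let ?A = "sec X (topspace (pts X))"
  have rs: "is_ringed_space X" and p0: "[p] \<cdot>\<^bsub>?A\<^esub> \<one>\<^bsub>?A\<^esub> = \<zero>\<^bsub>?A\<^esub>"
    using assms(1) by (auto simp: Fp_scheme_def is_scheme_def Let_def)
  interpret A: cring ?A using rs by (simp add: is_ringed_space_def)
  interpret B: cring "sec X U" using rs assms(2) by (simp add: is_ringed_space_def)
  interpret ring_hom_cring ?A "sec X U" "res X (topspace (pts X)) U"
    using rs assms(2) openin_subset[OF assms(2)] by unfold_locales (simp add: is_ringed_space_def)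
  have "res X (topspace (pts X)) U ([n] \<cdot>\<^bsub>?A\<^esub> \<one>\<^bsub>?A\<^esub>) = [n] \<cdot>\<^bsub>sec X U\<^esub> \<one>\<^bsub>sec X U\<^esub>" for n :: nat
    by (induction n) simp_all
  from this[of p] show ?thesis by (simp add: p0)
qed

theorem theorem2p31:
  fixes p q e :: nat
    and X :: "('a, 'r) ringed_space"
    and I :: "'a set \<Rightarrow> 'r set"
    and M :: "('a, 'r, 'm) module_sheaf"
    and C :: "'a set \<Rightarrow> 'm \<Rightarrow> 'm"
  assumes "Factorial_Ring.prime p"
    and "e > 0" and "q = p ^ e"
    and "noetherian_scheme X" and "Fp_scheme p X" and "F_finite p X"
    and "quasi_coherent_ideal X I" and "locally_principal X I"
    and "F_pure q X M C"
  shows "(Zp_of_rat p -` nu_inf p q X M C I (whole M) \<inter> (Z_loc p \<inter> {-1..<0}) =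
      uminus ` (real_of_rat -` FJN_minus q X M C I \<inter> Z_loc p \<inter> {0<..1})) \<and>
    (\<zero>\<^bsub>Zp p\<^esub> \<in> nu_inf p q X M C I (whole M) \<longleftrightarrow> 0 \<in> FJN_plus q X M C I)"
proof -
  have p0: "p > 0" using assms(1) by (simp add: prime_gt_0_nat)
  have rs: "is_ringed_space X" using assms(4) by (simp add: noetherian_scheme_def is_scheme_def)
  have ideal: "ideal_sheaf X I" using assms(7) by (simp add: quasi_coherent_ideal_def)
  have cartier: "cartier_module q X M C" and coh: "coherent X M"
    and pure: "\<And>U. openin (pts X) U \<Longrightarrow> cartier_image X M C 1 (whole M) U = whole M U"
    using assms(9) by (auto simp: F_pure_def)
  have ms: "is_module_sheaf X M" using cartier by (simp add: cartier_module_def)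
  interpret S: finite_cartier_sheaf X M q C I p e
    using rs ms cartier ideal assms(8) pure assms(1) Fp_scheme_char[OF assms(5)] assms(3)
    by unfold_locales auto
  have compact: "compact_space (pts X)" by (rule S.compact_space_noetherian_scheme[OF assms(4)])
  interpret J: jumping_family p q e S.power_image "test_module q X M C I"
  proof unfold_locales
    show "test_module q X M C I t \<le> test_module q X M C I s" if "0 \<le> s" "s \<le> t" for s t
      using that(2) by (rule S.test_module_antimono)
    show "test_module q X M C I (real n / real q ^ m) = S.power_image m n" for n m
      using p0 by (intro S.test_module_fraction) (simp add: assms(3))
    show "S.power_image (m + j) (n + k * q ^ m) = S.power_image (m + j) (n + k * q ^ m + 1)"
      if "S.power_image m n = S.power_image m (n + 1)" for m n j k using that by (rule S.power_image_shift)
    show "\<exists>k. S.power_image m n \<le> S.power_image k (nat \<lceil>t * real q ^ k\<rceil>)"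
      if "0 \<le> t" "S.power_image m n \<le> test_module q X M C I t" for t m n
      by (rule S.test_module_attained[OF compact coh assms(6) that(2)])
  qed fact+
  have nu: "n \<in> nu X M C I m (whole M) \<longleftrightarrow> S.power_image m n \<noteq> S.power_image m (n + 1)" for n m
    by (simp add: nu_def S.power_image_def)
  have qm: "q ^ m = p ^ (e * m)" for m by (simp add: assms(3) power_mult)
  have negative: "Zp_of_rat p r \<in> nu_inf p q X M C I (whole M) \<longleftrightarrow> real_of_rat (- r) \<in> FJN_minus q X M C I"
    if r: "r \<in> Z_loc p" "-1 \<le> r" "r < 0" for r
  proof -
    obtain a' b' where ab': "quotient_of r = (a', b')" by (cases "quotient_of r")
    have b'0: "b' > 0" and cop': "coprime a' b'" and r_eq: "r = of_int a' / of_int b'"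
      using ab' by (auto simp: quotient_of_denom_pos quotient_of_coprime quotient_of_div)
    define a b where "a = nat (- a')" and "b = nat b'"
    have a'0: "a' < 0" using r(3) b'0 by (simp add: r_eq divide_less_0_iff)
    have "- a' \<le> b'" using r(2) b'0 by (simp add: r_eq le_divide_eq flip: of_int_minus)
    then have ab: "0 < a" "a \<le> b" "a' = - int a" "b' = int b" using a'0 b'0 by (auto simp: a_def b_def)
    have pb: "\<not> p dvd b" using r(1) ab' ab by (simp add: Z_loc_def)
    have cop: "coprime a b" using cop' ab by simp
    have t: "real_of_rat (- r) = real a / real b" by (simp add: r_eq ab of_rat_divide of_rat_minus)
    have "Zp_of_rat p r \<in> nu_inf p q X M C I (whole M) \<longleftrightarrow>
        (\<forall>m\<ge>1. \<exists>n. S.power_image m n \<noteq> S.power_image m (n + 1) \<and> q ^ m dvd a + b * n)"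
    proof -
      have "int p ^ (e * m) dvd a' - b' * int n \<longleftrightarrow> q ^ m dvd a + b * n" for m n
      proof -
        have "a' - b' * int n = - int (a + b * n)" by (simp add: ab)
        then have "int p ^ (e * m) dvd a' - b' * int n \<longleftrightarrow> int (q ^ m) dvd int (a + b * n)"
          by (simp only: dvd_minus_iff qm of_nat_power)
        then show ?thesis by (simp only: int_dvd_int_iff)
      qed
      then show ?thesis
        unfolding nu_inf_def qm mem_Collect_eq Bex_def[of "nu X M C I _ (whole M)"] nu
        using Zp_of_rat(1)[OF assms(1) r(1) ab'] Zp_of_rat_dvd_iff[OF assms(1) r(1) ab']
        by (simp add: qm)
    qed
    also have "\<dots> \<longleftrightarrow> real_of_rat (- r) \<in> FJN_minus q X M C I"
      using J.residues_iff[OF ab(1,2) pb cop t] ab by (simp add: FJN_minus_def t)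
    finally show ?thesis .
  qed
  have Z_loc_minus: "- r \<in> Z_loc p \<longleftrightarrow> r \<in> Z_loc p" for r
    by (simp add: Z_loc_def rat_uminus_code split: prod.split)
  have "Zp_of_rat p -` nu_inf p q X M C I (whole M) \<inter> (Z_loc p \<inter> {-1..<0}) =
      uminus ` (real_of_rat -` FJN_minus q X M C I \<inter> Z_loc p \<inter> {0<..1})"
  proof (rule Set.set_eqI)
    fix r :: rat
    have "r \<in> uminus ` (real_of_rat -` FJN_minus q X M C I \<inter> Z_loc p \<inter> {0<..1}) \<longleftrightarrow>
      - r \<in> real_of_rat -` FJN_minus q X M C I \<inter> Z_loc p \<inter> {0<..1}"
      by (metis (no_types, lifting) add.inverse_inverse imageE image_eqI)
    then show "r \<in> Zp_of_rat p -` nu_inf p q X M C I (whole M) \<inter> (Z_loc p \<inter> {-1..<0}) \<longleftrightarrow>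
      r \<in> uminus ` (real_of_rat -` FJN_minus q X M C I \<inter> Z_loc p \<inter> {0<..1})"
      using negative[of r] by (auto simp: Z_loc_minus)
  qed
  moreover have "\<zero>\<^bsub>Zp p\<^esub> \<in> nu_inf p q X M C I (whole M) \<longleftrightarrow> 0 \<in> FJN_plus q X M C I"
  proof -
    have z: "\<zero>\<^bsub>Zp p\<^esub> \<in> carrier (Zp p)"
      using abelian_group.axioms(1)[OF Zp_abelian_group[OF p0]] by (rule abelian_monoid.zero_closed)
    have "int p ^ (e * m) dvd \<zero>\<^bsub>Zp p\<^esub> (e * m) - int n \<longleftrightarrow> q ^ m dvd n" for m n
    proof -
      have "\<zero>\<^bsub>Zp p\<^esub> (e * m) - int n = - int n" by (simp add: Zp_simps)
      then have "int p ^ (e * m) dvd \<zero>\<^bsub>Zp p\<^esub> (e * m) - int n \<longleftrightarrow> int (q ^ m) dvd int n"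
        by (simp only: dvd_minus_iff qm of_nat_power)
      then show ?thesis by (simp only: int_dvd_int_iff)
    qed
    then have "\<zero>\<^bsub>Zp p\<^esub> \<in> nu_inf p q X M C I (whole M) \<longleftrightarrow>
        (\<forall>m\<ge>1. \<exists>n. S.power_image m n \<noteq> S.power_image m (n + 1) \<and> q ^ m dvd n)"
      unfolding nu_inf_def qm mem_Collect_eq Bex_def[of "nu X M C I _ (whole M)"] nu
      using z Zp_dvd_iff[OF p0 z] by (simp add: qm)
    also have "\<dots> \<longleftrightarrow> (\<forall>m\<ge>1. \<exists>k. S.power_image m (k * q ^ m) \<noteq> S.power_image m (k * q ^ m + 1))"
      by (metis dvd_def dvd_triv_right mult.commute)
    also have "\<dots> \<longleftrightarrow> 0 \<in> FJN_plus q X M C I"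
      unfolding J.multiples_of_q_iff by (simp add: FJN_plus_def)
    finally show ?thesis .
  qed
  ultimately show ?thesis by blast
qed

end
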